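(* Let $\Omega,\Lambda\subset\mathbb{R}^n$ be bounded open sets with $0\in\Omega$ and $\Lambda$ convex, and let $f\in C^0(\overline{\Omega})$, $g\in C^0(\overline{\Lambda})$ be positive functions bounded away from zero and infinity with $\int_\Omega f\,dx=\int_\Lambda g\,dx$. Let $\{\{S_i^{(k)}\}_{i=1}^{M(k)}\}_{k\in\mathbb{N}}$ be an admissible sequence of almost-triangulations of $\overline\Omega$. Consider either the LDMAOP for every $k$, or the DMAOP for every $k$, and suppose that the optimal cost of the $k$-th problem tends to zero as $k\to\infty$. Let $\phi^{(k)}$ be the optimization potential associated with a solution of the $k$-th problem. Then, as $k\to\infty$, $\phi^{(k)}$ converges uniformly on $\overline{\Omega}$ to the unique Brenier solution $\varphi$, with $\varphi(0)=0$, of the Monge--Ampère equation $$\det(\nabla^2\varphi(x))=\frac{f(x)}{g(\nabla\varphi(x))},\ x\in\Omega,\qquad \partial\varphi(\Omega)\subset\overline\Lambda .$$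
   Context: **Brenier solution.** $\varphi$ is the convex function (finite on $\mathbb{R}^n$, with $\partial\varphi(\mathbb{R}^n)\subset\overline\Lambda$, $\varphi(0)=0$) such that $(\nabla\varphi)_\#\mu=\nu$, where $\mu=f\,dx$ on $\Omega$ and $\nu=g\,dx$ on $\Lambda$; $\nabla\varphi$ is the optimal transport map from $\mu$ to $\nu$ for the quadratic cost. **Almost-triangulation.** Points $x_1,\dots,x_N\in\overline\Omega$ and $n$-dimensional simplices $S_1,\dots,S_M\subset\overline\Omega$ whose set of vertices is exactly $\{x_j\}_{j=1}^N$, such that any two of the $S_i$ intersect in the empty set or a common face (of any dimension), and $\overline\Omega\setminus\bigcup_iS_i$ has "small" volume (for sequences this is quantified by admissibility). The vertices of $S_i$ are $x_{i_0},\dots,x_{i_n}$, and $V_i=\mathrm{vol}(S_i)$. Given $\eta_1,\dots,\eta_N\in\mathbb{R}^n$, let $A_i$ (resp. $B_i$) be the $n\times n$ matrix whose $j$-th row is $(x_{i_j}-x_{i_0})^T$ (resp. $(\eta_{i_j}-\eta_{i_0})^T$), $j=1,\dots,n$, and $H_i=\frac12A_i^{-1}B_i+\frac12(A_i^{-1}B_i)^T$. **LDMAOP.** Minimize over $\{\psi_i\in\mathbb{R},\eta_i\in\mathbb{R}^n\}_{i=1}^N$ the cost $$\sum_{i=1}^M V_i\max\Big\{0,-\log\det H_i-\log g\Big(\tfrac{1}{n+1}\sum_{j=0}^n\eta_{i_j}\Big)+\log f\Big(\tfrac1{n+1}\sum_{j=0}^nx_{i_j}\Big)\Big\}$$ subject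 to $\psi_j\ge\psi_i+\langle\eta_i,x_j-x_i\rangle$ for all $i,j=1,\dots,N$; $\eta_i\in\overline\Lambda$ for all $i=1,\dots,N$; and $H_i>0$ (positive definite) for all $i=1,\dots,M$. **DMAOP.** The same, with the cost replaced by $$\sum_{i=1}^M V_i\max\Big\{0,-(\det H_i)^{1/n}+\Big(f\Big(\tfrac1{n+1}\sum_{j=0}^nx_{i_j}\Big)\Big/g\Big(\tfrac{1}{n+1}\sum_{j=0}^n\eta_{i_j}\Big)\Big)^{1/n}\Big\}$$ and the last constraint replaced by $H_i\ge0$ (positive semidefinite). The optimal cost is the minimum value; a solution is a minimizer. **Optimization potential.** For a solution $\{\psi_j,\eta_j\}_{j=1}^N$, put $a_j(x)=\psi_j+\langle\eta_j,x-x_j\rangle$ and $\phi(x)=b+\max_{j}a_j(x)$, $x\in\mathbb{R}^n$, with $b\in\mathbb{R}$ chosen so that $\phi(0)=0$. All objects of the $k$-th almost-triangulation carry a superscript $(k)$. **Admissible sequence.** A sequence of almost-triangulations is admissible if $\lim_{k}\max_i\mathrm{diam}\,S_i^{(k)}=0$ and there are open sets $\Omega_\varepsilon\subset\Omega$, $\varepsilon>0$, with $\Omega_\varepsilon\subset\Omega_{\varepsilon'}$ for $\varepsilon'\le\varepsilon$, $\bigcup_{\varepsilon>0}\Omega_\varepsilon=\Omega$, and, for every sufficiently small $\varepsilon>0$, $\Omega_\varepsilon+B_\varepsilon(0)\subset\bigcup_{i}S_i^{(k)}$ for all $k$ sufficiently large. *)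

theory Defs
  imports "HOL-Analysis.Analysis"
begin

section \<open>Convex analysis and Brenier solutions\<close>

definition subdifferential :: "('a::real_inner \<Rightarrow> real) \<Rightarrow> 'a \<Rightarrow> 'a set" where
  "subdifferential \<phi> x = {p. \<forall>y. \<phi> y \<ge> \<phi> x + p \<bullet> (y - x)}"

text \<open>
  At a point of non-differentiability, \<open>gradient \<phi> x\<close> is an unspecified constant that does not
  depend on \<open>x\<close>. A convex function on the whole space is differentiable Lebesgue-almost everywhere,
  so this value does not affect the push-forward of an absolutely continuous measure.
\<close>

definition gradient :: "('a::real_inner \<Rightarrow> real) \<Rightarrow> 'a \<Rightarrow> 'a" where
  "gradient \<phi> x = (THE p. GDERIV \<phi> x :> p)"

definition density_on :: "'a::euclidean_space set \<Rightarrow> ('a \<Rightarrow> real) \<Rightarrow> 'a measure" where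
  "density_on S h = density lborel (\<lambda>x. ennreal (h x) * indicator S x)"

text \<open>
  The normalised weak solution, in the sense of Brenier, of
  \<open>det (\<nabla>\<^sup>2 \<phi>) = f / (g \<circ> \<nabla>\<phi>)\<close> in \<open>\<Omega>\<close> with \<open>\<partial>\<phi>(\<Omega>) \<subseteq> closure \<Lambda>\<close>: the equation is expressed by
  \<open>\<nabla>\<phi>\<close> pushing \<open>f dx\<close> on \<open>\<Omega>\<close> forward to \<open>g dx\<close> on \<open>\<Lambda>\<close>, and the
  subdifferential constraint is imposed on the whole space.
\<close>

definition brenier_solution ::
  "'a::euclidean_space set \<Rightarrow> 'a set \<Rightarrow> ('a \<Rightarrow> real) \<Rightarrow> ('a \<Rightarrow> real) \<Rightarrow> ('a \<Rightarrow> real) \<Rightarrow> bool" where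
  "brenier_solution \<Omega> \<Lambda> f g \<phi> \<longleftrightarrow>
     convex_on UNIV \<phi> \<and>
     (\<Union>x. subdifferential \<phi> x) \<subseteq> closure \<Lambda> \<and>
     \<phi> 0 = 0 \<and>
     distr (density_on \<Omega> f) borel (gradient \<phi>) = density_on \<Lambda> g"


section \<open>Almost-triangulations\<close>

text \<open>
  Points and simplices are indexed from 0, by \<open>{..<npts T}\<close> and \<open>{..<nsimp T}\<close>. The \<open>n + 1\<close>
  vertices of a simplex are indexed by \<open>'n option\<close>: the base vertex \<open>x\<^bsub>i\<^sub>0\<^esub>\<close> is
  \<open>pt T (vert T i None)\<close>, and \<open>Some j\<close> stands for the remaining indices \<open>j = 1, \<dots>, n\<close>,
  which are also the row indices of the matrices \<open>A\<^sub>i\<close> and \<open>B\<^sub>i\<close>.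
\<close>

record ('n::finite) simplices =
  npts :: nat
  nsimp :: nat
  pt :: "nat \<Rightarrow> real ^ 'n"
  vert :: "nat \<Rightarrow> 'n option \<Rightarrow> nat"

definition cell :: "'n::finite simplices \<Rightarrow> nat \<Rightarrow> (real ^ 'n) set" where
  "cell T i = convex hull (range (\<lambda>j. pt T (vert T i j)))"

definition almost_triangulation :: "(real ^ 'n::finite) set \<Rightarrow> 'n simplices \<Rightarrow> bool" where
  "almost_triangulation \<Omega> T \<longleftrightarrow>
     0 < nsimp T \<and>
     inj_on (pt T) {..<npts T} \<and>
     inj_on (cell T) {..<nsimp T} \<and>
     (\<forall>j<npts T. pt T j \<in> closure \<Omega>) \<and>
     (\<forall>i<nsimp T. range (vert T i) \<subseteq> {..<npts T} \<and> inj (vert T i) \<and>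
        \<not> affine_dependent (range (\<lambda>j. pt T (vert T i j))) \<and>
        cell T i \<subseteq> closure \<Omega>) \<and>
     (\<Union>i<nsimp T. range (\<lambda>j. pt T (vert T i j))) = pt T ` {..<npts T} \<and>
     (\<forall>i<nsimp T. \<forall>l<nsimp T. cell T i \<inter> cell T l = {} \<or>
        cell T i \<inter> cell T l face_of cell T i \<and> cell T i \<inter> cell T l face_of cell T l)"

definition admissible :: "(real ^ 'n::finite) set \<Rightarrow> (nat \<Rightarrow> 'n simplices) \<Rightarrow> bool" where
  "admissible \<Omega> T \<longleftrightarrow>
     (\<forall>k. almost_triangulation \<Omega> (T k)) \<and>
     (\<lambda>k. MAX i\<in>{..<nsimp (T k)}. diameter (cell (T k) i)) \<longlonglongrightarrow> 0 \<and>
     (\<exists>\<Omega>' :: real \<Rightarrow> (real ^ 'n) set.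
        (\<forall>\<epsilon>>0. open (\<Omega>' \<epsilon>) \<and> \<Omega>' \<epsilon> \<subseteq> \<Omega>) \<and>
        (\<forall>\<epsilon>>0. \<forall>\<delta>>0. \<delta> \<le> \<epsilon> \<longrightarrow> \<Omega>' \<epsilon> \<subseteq> \<Omega>' \<delta>) \<and>
        (\<Union>\<epsilon>\<in>{0<..}. \<Omega>' \<epsilon>) = \<Omega> \<and>
        (\<forall>\<^sub>F \<epsilon> in at_right 0. \<forall>\<^sub>F k in sequentially.
           {x + y |x y. x \<in> \<Omega>' \<epsilon> \<and> y \<in> ball 0 \<epsilon>} \<subseteq> (\<Union>i<nsimp (T k). cell (T k) i)))"


section \<open>The discrete optimization problems\<close>

definition volume :: "'n::finite simplices \<Rightarrow> nat \<Rightarrow> real" where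
  "volume T i = measure lebesgue (cell T i)"

definition edge_matrix ::
  "'n::finite simplices \<Rightarrow> (nat \<Rightarrow> real ^ 'n) \<Rightarrow> nat \<Rightarrow> real ^ 'n ^ 'n" where
  "edge_matrix T z i = (\<chi> j. z (vert T i (Some j)) - z (vert T i None))"

definition hess :: "'n::finite simplices \<Rightarrow> (nat \<Rightarrow> real ^ 'n) \<Rightarrow> nat \<Rightarrow> real ^ 'n ^ 'n" where
  "hess T \<eta> i =
     (let G = matrix_inv (edge_matrix T (pt T) i) ** edge_matrix T \<eta> i
      in (1/2) *\<^sub>R G + (1/2) *\<^sub>R transpose G)"

definition vertex_mean :: "'n::finite simplices \<Rightarrow> (nat \<Rightarrow> real ^ 'n) \<Rightarrow> nat \<Rightarrow> real ^ 'n" where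
  "vertex_mean T z i = (1 / (real CARD('n) + 1)) *\<^sub>R (\<Sum>j\<in>UNIV. z (vert T i j))"

definition pos_def :: "real ^ 'n ^ 'n::finite \<Rightarrow> bool" where
  "pos_def H \<longleftrightarrow> transpose H = H \<and> (\<forall>v. v \<noteq> 0 \<longrightarrow> v \<bullet> (H *v v) > 0)"

definition pos_semidef :: "real ^ 'n ^ 'n::finite \<Rightarrow> bool" where
  "pos_semidef H \<longleftrightarrow> transpose H = H \<and> (\<forall>v. v \<bullet> (H *v v) \<ge> 0)"

text \<open>
  The unknowns are functions on all of \<open>nat\<close>, but only their values on \<open>{..<npts T}\<close> enter the
  constraints and the costs.
\<close>

definition discrete_convex ::
  "(real ^ 'n::finite) set \<Rightarrow> 'n simplices \<Rightarrow> (nat \<Rightarrow> real) \<Rightarrow> (nat \<Rightarrow> real ^ 'n) \<Rightarrow> bool" where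
  "discrete_convex \<Lambda> T \<psi> \<eta> \<longleftrightarrow>
     (\<forall>i<npts T. \<forall>j<npts T. \<psi> j \<ge> \<psi> i + \<eta> i \<bullet> (pt T j - pt T i)) \<and>
     (\<forall>i<npts T. \<eta> i \<in> closure \<Lambda>)"

definition ldmaop_feasible ::
  "(real ^ 'n::finite) set \<Rightarrow> 'n simplices \<Rightarrow> (nat \<Rightarrow> real) \<times> (nat \<Rightarrow> real ^ 'n) \<Rightarrow> bool" where
  "ldmaop_feasible \<Lambda> T = (\<lambda>(\<psi>, \<eta>). discrete_convex \<Lambda> T \<psi> \<eta> \<and> (\<forall>i<nsimp T. pos_def (hess T \<eta> i)))"

definition ldmaop_cost ::
  "(real ^ 'n::finite \<Rightarrow> real) \<Rightarrow> (real ^ 'n \<Rightarrow> real) \<Rightarrow> 'n simplices \<Rightarrow>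
     (nat \<Rightarrow> real) \<times> (nat \<Rightarrow> real ^ 'n) \<Rightarrow> real" where
  "ldmaop_cost f g T = (\<lambda>(\<psi>, \<eta>).
     \<Sum>i<nsimp T. volume T i *
       max 0 (- ln (det (hess T \<eta> i)) - ln (g (vertex_mean T \<eta> i)) + ln (f (vertex_mean T (pt T) i))))"

definition dmaop_feasible ::
  "(real ^ 'n::finite) set \<Rightarrow> 'n simplices \<Rightarrow> (nat \<Rightarrow> real) \<times> (nat \<Rightarrow> real ^ 'n) \<Rightarrow> bool" where
  "dmaop_feasible \<Lambda> T = (\<lambda>(\<psi>, \<eta>). discrete_convex \<Lambda> T \<psi> \<eta> \<and> (\<forall>i<nsimp T. pos_semidef (hess T \<eta> i)))"

definition dmaop_cost ::
  "(real ^ 'n::finite \<Rightarrow> real) \<Rightarrow> (real ^ 'n \<Rightarrow> real) \<Rightarrow> 'n simplices \<Rightarrow>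
     (nat \<Rightarrow> real) \<times> (nat \<Rightarrow> real ^ 'n) \<Rightarrow> real" where
  "dmaop_cost f g T = (\<lambda>(\<psi>, \<eta>).
     \<Sum>i<nsimp T. volume T i *
       max 0 (- root CARD('n) (det (hess T \<eta> i))
              + root CARD('n) (f (vertex_mean T (pt T) i) / g (vertex_mean T \<eta> i))))"

text \<open>This is the minimum of the cost whenever a minimizer exists.\<close>

definition optimal_cost :: "('b \<Rightarrow> real) \<Rightarrow> ('b \<Rightarrow> bool) \<Rightarrow> real" where
  "optimal_cost cost feasible = (INF z\<in>{z. feasible z}. cost z)"

definition max_affine ::
  "'n::finite simplices \<Rightarrow> (nat \<Rightarrow> real) \<times> (nat \<Rightarrow> real ^ 'n) \<Rightarrow> real ^ 'n \<Rightarrow> real" where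
  "max_affine T = (\<lambda>(\<psi>, \<eta>) x. MAX j\<in>{..<npts T}. \<psi> j + \<eta> j \<bullet> (x - pt T j))"

definition optimization_potential ::
  "'n::finite simplices \<Rightarrow> (nat \<Rightarrow> real) \<times> (nat \<Rightarrow> real ^ 'n) \<Rightarrow> real ^ 'n \<Rightarrow> real" where
  "optimization_potential T z x = (let b = - max_affine T z 0 in b + max_affine T z x)"

end

theory Submission
  imports Defs "HOL-Complex_Analysis.Great_Picard"
begin

text \<open>
  The potentials \<open>\<phi>\<^sub>k\<close> of the discrete problems are equi-Lipschitz, so by compactness and uniqueness of the
  Brenier solution it suffices that every pointwise limit \<open>\<phi>\<close> is a Brenier solution. Interpolating the
  discrete gradients affinely on the simplices gives maps \<open>G\<^sub>k\<close> that, after adding a small multiple of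
  the identity, are strictly monotone and hence injective on convex sets covered by the simplices. Since
  \<open>\<bar>det DG\<^sub>k\<bar> \<ge> det H\<close> for the symmetric part \<open>H\<close> of \<open>DG\<^sub>k\<close>, the vanishing cost bounds the \<open>f\<close>-mass of a
  convex compact \<open>K \<subseteq> \<Omega>\<close> by the \<open>g\<close>-mass of \<open>G\<^sub>k(K)\<close> up to \<open>o(1)\<close>. Limit points of \<open>G\<^sub>k(K)\<close> are subgradients
  of \<open>\<phi>\<close> on \<open>K\<close>, i.e. almost all of them are mapped into \<open>K\<close> by the gradient of the conjugate \<open>\<phi>\<^sup>*\<close>. Hence
  \<open>\<mu> \<le> (\<nabla>\<phi>\<^sup>*)\<^sub># \<nu>\<close>, with equality because the total masses agree, and \<open>\<nabla>\<phi>\<close> inverts \<open>\<nabla>\<phi>\<^sup>*\<close> almost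
  everywhere. Uniqueness is the duality argument: two Brenier potentials have the same gradient almost
  everywhere on \<open>\<Omega>\<close>, hence common subgradients that are dense in \<open>\<Lambda>\<close>, and the convexity of \<open>\<Lambda>\<close>
  fixes the potentials up to a constant even if \<open>\<Omega>\<close> is disconnected.
\<close>

section \<open>Differentiability of convex functions\<close>

text \<open>The costs penalise only determinants that are too small, so cell by cell only one
  inequality between masses is available. Three obstacles shape the limit. First, the injectivity
  argument follows segments, so masses can be compared only on convex compact sets covered by the
  simplices; a Vitali covering by disjoint closed balls passes to open sets. Second, the cost
  evaluates \<open>g\<close> at the mean of the vertex gradients, whereas the mass of an image sees
  \<open>g\<close> all over it. The gradients need not be close to each other on every cell, but
  near a differentiability point of \<open>\<phi>\<close> they eventually are, so cells with large
  oscillation carry vanishing \<open>f\<close>-mass. Third, the tilt pushes images slightly out of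
  \<open>closure \<Lambda>\<close>, so \<open>g\<close> is extended continuously to a ball.
  Conjugates are taken over the compact set \<open>closure \<Omega>\<close> only: suprema are then
  attained, gradients of the conjugate lie in \<open>closure \<Omega>\<close>, and at a
  differentiability point in \<open>\<Omega>\<close> a subgradient relative to
  \<open>closure \<Omega>\<close> is still the gradient.\<close>

lemma lipschitz_on_if_diff_le:
  fixes f :: "'a::real_normed_vector \<Rightarrow> real"
  assumes "\<And>x y. f x - f y \<le> L * norm (x - y)" "L \<ge> 0"
  shows "L-lipschitz_on A f"
proof (rule lipschitz_onI)
  fix x y show "dist (f x) (f y) \<le> L * dist x y"
    using assms(1)[of x y] assms(1)[of y x] by (simp add: dist_norm norm_minus_commute abs_le_iff)
qed fact

text \<open>A hyperplane separating the open vertical ray below \<open>(x, \<phi> x)\<close> from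
  the epigraph cannot be vertical, because \<open>\<phi>\<close> is finite on the whole space; its
  slope is the subgradient.\<close>

lemma subdifferential_nonempty:
  fixes \<phi> :: "'a::euclidean_space \<Rightarrow> real"
  assumes "convex_on UNIV \<phi>"
  obtains p where "p \<in> subdifferential \<phi> x"
proof -
  let ?S = "{x} \<times> {..< \<phi> x}" and ?T = "epigraph UNIV \<phi>"
  have "convex ?S" by (intro convex_Times) auto
  moreover have "convex ?T" using assms by (simp add: convex_epigraph)
  moreover have "(x, \<phi> x - 1) \<in> ?S" by simp
  then have "?S \<noteq> {}" by blast
  moreover have "?T \<noteq> {}" by (auto simp: epigraph_def)
  moreover have "?S \<inter> ?T = {}" by (auto simp: epigraph_def)
  ultimately obtain ab \<beta> where ab: "ab \<noteq> 0" "\<forall>u\<in>?S. ab \<bullet> u \<le> \<beta>" "\<forall>u\<in>?T. ab \<bullet> u \<ge> \<beta>"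
    using separating_hyperplane_sets[of ?S ?T] by metis
  obtain a b where [simp]: "ab = (a, b)" by force
  have S: "a \<bullet> x + b * r \<le> \<beta>" if "r < \<phi> x" for r
    using ab(2) that by (auto simp: inner_Pair)
  have T: "a \<bullet> w + b * s \<ge> \<beta>" if "s \<ge> \<phi> w" for w s
    using ab(3) that by (auto simp: inner_Pair epigraph_def)
  \<comment> \<open>The graph point itself lies in the epigraph and had to be left out of
    \<open>?S\<close>; it is recovered from below by a limit.\<close>
  have S': "a \<bullet> x + b * \<phi> x \<le> \<beta>"
  proof (rule tendsto_upperbound[OF _ _ trivial_limit_at_left_real])
    show "((\<lambda>r. a \<bullet> x + b * r) \<longlongrightarrow> a \<bullet> x + b * \<phi> x) (at_left (\<phi> x))"
      by (intro tendsto_intros)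
    show "\<forall>\<^sub>F r in at_left (\<phi> x). a \<bullet> x + b * r \<le> \<beta>"
      using S by (auto simp: eventually_at_filter)
  qed
  have "b \<ge> 0"
    using S[of "\<phi> x - 1"] T[of x "\<phi> x"] by (simp add: algebra_simps)
  moreover have "b \<noteq> 0"
  proof
    assume "b = 0"
    then have *: "a \<bullet> w \<ge> a \<bullet> x" for w
      using S' T[of w "\<phi> w"] by simp
    from *[of "x - a"] have "a \<bullet> a \<le> 0" by (simp add: inner_diff_right)
    then have "a = 0" by (metis inner_eq_zero_iff inner_ge_zero order_antisym)
    then show False using \<open>b = 0\<close> ab(1) by (simp add: zero_prod_def)
  qed
  ultimately have b: "b > 0" by simp
  have "- (a /\<^sub>R b) \<in> subdifferential \<phi> x"
    unfolding subdifferential_def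
  proof safe
    fix y
    have "a \<bullet> y + b * \<phi> y \<ge> a \<bullet> x + b * \<phi> x"
      using S' T[of y "\<phi> y"] by simp
    then show "\<phi> y \<ge> \<phi> x + - (a /\<^sub>R b) \<bullet> (y - x)"
      using b by (simp add: field_simps inner_diff_right)
  qed
  then show ?thesis using that by blast
qed

lemma lipschitz_if_subdifferential_bounded:
  fixes \<phi> :: "'a::euclidean_space \<Rightarrow> real"
  assumes "convex_on UNIV \<phi>" "\<And>x p. p \<in> subdifferential \<phi> x \<Longrightarrow> norm p \<le> L"
  shows "L-lipschitz_on UNIV \<phi>"
proof -
  have 1: "\<phi> x - \<phi> y \<le> L * norm (x - y)" for x y
  proof -
    obtain p where p: "p \<in> subdifferential \<phi> x"
      using subdifferential_nonempty[OF assms(1)] .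
    then have "\<phi> y \<ge> \<phi> x + p \<bullet> (y - x)" by (auto simp: subdifferential_def)
    then have "\<phi> x - \<phi> y \<le> p \<bullet> (x - y)" by (simp add: inner_diff_right)
    also have "\<dots> \<le> norm p * norm (x - y)" by (rule norm_cauchy_schwarz)
    also have "\<dots> \<le> L * norm (x - y)" by (intro mult_right_mono assms(2)[OF p]) auto
    finally show ?thesis .
  qed
  obtain p where "p \<in> subdifferential \<phi> 0"
    using subdifferential_nonempty[OF assms(1)] .
  then have "L \<ge> 0" using assms(2) norm_ge_zero order_trans by blast
  show ?thesis by (rule lipschitz_on_if_diff_le) fact+
qed

lemma gradient_eqI: "GDERIV \<phi> x :> p \<Longrightarrow> gradient \<phi> x = p"
  unfolding gradient_def
proof (rule the_equality)
  fix q assume "GDERIV \<phi> x :> p" "GDERIV \<phi> x :> q"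
  then have "(\<lambda>h. h \<bullet> p) = (\<lambda>h. h \<bullet> q)"
    unfolding gderiv_def by (rule has_derivative_unique)
  then have "(q - p) \<bullet> p = (q - p) \<bullet> q" by (rule fun_cong)
  then have "(q - p) \<bullet> (q - p) = 0" by (simp add: inner_diff_right)
  then show "q = p" by simp
qed

text \<open>Testing at distance \<open>s\<close> from \<open>x\<close> in the direction of
  \<open>q - p\<close>, where the linearisation error is at most \<open>e / 2 * s\<close>, turns a
  slack of \<open>e / 2 * s\<close> into the bound \<open>e\<close>. Slack and the restriction to
  \<open>W\<close> appear because discrete gradients are only approximate subgradients against
  points of \<open>closure \<Omega>\<close>.\<close>

lemma approx_subgradient_near_gradient:
  fixes \<phi> :: "'a::real_inner \<Rightarrow> real"
  assumes "GDERIV \<phi> x :> p" "x \<in> interior W" "e > 0"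
  obtains \<tau> where "\<tau> > 0"
    "\<And>q. (\<And>w. w \<in> W \<Longrightarrow> \<phi> w \<ge> \<phi> x + q \<bullet> (w - x) - \<tau>) \<Longrightarrow> norm (q - p) \<le> e"
proof -
  from assms(1) have "(\<phi> has_derivative (\<lambda>h. h \<bullet> p)) (at x)" by (simp add: gderiv_def)
  then obtain d where d: "d > 0"
    "\<And>w. norm (w - x) < d \<Longrightarrow> \<bar>\<phi> w - \<phi> x - (w - x) \<bullet> p\<bar> \<le> e / 2 * norm (w - x)"
    using assms(3) unfolding has_derivative_at_alt
    by (metis half_gt_zero real_norm_def)
  obtain r where r: "r > 0" "ball x r \<subseteq> W"
    using assms(2) mem_interior by blast
  define s where "s = min d r / 2"
  have s: "s > 0" "s < d" "s < r" using d r by (auto simp: s_def)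
  show ?thesis
  proof (rule that)
    show "e / 2 * s > 0" using s assms(3) by simp
    fix q assume q: "\<And>w. w \<in> W \<Longrightarrow> \<phi> w \<ge> \<phi> x + q \<bullet> (w - x) - e / 2 * s"
    show "norm (q - p) \<le> e"
    proof (cases "q = p")
      case False
      define u where "u = (q - p) /\<^sub>R norm (q - p)"
      have u: "norm u = 1" "(q - p) \<bullet> u = norm (q - p)"
        using False by (simp_all add: u_def dot_square_norm power2_eq_square)
      define w where "w = x + s *\<^sub>R u"
      have w: "norm (w - x) = s" using u s by (simp add: w_def)
      have "w \<in> W" using r w s by (auto simp: dist_norm norm_minus_commute subset_iff)
      have "\<phi> w - \<phi> x - (w - x) \<bullet> p \<le> e / 2 * s"
        using d(2)[of w] s(2) unfolding w by linarith
      with q[OF \<open>w \<in> W\<close>] have "(q - p) \<bullet> (w - x) \<le> e * s"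
        by (simp add: inner_diff_left inner_commute field_simps)
      then have "s * norm (q - p) \<le> e * s" using u(2) by (simp add: w_def)
      then show ?thesis using s by (simp add: mult.commute)
    qed (use assms in auto)
  qed
qed

lemma local_subgradient_eq_gradient:
  fixes \<phi> :: "'a::real_inner \<Rightarrow> real"
  assumes "GDERIV \<phi> x :> p" "x \<in> interior W" "\<And>w. w \<in> W \<Longrightarrow> \<phi> w \<ge> \<phi> x + q \<bullet> (w - x)"
  shows "q = p"
proof -
  have "norm (q - p) \<le> 0 + e" if e: "e > 0" for e
  proof -
    obtain \<tau> where "\<tau> > 0"
      "\<And>q. (\<And>w. w \<in> W \<Longrightarrow> \<phi> w \<ge> \<phi> x + q \<bullet> (w - x) - \<tau>) \<Longrightarrow> norm (q - p) \<le> e"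
      using approx_subgradient_near_gradient[OF assms(1,2) e] by blast
    moreover have "\<phi> w \<ge> \<phi> x + q \<bullet> (w - x) - \<tau>" if "w \<in> W" for w
      using assms(3)[OF that] \<open>\<tau> > 0\<close> by linarith
    ultimately show ?thesis by simp
  qed
  then have "norm (q - p) \<le> 0" by (rule field_le_epsilon)
  then show ?thesis by simp
qed

section \<open>Differentiability almost everywhere through second difference quotients\<close>

definition second_diff :: "('a::real_vector \<Rightarrow> real) \<Rightarrow> 'a \<Rightarrow> nat \<Rightarrow> 'a \<Rightarrow> real" where
  "second_diff \<phi> e k x =
     real (Suc k) * (\<phi> (x + e /\<^sub>R real (Suc k)) + \<phi> (x - e /\<^sub>R real (Suc k)) - 2 * \<phi> x)"

text \<open>For convex \<open>\<phi>\<close> the quotient is nonnegative and nondecreasing in the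
  step, so a single small value replaces a limit. The countable quantifiers make the set Borel and
  its complement a countable union of sets on which the quotients along one axis stay above a fixed
  bound for all \<open>k\<close>.\<close>

definition smooth_points :: "('a::euclidean_space \<Rightarrow> real) \<Rightarrow> 'a set" where
  "smooth_points \<phi> = {x. \<forall>e\<in>Basis. \<forall>m. \<exists>k. second_diff \<phi> e k x < 1 / real (Suc m)}"

text \<open>The remainder \<open>\<theta>\<close> below is convex and nonnegative, so smallness along the coordinate axes
  propagates to all directions.\<close>

lemma smooth_points_GDERIV:
  fixes \<phi> :: "'a::euclidean_space \<Rightarrow> real"
  assumes cvx: "convex_on UNIV \<phi>" and p: "p \<in> subdifferential \<phi> x" and x: "x \<in> smooth_points \<phi>"
  shows "GDERIV \<phi> x :> p"
proof -
  define \<theta> where "\<theta> v = \<phi> (x + v) - \<phi> x - p \<bullet> v" for v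
  have \<theta>0: "\<theta> v \<ge> 0" for v
  proof -
    have "\<phi> (x + v) \<ge> \<phi> x + p \<bullet> (x + v - x)" using p unfolding subdifferential_def by blast
    then show ?thesis by (simp add: \<theta>_def)
  qed
  have \<theta>z: "\<theta> 0 = 0" by (simp add: \<theta>_def)
  have \<theta>c: "convex_on UNIV \<theta>"
  proof (rule convex_onI)
    fix t :: real and v w :: 'a assume t: "0 < t" "t < 1"
    have "\<phi> ((1 - t) *\<^sub>R (x + v) + t *\<^sub>R (x + w)) \<le> (1 - t) * \<phi> (x + v) + t * \<phi> (x + w)"
      using convex_onD[OF cvx] t by simp
    moreover have "(1 - t) *\<^sub>R (x + v) + t *\<^sub>R (x + w) = x + ((1 - t) *\<^sub>R v + t *\<^sub>R w)"
      by (simp add: algebra_simps)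
    ultimately show "\<theta> ((1 - t) *\<^sub>R v + t *\<^sub>R w) \<le> (1 - t) * \<theta> v + t * \<theta> w"
      by (simp add: \<theta>_def algebra_simps)
  qed simp
  have axis: "\<exists>r>0. \<forall>e\<in>Basis. \<forall>s. \<bar>s\<bar> \<le> r \<longrightarrow> \<theta> (s *\<^sub>R e) \<le> \<epsilon> * \<bar>s\<bar>" if "\<epsilon> > 0" for \<epsilon>
  proof -
    have "\<exists>r>0. \<forall>s. \<bar>s\<bar> \<le> r \<longrightarrow> \<theta> (s *\<^sub>R e) \<le> \<epsilon> * \<bar>s\<bar>" if e: "e \<in> Basis" for e
    proof -
      obtain m where m: "1 / real (Suc m) < \<epsilon>" using \<open>\<epsilon> > 0\<close> nat_approx_posE by blast
      obtain k where "second_diff \<phi> e k x < 1 / real (Suc m)"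
        using x e by (auto simp: smooth_points_def)
      with m have k: "second_diff \<phi> e k x < \<epsilon>" by linarith
      define h where "h = 1 / real (Suc k)"
      have h: "h > 0" by (simp add: h_def)
      have eq: "second_diff \<phi> e k x = (\<theta> (h *\<^sub>R e) + \<theta> ((-h) *\<^sub>R e)) / h"
      proof -
        have "e /\<^sub>R real (Suc k) = h *\<^sub>R e" "real (Suc k) = 1 / h"
          by (simp_all add: h_def inverse_eq_divide)
        then have "second_diff \<phi> e k x = 1 / h * (\<phi> (x + h *\<^sub>R e) + \<phi> (x - h *\<^sub>R e) - 2 * \<phi> x)"
          unfolding second_diff_def by simp
        then show ?thesis by (simp add: \<theta>_def)
      qed
      have b: "\<theta> (h *\<^sub>R e) \<le> \<epsilon> * h" "\<theta> ((-h) *\<^sub>R e) \<le> \<epsilon> * h"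
        using k h \<theta>0[of "h *\<^sub>R e"] \<theta>0[of "(-h) *\<^sub>R e"] unfolding eq by (auto simp: field_simps)
      have "\<theta> (s *\<^sub>R e) \<le> \<epsilon> * \<bar>s\<bar>" if s: "\<bar>s\<bar> \<le> h" for s
      proof -
        \<comment> \<open>The end point of the axis segment on the same side as \<open>s\<close>;
          convexity and \<open>\<theta> 0 = 0\<close> carry the bound at step \<open>h\<close> to
          all shorter steps.\<close>
        define a where "a = (if s \<ge> 0 then h else -h)"
        have ab: "\<theta> (a *\<^sub>R e) \<le> \<epsilon> * h" using b by (simp add: a_def)
        have a: "s = (\<bar>s\<bar> / h) * a" using h by (simp add: a_def)
        have "\<theta> ((1 - \<bar>s\<bar>/h) *\<^sub>R 0 + (\<bar>s\<bar>/h) *\<^sub>R (a *\<^sub>R e)) \<le> (1 - \<bar>s\<bar>/h) * \<theta> 0 + (\<bar>s\<bar>/h) * \<theta> (a *\<^sub>R e)"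
          by (rule convex_onD[OF \<theta>c]) (use s h in auto)
        also have "(1 - \<bar>s\<bar>/h) *\<^sub>R 0 + (\<bar>s\<bar>/h) *\<^sub>R (a *\<^sub>R e) = s *\<^sub>R e"
          using a by simp
        also have "(1 - \<bar>s\<bar>/h) * \<theta> 0 + (\<bar>s\<bar>/h) * \<theta> (a *\<^sub>R e) \<le> (\<bar>s\<bar>/h) * (\<epsilon> * h)"
          unfolding \<theta>z using mult_left_mono[OF ab, of "\<bar>s\<bar>/h"] h by simp
        also have "\<dots> = \<epsilon> * \<bar>s\<bar>" using h by simp
        finally show ?thesis .
      qed
      then show ?thesis using h by blast
    qed
    then obtain r where r: "\<And>e. e \<in> Basis \<Longrightarrow> r e > 0 \<and> (\<forall>s. \<bar>s\<bar> \<le> r e \<longrightarrow> \<theta> (s *\<^sub>R e) \<le> \<epsilon> * \<bar>s\<bar>)"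
      by metis
    have "Min (r ` Basis) > 0" using r by simp
    moreover have "\<theta> (s *\<^sub>R e) \<le> \<epsilon> * \<bar>s\<bar>" if "e \<in> Basis" "\<bar>s\<bar> \<le> Min (r ` Basis)" for e s
    proof -
      have "Min (r ` Basis) \<le> r e" using that by simp
      with that r show ?thesis by (meson order_trans)
    qed
    ultimately show ?thesis by blast
  qed
  define n where "n = real DIM('a)"
  have n: "n > 0" by (simp add: n_def)
  \<comment> \<open>Jensen: \<open>v\<close> is the mean over the basis of its components stretched
    by \<open>n\<close>. This is why the axis bound is taken with \<open>\<epsilon> / n\<close> and
    the radius is \<open>r / n\<close>.\<close>
  have \<theta>sum: "\<theta> v \<le> (\<Sum>e\<in>Basis. \<theta> ((n * (v \<bullet> e)) *\<^sub>R e)) / n" for v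
  proof -
    have "\<theta> (\<Sum>e\<in>Basis. (1/n) *\<^sub>R ((n * (v \<bullet> e)) *\<^sub>R e)) \<le> (\<Sum>e\<in>Basis. (1/n) * \<theta> ((n * (v \<bullet> e)) *\<^sub>R e))"
      by (rule convex_on_sum[OF _ _ \<theta>c]) (use n in \<open>auto simp: n_def\<close>)
    also have "(\<Sum>e\<in>Basis. (1/n) *\<^sub>R ((n * (v \<bullet> e)) *\<^sub>R e)) = v"
      using n by (simp add: euclidean_representation)
    finally show ?thesis by (simp add: sum_divide_distrib)
  qed
  show ?thesis
    unfolding gderiv_def has_derivative_at_alt
  proof (intro conjI allI impI)
    show "bounded_linear (\<lambda>h. h \<bullet> p)" by (rule bounded_linear_inner_left)
    fix \<epsilon> :: real assume \<epsilon>: "\<epsilon> > 0"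
    then have "\<epsilon> / n > 0" using n by simp
    from axis[OF this] obtain r where r: "r > 0"
      "\<And>e s. e \<in> Basis \<Longrightarrow> \<bar>s\<bar> \<le> r \<Longrightarrow> \<theta> (s *\<^sub>R e) \<le> \<epsilon> / n * \<bar>s\<bar>" by blast
    have "norm (\<phi> y - \<phi> x - (y - x) \<bullet> p) \<le> \<epsilon> * norm (y - x)" if y: "norm (y - x) < r / n" for y
    proof -
      let ?v = "y - x"
      have "\<theta> ((n * (?v \<bullet> e)) *\<^sub>R e) \<le> \<epsilon> * norm ?v" if e: "e \<in> Basis" for e
      proof -
        have *: "\<bar>?v \<bullet> e\<bar> \<le> norm ?v" by (rule Basis_le_norm[OF e])
        have **: "\<bar>n * (?v \<bullet> e)\<bar> = n * \<bar>?v \<bullet> e\<bar>" using n by (simp add: abs_mult)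
        have "n * \<bar>?v \<bullet> e\<bar> \<le> r" using y n * by (simp add: field_simps) (meson less_imp_le order_trans mult_left_mono)
        then have "\<theta> ((n * (?v \<bullet> e)) *\<^sub>R e) \<le> \<epsilon> / n * (n * \<bar>?v \<bullet> e\<bar>)"
          using r(2)[OF e, of "n * (?v \<bullet> e)"] ** by simp
        also have "\<dots> \<le> \<epsilon> * norm ?v" using n * \<epsilon> by simp
        finally show ?thesis .
      qed
      then have "(\<Sum>e\<in>Basis. \<theta> ((n * (?v \<bullet> e)) *\<^sub>R e)) \<le> n * (\<epsilon> * norm ?v)"
        unfolding n_def by (rule sum_bounded_above)
      then have "\<theta> ?v \<le> \<epsilon> * norm ?v"
        using order_trans[OF \<theta>sum[of ?v] divide_right_mono, of "n * (\<epsilon> * norm ?v)"] n by simp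
      then show ?thesis
        using \<theta>0[of ?v] by (simp add: \<theta>_def inner_commute)
    qed
    then show "\<exists>d>0. \<forall>y. norm (y - x) < d \<longrightarrow> norm (\<phi> y - \<phi> x - (y - x) \<bullet> p) \<le> \<epsilon> * norm (y - x)"
      using r(1) n by (intro exI[of _ "r / n"]) auto
  qed
qed

lemma GDERIV_difference_quotient:
  fixes \<phi> :: "'a::euclidean_space \<Rightarrow> real"
  assumes "GDERIV \<phi> x :> p"
  shows "(\<lambda>k. real (Suc k) * (\<phi> (x + e /\<^sub>R real (Suc k)) - \<phi> x)) \<longlonglongrightarrow> p \<bullet> e"
proof -
  have D: "(\<phi> has_derivative (\<lambda>h. h \<bullet> p)) (at x)" using assms by (simp add: gderiv_def)
  have g: "((\<lambda>t. x + t *\<^sub>R e) has_derivative (\<lambda>t. t *\<^sub>R e)) (at 0)"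
    by (auto intro!: derivative_eq_intros)
  have "((\<lambda>t. \<phi> (x + t *\<^sub>R e)) has_derivative (\<lambda>t. (t *\<^sub>R e) \<bullet> p)) (at 0)"
    using diff_chain_at[OF g, of \<phi> "\<lambda>h. h \<bullet> p"] D by (simp add: o_def)
  then have "((\<lambda>t. \<phi> (x + t *\<^sub>R e)) has_field_derivative (e \<bullet> p)) (at 0)"
    by (simp add: has_field_derivative_def mult_commute_abs)
  then have L: "((\<lambda>t. (\<phi> (x + t *\<^sub>R e) - \<phi> x) / t) \<longlongrightarrow> e \<bullet> p) (at 0)"
    by (simp add: has_field_derivative_iff)
  have "filterlim (\<lambda>k. 1 / real (Suc k)) (at 0) sequentially"
    unfolding filterlim_at using LIMSEQ_inverse_real_of_nat
    by (auto simp: inverse_eq_divide)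
  from filterlim_compose[OF L this] show ?thesis
    by (simp add: inner_commute inverse_eq_divide mult.commute)
qed

lemma smooth_points_iff:
  fixes \<phi> :: "'a::euclidean_space \<Rightarrow> real"
  assumes cvx: "convex_on UNIV \<phi>"
  shows "x \<in> smooth_points \<phi> \<longleftrightarrow> (\<exists>p. GDERIV \<phi> x :> p)"
proof
  assume "x \<in> smooth_points \<phi>"
  then show "\<exists>p. GDERIV \<phi> x :> p"
    using smooth_points_GDERIV[OF cvx] subdifferential_nonempty[OF cvx] by metis
next
  assume "\<exists>p. GDERIV \<phi> x :> p"
  then obtain p where p: "GDERIV \<phi> x :> p" ..
  have "(\<lambda>k. second_diff \<phi> e k x) \<longlonglongrightarrow> 0" for e
    using tendsto_add[OF GDERIV_difference_quotient[OF p, of e] GDERIV_difference_quotient[OF p, of "-e"]]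
    by (simp add: second_diff_def algebra_simps)
  then have "\<forall>\<^sub>F k in sequentially. second_diff \<phi> e k x < 1 / real (Suc m)" for e m
    by (rule order_tendstoD) simp
  then show "x \<in> smooth_points \<phi>"
    unfolding smooth_points_def using eventually_happens[of _ sequentially] by (auto simp del: of_nat_Suc)
qed

lemma subgradient_is_gradient:
  fixes \<phi> :: "'a::euclidean_space \<Rightarrow> real"
  assumes "convex_on UNIV \<phi>" "x \<in> smooth_points \<phi>" "p \<in> subdifferential \<phi> x"
  shows "GDERIV \<phi> x :> p" "gradient \<phi> x = p"
  using smooth_points_GDERIV[OF assms(1,3,2)] by (auto intro: gradient_eqI)

lemma gradient_in_subdifferential:
  fixes \<phi> :: "'a::euclidean_space \<Rightarrow> real"
  assumes "convex_on UNIV \<phi>" "x \<in> smooth_points \<phi>"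
  shows "gradient \<phi> x \<in> subdifferential \<phi> x" "GDERIV \<phi> x :> gradient \<phi> x"
  using subgradient_is_gradient[OF assms] subdifferential_nonempty[OF assms(1), of x] by metis+

lemma continuous_convex_UNIV:
  fixes \<phi> :: "'a::euclidean_space \<Rightarrow> real"
  assumes "convex_on UNIV \<phi>"
  shows "continuous_on A \<phi>"
  using convex_on_continuous[OF open_UNIV assms] continuous_on_subset by blast

lemma borel_measurable_convex:
  fixes \<phi> :: "'a::euclidean_space \<Rightarrow> real"
  assumes "convex_on UNIV \<phi>"
  shows "\<phi> \<in> borel_measurable borel"
  by (intro borel_measurable_continuous_onI continuous_convex_UNIV assms)

lemma smooth_points_borel:
  fixes \<phi> :: "'a::euclidean_space \<Rightarrow> real"
  assumes "convex_on UNIV \<phi>"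
  shows "smooth_points \<phi> \<in> sets borel"
proof -
  have [measurable]: "\<phi> \<in> borel_measurable borel" by (rule borel_measurable_convex[OF assms])
  have [measurable]: "second_diff \<phi> e k \<in> borel_measurable borel" for e k
    unfolding second_diff_def by measurable
  have "smooth_points \<phi> = (\<Inter>e\<in>Basis. \<Inter>m. \<Union>k. {x\<in>space borel. second_diff \<phi> e k x < 1 / real (Suc m)})"
    by (auto simp: smooth_points_def)
  also have "\<dots> \<in> sets borel"
    by (intro sets.countable_INT'' sets.countable_UN sets.finite_INT) (auto intro: measurable_sets)
  finally show ?thesis .
qed

lemma borel_measurable_gradient:
  fixes \<phi> :: "'a::euclidean_space \<Rightarrow> real"
  assumes "convex_on UNIV \<phi>"
  shows "gradient \<phi> \<in> borel_measurable borel"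
proof -
  note [measurable] = borel_measurable_convex[OF assms] smooth_points_borel[OF assms]
  define q where "q e x = lim (\<lambda>k. real (Suc k) * (\<phi> (x + e /\<^sub>R real (Suc k)) - \<phi> x))" for e x
  have [measurable]: "q e \<in> borel_measurable borel" for e
    unfolding q_def by (intro borel_measurable_lim_metric) measurable
  \<comment> \<open>At every point without a gradient the description in \<open>gradient\<close> has
    an unsatisfiable body, so its value is this one constant.\<close>
  define c :: 'a where "c = (THE p. False)"
  have "gradient \<phi> = (\<lambda>x. if x \<in> smooth_points \<phi> then (\<Sum>e\<in>Basis. q e x *\<^sub>R e) else c)"
  proof
    fix x
    show "gradient \<phi> x = (if x \<in> smooth_points \<phi> then (\<Sum>e\<in>Basis. q e x *\<^sub>R e) else c)"
    proof (cases "x \<in> smooth_points \<phi>")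
      case True
      have "q e x = gradient \<phi> x \<bullet> e" for e
        using GDERIV_difference_quotient[OF gradient_in_subdifferential(2)[OF assms True]]
        by (simp add: q_def limI)
      then show ?thesis using True by (simp add: euclidean_representation)
    next
      case False
      then have "\<And>p. \<not> GDERIV \<phi> x :> p" using smooth_points_iff[OF assms] by blast
      then show ?thesis using False by (simp add: gradient_def c_def)
    qed
  qed
  also have "\<dots> \<in> borel_measurable borel" by measurable
  finally show ?thesis .
qed

lemma lborel_integral_shift:
  fixes F :: "'a::euclidean_space \<Rightarrow> real"
  assumes [measurable]: "F \<in> borel_measurable borel"
  shows "(\<integral>x. F (x + c) \<partial>lborel) = (\<integral>x. F x \<partial>lborel)"
proof -
  have "(\<integral>x. F x \<partial>lborel) = (\<integral>x. F x \<partial>distr lborel borel ((+) c))"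
    by (simp add: lborel_distr_plus)
  also have "\<dots> = (\<integral>x. F (c + x) \<partial>lborel)"
    by (rule integral_distr) auto
  finally show ?thesis by (simp add: add.commute)
qed

lemma integrable_lborel_compact_support:
  fixes F :: "'a::euclidean_space \<Rightarrow> real"
  assumes "continuous_on UNIV F" "compact S" "\<And>x. x \<notin> S \<Longrightarrow> F x = 0"
  shows "integrable lborel F"
proof -
  have "integrable lborel (\<lambda>x. indicator S x *\<^sub>R F x)"
    using assms(1,2) by (intro borel_integrable_compact) (auto intro: continuous_on_subset)
  also have "(\<lambda>x. indicator S x *\<^sub>R F x) = F"
    using assms(3) by (auto simp: indicator_def fun_eq_iff)
  finally show ?thesis .
qed

text \<open>Testing the second difference quotient against a Lipschitz cutoff \<open>cut\<close> and shifting one difference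
  onto \<open>cut\<close> bounds its integral by a multiple of the step size.\<close>

lemma second_diff_large_null:
  fixes \<phi> :: "'a::euclidean_space \<Rightarrow> real"
  assumes cvx: "convex_on UNIV \<phi>" and lip: "L-lipschitz_on UNIV \<phi>" and e: "e \<in> Basis" and R: "R \<ge> 0"
    and \<epsilon>: "\<epsilon> > 0"
  shows "{x \<in> cball 0 R. \<forall>k. second_diff \<phi> e k x \<ge> \<epsilon>} \<in> null_sets lborel" (is "?N \<in> _")
proof -
  have cont: "continuous_on A \<phi>" for A by (rule continuous_convex_UNIV[OF cvx])
  have [measurable]: "\<phi> \<in> borel_measurable borel" by (rule borel_measurable_convex[OF cvx])
  have [measurable]: "second_diff \<phi> e k \<in> borel_measurable borel" for k
    unfolding second_diff_def by measurable
  have contsd: "continuous_on UNIV (second_diff \<phi> e k)" for k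
    unfolding second_diff_def by (intro continuous_intros continuous_on_compose2[OF cont[of UNIV]]) auto
  define cut where "cut x = max 0 (R + 1 - norm x)" for x :: 'a
  have cont_cut: "continuous_on A cut" for A
    unfolding cut_def by (intro continuous_intros)
  have [measurable]: "cut \<in> borel_measurable borel"
    by (intro borel_measurable_continuous_onI cont_cut)
  define V where "V = measure lborel (cball (0::'a) (R + 2))"
  have N: "?N \<in> sets borel" by measurable
  have fin: "emeasure lborel ?N < \<infinity>"
    by (rule emeasure_bounded_finite[OF bounded_subset[OF bounded_cball[of 0 R]]]) auto
  have bound: "measure lborel ?N * \<epsilon> \<le> L * V / real (Suc k)" for k
  proof -
    define h where "h = 1 / real (Suc k)"
    have h: "0 < h" "h \<le> 1" by (auto simp: h_def)
    define v where "v = h *\<^sub>R e"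
    have v: "norm v = h" using e h by (simp add: v_def)
    \<comment> \<open>The forward difference quotient: it is bounded by \<open>L\<close>, and the
      second difference is \<open>D x - D (x - v)\<close>, which is ready for summation by
      parts.\<close>
    define D where "D x = (\<phi> (x + v) - \<phi> x) / h" for x
    have contD: "continuous_on A D" for A
      unfolding D_def using h by (intro continuous_intros continuous_on_compose2[OF cont[of UNIV]]) auto
    have [measurable]: "D \<in> borel_measurable borel"
      by (intro borel_measurable_continuous_onI contD)
    have DL: "\<bar>D x\<bar> \<le> L" for x
      using lipschitz_onD[OF lip, of "x + v" x] v h by (simp add: D_def dist_norm field_simps)
    have sd: "second_diff \<phi> e k x = D x - D (x - v)" for x
    proof -
      have "e /\<^sub>R real (Suc k) = v" "real (Suc k) = 1 / h"
        by (simp_all add: h_def v_def inverse_eq_divide)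
      then have "second_diff \<phi> e k x = 1 / h * (\<phi> (x + v) + \<phi> (x - v) - 2 * \<phi> x)"
        unfolding second_diff_def by simp
      then show ?thesis by (simp add: D_def diff_divide_distrib add_divide_distrib)
    qed
    have sd0: "second_diff \<phi> e k x \<ge> 0" for x
    proof -
      have "\<phi> ((1 - 1/2) *\<^sub>R (x + v) + (1/2) *\<^sub>R (x - v)) \<le> (1 - 1/2) * \<phi> (x + v) + (1/2) * \<phi> (x - v)"
        by (rule convex_onD[OF cvx]) auto
      moreover have "(1 - 1/2) *\<^sub>R (x + v) + (1/2) *\<^sub>R (x - v) = x"
        by (simp add: algebra_simps flip: scaleR_add_left)
      ultimately have "0 \<le> \<phi> (x + v) + \<phi> (x - v) - 2 * \<phi> x" by simp
      then have "0 \<le> (\<phi> (x + v) + \<phi> (x - v) - 2 * \<phi> x) / h" using h by simp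
      then show ?thesis unfolding sd by (simp add: D_def diff_divide_distrib add_divide_distrib)
    qed
    have supp: "cut x = 0" "cut (x + v) = 0" if "x \<notin> cball 0 (R + 2)" for x
    proof -
      have "norm x \<le> norm (x + v) + norm v" using norm_triangle_ineq4[of "x + v" v] by simp
      then show "cut x = 0" "cut (x + v) = 0" using that v h by (auto simp: cut_def)
    qed
    have supp': "cut x = 0" if "x \<notin> cball 0 (R + 1)" for x
      using that by (auto simp: cut_def)
    have cut: "integrable lborel (\<lambda>x. cut x * F x)" if "continuous_on UNIV F" for F
      by (rule integrable_lborel_compact_support[of _ "cball 0 (R + 1)"])
        (use that in \<open>auto intro!: continuous_intros cont_cut simp: supp'\<close>)
    have int1: "integrable lborel (\<lambda>x. cut x * D x)" "integrable lborel (\<lambda>x. cut x * D (x - v))"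
        "integrable lborel (\<lambda>x. cut x * second_diff \<phi> e k x)"
      by (rule cut, intro contD contsd continuous_on_compose2[OF contD[of UNIV]] continuous_intros subset_UNIV)+
    have int2: "integrable lborel (\<lambda>x. cut (x + v) * D x)"
      by (rule integrable_lborel_compact_support[of _ "cball 0 (R + 2)"])
        (auto intro!: continuous_intros contD continuous_on_compose2[OF cont_cut[of UNIV]] simp: supp)
    have int3: "integrable lborel (\<lambda>x. indicator (cball (0::'a) (R + 2)) x * (h * L))"
      by (intro integrable_mult_left integrable_real_indicator) (use emeasure_bounded_finite[OF bounded_cball] in auto)
    have "measure lborel ?N * \<epsilon> = (\<integral>x. indicator ?N x * \<epsilon> \<partial>lborel)"
      using N by simp
    also have "\<dots> \<le> (\<integral>x. cut x * second_diff \<phi> e k x \<partial>lborel)"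
    proof (rule integral_mono)
      show "integrable lborel (\<lambda>x. indicator ?N x * \<epsilon>)"
        using N fin by (intro integrable_mult_left integrable_real_indicator) auto
      fix x :: 'a
      show "indicator ?N x * \<epsilon> \<le> cut x * second_diff \<phi> e k x"
      proof (cases "x \<in> ?N")
        case True
        then have "1 \<le> cut x" "\<epsilon> \<le> second_diff \<phi> e k x" by (auto simp: cut_def)
        then have "1 * \<epsilon> \<le> cut x * second_diff \<phi> e k x"
          using \<epsilon> by (intro mult_mono) auto
        with True show ?thesis by simp
      qed (use sd0[of x] in \<open>auto simp: cut_def indicator_def\<close>)
    qed (rule int1)
    also have "\<dots> = (\<integral>x. cut x * D x \<partial>lborel) - (\<integral>x. cut x * D (x - v) \<partial>lborel)"
      unfolding sd by (subst Bochner_Integration.integral_diff[symmetric]) (use int1 in \<open>auto simp: algebra_simps\<close>)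
    also have "(\<integral>x. cut x * D (x - v) \<partial>lborel) = (\<integral>x. cut (x + v) * D x \<partial>lborel)"
      by (subst lborel_integral_shift[of "\<lambda>x. cut x * D (x - v)" v, symmetric]) auto
    also have "(\<integral>x. cut x * D x \<partial>lborel) - \<dots> = (\<integral>x. (cut x - cut (x + v)) * D x \<partial>lborel)"
      by (subst Bochner_Integration.integral_diff[symmetric]) (use int1 int2 in \<open>auto simp: algebra_simps\<close>)
    also have "\<dots> \<le> (\<integral>x. indicator (cball (0::'a) (R + 2)) x * (h * L) \<partial>lborel)"
    proof (rule integral_mono)
      show "integrable lborel (\<lambda>x. (cut x - cut (x + v)) * D x)"
        using Bochner_Integration.integrable_diff[OF int1(1) int2] by (simp add: algebra_simps)
      fix x :: 'a
      have "norm (x + v) \<le> norm x + norm v" "norm x \<le> norm (x + v) + norm v"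
        using norm_triangle_ineq[of x v] norm_triangle_ineq4[of "x + v" v] by simp_all
      then have "\<bar>cut x - cut (x + v)\<bar> \<le> h" unfolding v by (auto simp: cut_def max_def)
      then have "\<bar>cut x - cut (x + v)\<bar> * \<bar>D x\<bar> \<le> h * L"
        using DL[of x] h by (intro mult_mono) auto
      then have "(cut x - cut (x + v)) * D x \<le> h * L"
        by (simp flip: abs_mult)
      then show "(cut x - cut (x + v)) * D x \<le> indicator (cball (0::'a) (R + 2)) x * (h * L)"
        by (cases "x \<in> cball 0 (R + 2)") (simp_all add: supp)
    qed (rule int3)
    also have "\<dots> = L * V / real (Suc k)" by (simp add: V_def h_def)
    finally show ?thesis .
  qed
  have "(\<lambda>k. L * V / real (Suc k)) \<longlonglongrightarrow> 0"
    using LIMSEQ_Suc[OF lim_const_over_n] by simp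
  then have "measure lborel ?N * \<epsilon> \<le> 0"
    using bound by (intro LIMSEQ_le_const) auto
  then have "measure lborel ?N = 0"
    using \<epsilon> by (simp add: mult_le_0_iff measure_le_0_iff)
  then have "emeasure lborel ?N = 0"
    using fin by (metis ennreal_0 emeasure_eq_ennreal_measure less_irrefl infinity_ennreal_def)
  then show ?thesis using N by (simp add: null_sets_def)
qed

proposition AE_smooth_points:
  fixes \<phi> :: "'a::euclidean_space \<Rightarrow> real"
  assumes "convex_on UNIV \<phi>" "L-lipschitz_on UNIV \<phi>"
  shows "AE x in lborel. x \<in> smooth_points \<phi>"
proof (rule AE_I')
  have "{x \<in> cball 0 (real r). \<forall>k. second_diff \<phi> e k x \<ge> 1 / real (Suc m)} \<in> null_sets lborel"
    if "e \<in> Basis" for e r m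
    by (rule second_diff_large_null[OF assms that]) auto
  then show "(\<Union>e\<in>Basis. \<Union>m. \<Union>r. {x \<in> cball 0 (real r). \<forall>k. second_diff \<phi> e k x \<ge> 1 / real (Suc m)})
      \<in> null_sets lborel"
    by (intro null_sets_UN' null_sets_UN) (auto simp: countable_finite)
  have "\<exists>r. x \<in> cball 0 (real r)" for x :: 'a
    by (simp add: real_arch_simple)
  then show "{x \<in> space lborel. x \<notin> smooth_points \<phi>} \<subseteq>
    (\<Union>e\<in>Basis. \<Union>m. \<Union>r. {x \<in> cball 0 (real r). \<forall>k. second_diff \<phi> e k x \<ge> 1 / real (Suc m)})"
    by (fastforce simp: smooth_points_def not_less simp del: of_nat_Suc)
qed

section \<open>Conjugates and uniqueness of potentials\<close>

text \<open>The Legendre transform of \<open>\<phi>\<close> set to infinity outside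
  \<open>W\<close>. For compact \<open>W\<close> and continuous \<open>\<phi>\<close> it is finite
  everywhere, and its gradients are points of \<open>W\<close>.\<close>

definition conjugate_on :: "'a::real_inner set \<Rightarrow> ('a \<Rightarrow> real) \<Rightarrow> 'a \<Rightarrow> real" where
  "conjugate_on W \<phi> y = (SUP w\<in>W. w \<bullet> y - \<phi> w)"

context
  fixes W :: "'a::euclidean_space set" and \<phi> :: "'a \<Rightarrow> real"
  assumes W: "compact W" "W \<noteq> {}" and cont: "continuous_on W \<phi>"
begin

lemma conjugate_on_attained:
  obtains x where "x \<in> W" "conjugate_on W \<phi> y = x \<bullet> y - \<phi> x" "\<And>w. w \<in> W \<Longrightarrow> w \<bullet> y - \<phi> w \<le> x \<bullet> y - \<phi> x"
proof -
  have "continuous_on W (\<lambda>w. w \<bullet> y - \<phi> w)" by (intro continuous_intros cont)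
  then obtain x where x: "x \<in> W" "\<And>w. w \<in> W \<Longrightarrow> w \<bullet> y - \<phi> w \<le> x \<bullet> y - \<phi> x"
    using continuous_attains_sup[OF W] by blast
  have "conjugate_on W \<phi> y = x \<bullet> y - \<phi> x"
    unfolding conjugate_on_def by (rule cSup_eq_maximum) (use x in auto)
  with x that show ?thesis by blast
qed

lemma conjugate_on_ge: "w \<in> W \<Longrightarrow> conjugate_on W \<phi> y \<ge> w \<bullet> y - \<phi> w"
  by (metis conjugate_on_attained)

text \<open>The equality case of the Fenchel--Young inequality, with subgradients relative to
  \<open>W\<close>.\<close>

lemma conjugate_on_eq_iff:
  assumes "x \<in> W"
  shows "conjugate_on W \<phi> y = x \<bullet> y - \<phi> x \<longleftrightarrow> (\<forall>w\<in>W. \<phi> w \<ge> \<phi> x + y \<bullet> (w - x))"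
proof
  assume eq: "conjugate_on W \<phi> y = x \<bullet> y - \<phi> x"
  show "\<forall>w\<in>W. \<phi> w \<ge> \<phi> x + y \<bullet> (w - x)"
  proof
    fix w assume "w \<in> W"
    from conjugate_on_ge[OF this, of y] eq show "\<phi> w \<ge> \<phi> x + y \<bullet> (w - x)"
      by (simp add: inner_diff_right inner_commute)
  qed
next
  assume *: "\<forall>w\<in>W. \<phi> w \<ge> \<phi> x + y \<bullet> (w - x)"
  obtain z where z: "z \<in> W" "conjugate_on W \<phi> y = z \<bullet> y - \<phi> z" using conjugate_on_attained .
  have "z \<bullet> y - \<phi> z \<le> x \<bullet> y - \<phi> x"
    using * z(1) by (auto simp: inner_diff_right inner_commute)
  with z conjugate_on_ge[OF assms, of y] show "conjugate_on W \<phi> y = x \<bullet> y - \<phi> x" by simp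
qed

lemma conjugate_on_subgradient:
  assumes "x \<in> W" "conjugate_on W \<phi> y = x \<bullet> y - \<phi> x"
  shows "x \<in> subdifferential (conjugate_on W \<phi>) y"
  unfolding subdifferential_def
proof safe
  fix y'
  show "conjugate_on W \<phi> y' \<ge> conjugate_on W \<phi> y + x \<bullet> (y' - y)"
    using conjugate_on_ge[OF assms(1), of y'] assms(2) by (simp add: inner_diff_right)
qed

lemma convex_conjugate_on: "convex_on UNIV (conjugate_on W \<phi>)"
proof (rule convex_onI)
  fix t :: real and y z :: 'a assume t: "0 < t" "t < 1"
  obtain x where x: "x \<in> W"
    "conjugate_on W \<phi> ((1 - t) *\<^sub>R y + t *\<^sub>R z) = x \<bullet> ((1 - t) *\<^sub>R y + t *\<^sub>R z) - \<phi> x"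
    using conjugate_on_attained .
  have "(1 - t) * (x \<bullet> y - \<phi> x) + t * (x \<bullet> z - \<phi> x) \<le> (1 - t) * conjugate_on W \<phi> y + t * conjugate_on W \<phi> z"
    using t conjugate_on_ge[OF x(1)] by (intro add_mono mult_left_mono) auto
  then show "conjugate_on W \<phi> ((1 - t) *\<^sub>R y + t *\<^sub>R z) \<le> (1 - t) * conjugate_on W \<phi> y + t * conjugate_on W \<phi> z"
    unfolding x(2) by (simp add: inner_add_right algebra_simps)
qed simp

lemma lipschitz_conjugate_on:
  assumes "\<And>w. w \<in> W \<Longrightarrow> norm w \<le> R"
  shows "R-lipschitz_on UNIV (conjugate_on W \<phi>)"
proof -
  have 1: "conjugate_on W \<phi> y - conjugate_on W \<phi> z \<le> R * norm (y - z)" for y z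
  proof -
    obtain x where x: "x \<in> W" "conjugate_on W \<phi> y = x \<bullet> y - \<phi> x" using conjugate_on_attained .
    have "conjugate_on W \<phi> y - conjugate_on W \<phi> z \<le> x \<bullet> (y - z)"
      using x conjugate_on_ge[OF x(1), of z] by (simp add: inner_diff_right)
    also have "\<dots> \<le> norm x * norm (y - z)" by (rule norm_cauchy_schwarz)
    also have "\<dots> \<le> R * norm (y - z)" using assms[OF x(1)] by (intro mult_right_mono) auto
    finally show ?thesis .
  qed
  have "R \<ge> 0" using W(2) assms norm_ge_zero order_trans by blast
  show ?thesis by (rule lipschitz_on_if_diff_le) fact+
qed

lemma AE_smooth_points_conjugate_on: "AE y in lborel. y \<in> smooth_points (conjugate_on W \<phi>)"
proof -
  obtain R where "\<And>w. w \<in> W \<Longrightarrow> norm w \<le> R"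
    using compact_imp_bounded[OF W(1)] bounded_iff by blast
  then show ?thesis by (intro AE_smooth_points convex_conjugate_on lipschitz_conjugate_on)
qed

lemma gradient_conjugate_on_eqI:
  assumes "y \<in> smooth_points (conjugate_on W \<phi>)" "x \<in> W" "\<And>w. w \<in> W \<Longrightarrow> \<phi> w \<ge> \<phi> x + y \<bullet> (w - x)"
  shows "gradient (conjugate_on W \<phi>) y = x"
proof (rule subgradient_is_gradient(2)[OF convex_conjugate_on assms(1)])
  show "x \<in> subdifferential (conjugate_on W \<phi>) y"
    using assms by (intro conjugate_on_subgradient) (auto simp: conjugate_on_eq_iff)
qed

lemma gradient_conjugate_on:
  assumes "y \<in> smooth_points (conjugate_on W \<phi>)"
  shows "gradient (conjugate_on W \<phi>) y \<in> W"
    "\<And>w. w \<in> W \<Longrightarrow> \<phi> w \<ge> \<phi> (gradient (conjugate_on W \<phi>) y) + y \<bullet> (w - gradient (conjugate_on W \<phi>) y)"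
proof -
  obtain x where x: "x \<in> W" "conjugate_on W \<phi> y = x \<bullet> y - \<phi> x" using conjugate_on_attained .
  then have *: "\<And>w. w \<in> W \<Longrightarrow> \<phi> w \<ge> \<phi> x + y \<bullet> (w - x)" by (simp add: conjugate_on_eq_iff)
  have "gradient (conjugate_on W \<phi>) y = x" by (rule gradient_conjugate_on_eqI[OF assms x(1) *])
  with x(1) * show "gradient (conjugate_on W \<phi>) y \<in> W"
    "\<And>w. w \<in> W \<Longrightarrow> \<phi> w \<ge> \<phi> (gradient (conjugate_on W \<phi>) y) + y \<bullet> (w - gradient (conjugate_on W \<phi>) y)"
    by auto
qed

end

section \<open>Finite measures with positive continuous density\<close>

locale positive_density =
  fixes S :: "'a::euclidean_space set" and h :: "'a \<Rightarrow> real"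
  assumes bounded_S: "bounded S" and open_S: "open S"
    and cont_h: "continuous_on (closure S) h"
    and bounds_h: "\<exists>c C. 0 < c \<and> (\<forall>x\<in>closure S. c \<le> h x \<and> h x \<le> C)"
begin

abbreviation M where "M \<equiv> density_on S h"

lemma h_pos: "x \<in> closure S \<Longrightarrow> h x > 0"
  using bounds_h less_le_trans by blast

lemma norm_bound:
  obtains R where "R > 0" "\<And>x. x \<in> closure S \<Longrightarrow> norm x \<le> R"
  using bounded_S bounded_closure bounded_pos by metis

lemma compact_closure_S: "compact (closure S)"
  using bounded_S by simp

lemma borel_S [measurable]: "S \<in> sets borel"
  using open_S by simp

lemma borel_measurable_h_indicator [measurable]: "(\<lambda>x. ennreal (h x) * indicator S x) \<in> borel_measurable borel"
proof -
  have "continuous_on S h" using cont_h closure_subset continuous_on_subset by blast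
  then have [measurable]: "(\<lambda>x. indicator S x *\<^sub>R h x) \<in> borel_measurable borel"
    by (rule borel_measurable_continuous_on_indicator[OF borel_S])
  have "(\<lambda>x. ennreal (indicator S x *\<^sub>R h x)) \<in> borel_measurable borel" by measurable
  also have "(\<lambda>x. ennreal (indicator S x *\<^sub>R h x)) = (\<lambda>x. ennreal (h x) * indicator S x)"
    by (auto simp: indicator_def)
  finally show ?thesis .
qed

lemma sets_M [simp, measurable_cong]: "sets M = sets borel"
  and space_M [simp]: "space M = UNIV"
  by (simp_all add: density_on_def)

lemma set_integrable_h: "set_integrable lborel S h"
proof -
  obtain C where C: "\<And>x. x \<in> closure S \<Longrightarrow> h x \<le> C" using bounds_h by blast
  have "continuous_on S h" using cont_h closure_subset continuous_on_subset by blast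
  then have m: "(\<lambda>x. indicator S x *\<^sub>R h x) \<in> borel_measurable borel"
    by (rule borel_measurable_continuous_on_indicator[OF borel_S])
  have fin: "emeasure lborel S < \<infinity>" using bounded_S by (rule emeasure_bounded_finite)
  have "integrable lborel (\<lambda>x. C * indicator S x)"
    using fin by (intro integrable_mult_right integrable_real_indicator) auto
  then show ?thesis unfolding set_integrable_def
  proof (rule Bochner_Integration.integrable_bound)
    show "(\<lambda>x. indicator S x *\<^sub>R h x) \<in> borel_measurable lborel" using m by simp
    show "AE x in lborel. norm (indicator S x *\<^sub>R h x) \<le> norm (C * indicator S x)"
    proof (rule AE_I2)
      fix x show "norm (indicator S x *\<^sub>R h x) \<le> norm (C * indicator S x)"
      proof (cases "x \<in> S")
        case True
        then have "x \<in> closure S" using closure_subset by blast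
        then show ?thesis using True C[of x] h_pos[of x] by simp
      qed simp
    qed
  qed
qed

lemma emeasure_M_UNIV: "emeasure M UNIV = ennreal (LINT x:S|lborel. h x)"
proof -
  have "emeasure M UNIV = (\<integral>\<^sup>+x. ennreal (h x) * indicator S x \<partial>lborel)"
    by (simp add: density_on_def emeasure_density)
  also have "\<dots> = (\<integral>\<^sup>+x. ennreal (indicator S x *\<^sub>R h x) \<partial>lborel)"
    by (intro nn_integral_cong) (simp add: indicator_def)
  also have "\<dots> = ennreal (LINT x:S|lborel. h x)"
    unfolding set_lebesgue_integral_def
  proof (rule nn_integral_eq_integral)
    show "integrable lborel (\<lambda>x. indicator S x *\<^sub>R h x)"
      using set_integrable_h by (simp add: set_integrable_def)
    show "AE x in lborel. 0 \<le> indicator S x *\<^sub>R h x"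
      using h_pos closure_subset[of S] by (auto simp: indicator_def subset_iff less_imp_le)
  qed
  finally show ?thesis .
qed

lemma finite_measure_M: "finite_measure M"
  by (rule finite_measureI) (simp add: emeasure_M_UNIV)

sublocale finite_measure M by (rule finite_measure_M)

lemma AE_M_iff: "(AE x in M. P x) \<longleftrightarrow> (AE x in lborel. x \<in> S \<longrightarrow> P x)"
proof -
  have "(AE x in M. P x) \<longleftrightarrow> (AE x in lborel. ennreal (h x) * indicator S x > 0 \<longrightarrow> P x)"
    unfolding density_on_def by (rule AE_density) simp
  also have "\<dots> \<longleftrightarrow> (AE x in lborel. x \<in> S \<longrightarrow> P x)"
    by (intro AE_cong) (use h_pos closure_subset[of S] in \<open>auto simp: indicator_def subset_iff\<close>)
  finally show ?thesis .
qed

lemma AE_M_in_S: "AE x in M. x \<in> S"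
  by (simp add: AE_M_iff)

lemma AE_M_lborel: "AE x in lborel. P x \<Longrightarrow> AE x in M. P x"
  unfolding AE_M_iff by (auto elim: eventually_mono)

lemma open_charged:
  assumes "open U" "U \<inter> S \<noteq> {}"
  shows "\<not> (AE x in M. x \<notin> U)"
proof
  assume "AE x in M. x \<notin> U"
  then have "AE x in lborel. x \<notin> S \<inter> U" unfolding AE_M_iff by (auto elim: eventually_mono)
  then have "S \<inter> U \<in> null_sets lborel"
    using assms(1) by (subst AE_iff_null_sets) auto
  moreover have "open (S \<inter> U)" using assms open_S by blast
  ultimately show False
    using open_not_negligible[of "S \<inter> U"] assms(2) by (auto simp: negligible_iff_null_sets null_sets_completionI)
qed

end

text \<open>Refining the segment from \<open>snd p\<close> to \<open>snd q\<close> into \<open>N\<close> steps, the monotone sums squeezing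
  \<open>s1\<close> and \<open>s2\<close> telescope to \<open>O(1/N)\<close>.\<close>

lemma common_potential_unique:
  fixes P :: "('a::real_inner \<times> 'a) set"
  assumes "convex C" and dense: "\<And>y e. y \<in> C \<Longrightarrow> e > 0 \<Longrightarrow> \<exists>p\<in>P. norm (snd p - y) \<le> e"
    and C: "\<And>p. p \<in> P \<Longrightarrow> snd p \<in> C" and R: "\<And>p. p \<in> P \<Longrightarrow> norm (fst p) \<le> R"
    and s1: "\<And>p q. p \<in> P \<Longrightarrow> q \<in> P \<Longrightarrow> fst p \<bullet> (snd q - snd p) \<le> s1 q - s1 p"
    and s2: "\<And>p q. p \<in> P \<Longrightarrow> q \<in> P \<Longrightarrow> fst p \<bullet> (snd q - snd p) \<le> s2 q - s2 p"
    and p: "p \<in> P" and q: "q \<in> P"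
  shows "s1 q - s2 q = (s1 p - s2 p :: real)"
proof -
  define d where "d r = s1 r - s2 r" for r
  define v where "v = snd q - snd p"
  have R0: "R \<ge> 0" using R[OF p] norm_ge_zero order_trans by blast
  \<comment> \<open>Both \<open>s1 b - s1 a\<close> and \<open>s2 b - s2 a\<close> lie between
    \<open>fst a \<bullet> (snd b - snd a)\<close> and
    \<open>fst b \<bullet> (snd b - snd a)\<close>, so they differ by at most the length of that
    interval.\<close>
  have step: "\<bar>d b - d a\<bar> \<le> (fst b - fst a) \<bullet> (snd b - snd a)" if "a \<in> P" "b \<in> P" for a b
    using s1[OF that] s2[OF that] s1[OF that(2,1)] s2[OF that(2,1)]
    by (simp add: d_def inner_diff_left inner_diff_right abs_le_iff)
  have bound: "\<bar>d q - d p\<bar> \<le> (2 * R * norm v + 4 * R) / real (Suc m)" for m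
  proof -
    define N where "N = Suc m"
    have N: "real N > 0" by (simp add: N_def)
    define y where "y i = snd p + (real i / real N) *\<^sub>R v" for i
    have "y i \<in> C" if "i \<le> N" for i
    proof -
      have "(1 - real i / real N) *\<^sub>R snd p + (real i / real N) *\<^sub>R snd q \<in> C"
        using \<open>convex C\<close> C[OF p] C[OF q] that N by (intro convexD_alt) auto
      then show ?thesis by (simp add: y_def v_def algebra_simps)
    qed
    \<comment> \<open>Tolerance \<open>1 / N^2\<close>: each of the \<open>N\<close> steps costs at
      most \<open>4 * R / N^2\<close>, which still sums to \<open>4 * R / N\<close>.\<close>
    then have "\<forall>i. \<exists>r. i \<le> N \<longrightarrow> r \<in> P \<and> norm (snd r - y i) \<le> 1 / (real N)^2"
      using dense[of _ "1 / (real N)^2"] N by (metis zero_less_divide_1_iff zero_less_power)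
    then obtain z0 where z0: "\<And>i. i \<le> N \<Longrightarrow> z0 i \<in> P" "\<And>i. i \<le> N \<Longrightarrow> norm (snd (z0 i) - y i) \<le> 1 / (real N)^2"
      by metis
    define z where "z i = (if i = 0 then p else if i = N then q else z0 i)" for i
    have zP: "z i \<in> P" if "i \<le> N" for i using that p q z0(1) by (auto simp: z_def)
    have zy: "norm (snd (z i) - y i) \<le> 1 / (real N)^2" if "i \<le> N" for i
      using that z0(2) N by (auto simp: z_def y_def v_def)
    have "\<bar>d q - d p\<bar> = \<bar>\<Sum>i<N. d (z (Suc i)) - d (z i)\<bar>"
      using N by (subst sum_lessThan_telescope) (simp add: z_def)
    also have "\<dots> \<le> (\<Sum>i<N. (fst (z (Suc i)) - fst (z i)) \<bullet> (snd (z (Suc i)) - snd (z i)))"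
      by (rule order_trans[OF sum_abs sum_mono]) (use step zP in auto)
    also have "\<dots> \<le> (\<Sum>i<N. (fst (z (Suc i)) - fst (z i)) \<bullet> (v /\<^sub>R real N) + 2 * R * (2 / (real N)^2))"
    proof (rule sum_mono)
      fix i assume i: "i \<in> {..<N}"
      define r where "r = (snd (z (Suc i)) - y (Suc i)) - (snd (z i) - y i)"
      have "norm r \<le> norm (snd (z (Suc i)) - y (Suc i)) + norm (snd (z i) - y i)"
        unfolding r_def by (rule norm_triangle_ineq4)
      also have "\<dots> \<le> 1 / (real N)^2 + 1 / (real N)^2"
        using i zy[of i] zy[of "Suc i"] by (intro add_mono) auto
      finally have r: "norm r \<le> 2 / (real N)^2" by simp
      have x: "norm (fst (z (Suc i)) - fst (z i)) \<le> 2 * R"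
        using norm_triangle_ineq4[of "fst (z (Suc i))" "fst (z i)"] R[OF zP[of i]] R[OF zP[of "Suc i"]] i by simp
      have "snd (z (Suc i)) - snd (z i) = v /\<^sub>R real N + r"
        by (simp add: r_def y_def inverse_eq_divide algebra_simps add_divide_distrib)
      moreover have "(fst (z (Suc i)) - fst (z i)) \<bullet> r \<le> 2 * R * (2 / (real N)^2)"
        by (rule order_trans[OF norm_cauchy_schwarz mult_mono]) (use r x R0 in auto)
      ultimately show "(fst (z (Suc i)) - fst (z i)) \<bullet> (snd (z (Suc i)) - snd (z i))
        \<le> (fst (z (Suc i)) - fst (z i)) \<bullet> (v /\<^sub>R real N) + 2 * R * (2 / (real N)^2)"
        by (simp add: inner_add_right)
    qed
    also have "\<dots> = (fst q - fst p) \<bullet> (v /\<^sub>R real N) + real N * (2 * R * (2 / (real N)^2))"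
    proof -
      have "(\<Sum>i<N. fst (z (Suc i)) - fst (z i)) = fst q - fst p"
        using sum_lessThan_telescope[of "\<lambda>i. fst (z i)" N] N by (simp add: z_def)
      then show ?thesis by (simp only: sum.distrib sum_constant card_lessThan flip: inner_sum_left)
    qed
    also have "\<dots> \<le> (2 * R) * norm (v /\<^sub>R real N) + real N * (2 * R * (2 / (real N)^2))"
    proof (intro add_right_mono order_trans[OF norm_cauchy_schwarz] mult_right_mono)
      show "norm (fst q - fst p) \<le> 2 * R"
        using norm_triangle_ineq4[of "fst q" "fst p"] R[OF p] R[OF q] by simp
    qed simp
    also have "\<dots> = (2 * R * norm v + 4 * R) / real N"
      using N by (simp add: field_simps power2_eq_square)
    finally show ?thesis by (simp add: N_def)
  qed
  have "(\<lambda>m. (2 * R * norm v + 4 * R) / real (Suc m)) \<longlonglongrightarrow> 0"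
    using LIMSEQ_Suc[OF lim_const_over_n] by simp
  then have "\<bar>d q - d p\<bar> \<le> 0"
    by (rule LIMSEQ_le_const) (use bound in blast)
  then show ?thesis by (simp add: d_def)
qed

section \<open>Uniqueness of the Brenier solution\<close>

locale mass_transport = src: positive_density \<Omega> f + tgt: positive_density \<Lambda> g
  for \<Omega> \<Lambda> :: "'a::euclidean_space set" and f g :: "'a \<Rightarrow> real" +
  assumes source_nonempty: "\<Omega> \<noteq> {}" and convex_target: "convex \<Lambda>"
    and mass_eq: "(LINT x:\<Omega>|lborel. f x) = (LINT y:\<Lambda>|lborel. g y)"
begin

abbreviation "\<mu> \<equiv> density_on \<Omega> f"
abbreviation "\<nu> \<equiv> density_on \<Lambda> g"

text \<open>Kept apart from the push-forward condition: pointwise limits of the discrete potentials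
  have this property at once.\<close>

definition potential :: "('a \<Rightarrow> real) \<Rightarrow> bool" where
  "potential \<phi> \<longleftrightarrow> convex_on UNIV \<phi> \<and> (\<Union>x. subdifferential \<phi> x) \<subseteq> closure \<Lambda>"

lemma brenier_potential: "brenier_solution \<Omega> \<Lambda> f g \<phi> \<Longrightarrow> potential \<phi>"
  by (simp add: brenier_solution_def potential_def)

lemma potential_convex: "potential \<phi> \<Longrightarrow> convex_on UNIV \<phi>"
  by (simp add: potential_def)

lemma potential_subdifferential: "potential \<phi> \<Longrightarrow> p \<in> subdifferential \<phi> x \<Longrightarrow> p \<in> closure \<Lambda>"
  by (auto simp: potential_def)

lemma closure_source_nonempty: "closure \<Omega> \<noteq> {}"
  using source_nonempty by simp

lemma source_in_interior: "x \<in> \<Omega> \<Longrightarrow> x \<in> interior (closure \<Omega>)"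
  using src.open_S closure_subset interior_maximal by blast

lemma AE_potential_smooth: "potential \<phi> \<Longrightarrow> AE x in lborel. x \<in> smooth_points \<phi>"
proof -
  assume \<phi>: "potential \<phi>"
  obtain L where "\<And>y. y \<in> closure \<Lambda> \<Longrightarrow> norm y \<le> L" using tgt.norm_bound by metis
  with \<phi> show ?thesis
    by (intro AE_smooth_points[of \<phi> L] lipschitz_if_subdifferential_bounded)
      (auto simp: potential_convex potential_subdifferential)
qed

lemma gradient_potential_in_closure:
  assumes "potential \<phi>" "x \<in> smooth_points \<phi>"
  shows "gradient \<phi> x \<in> closure \<Lambda>"
  using gradient_in_subdifferential(1) assms potential_convex potential_subdifferential by metis

text \<open>Kantorovich duality in the form needed here: \<open>\<integral> \<phi>\<^sup>*(\<nabla>\<phi>') d\<mu>\<close> does not depend on the Brenier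
  potential \<open>\<phi>'\<close>, so the Fenchel--Young defects of the two mixed pairs integrate to zero.\<close>

lemma brenier_gradients_agree:
  assumes \<phi>1: "brenier_solution \<Omega> \<Lambda> f g \<phi>1" and \<phi>2: "brenier_solution \<Omega> \<Lambda> f g \<phi>2"
  shows "AE x in \<mu>. x \<in> \<Omega> \<and> x \<in> smooth_points \<phi>1 \<and> x \<in> smooth_points \<phi>2 \<and> gradient \<phi>1 x = gradient \<phi>2 x"
proof -
  define W where "W = closure \<Omega>"
  have W: "compact W" "W \<noteq> {}"
    unfolding W_def by (rule src.compact_closure_S closure_source_nonempty)+
  obtain R where R: "R > 0" "\<And>x. x \<in> closure \<Omega> \<Longrightarrow> norm x \<le> R" using src.norm_bound by metis
  obtain L where L: "L > 0" "\<And>y. y \<in> closure \<Lambda> \<Longrightarrow> norm y \<le> L" using tgt.norm_bound by metis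
  let ?B = "brenier_solution \<Omega> \<Lambda> f g"
  define c where "c \<phi> = conjugate_on W \<phi>" for \<phi> :: "'a \<Rightarrow> real"
  \<comment> \<open>The Fenchel--Young defect of \<open>\<phi>\<close> at the pair formed by
    \<open>x\<close> and the gradient of \<open>\<phi>'\<close>. For \<open>x\<close> in
    \<open>W\<close> it is nonnegative, and zero exactly if that gradient is a subgradient of
    \<open>\<phi>\<close> at \<open>x\<close> relative to \<open>W\<close>.\<close>
  define F where "F \<phi> \<phi>' x = c \<phi> (gradient \<phi>' x) - x \<bullet> gradient \<phi>' x + \<phi> x" for \<phi> \<phi>' x
  have cvx: "convex_on UNIV \<phi>" if "?B \<phi>" for \<phi> using that by (simp add: brenier_solution_def)
  have cW: "continuous_on A \<phi>" if "?B \<phi>" for \<phi> A using continuous_convex_UNIV[OF cvx[OF that]] .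
  have ccvx: "convex_on UNIV (c \<phi>)" if "?B \<phi>" for \<phi>
    unfolding c_def by (rule convex_conjugate_on[OF W cW[OF that]])
  have sm: "AE x in \<mu>. x \<in> \<Omega> \<and> x \<in> smooth_points \<phi>" if "?B \<phi>" for \<phi>
    using src.AE_M_in_S src.AE_M_lborel[OF AE_potential_smooth[OF brenier_potential[OF that]]] by eventually_elim simp
  have m\<phi>: "\<phi> \<in> borel_measurable borel" if "?B \<phi>" for \<phi> by (rule borel_measurable_convex[OF cvx[OF that]])
  have mc: "c \<phi> \<in> borel_measurable borel" if "?B \<phi>" for \<phi> by (rule borel_measurable_convex[OF ccvx[OF that]])
  have mg: "gradient \<phi> \<in> borel_measurable borel" if "?B \<phi>" for \<phi> by (rule borel_measurable_gradient[OF cvx[OF that]])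
  have int1: "integrable \<mu> (\<lambda>x. c \<phi> (gradient \<phi>' x))" if "?B \<phi>" "?B \<phi>'" for \<phi> \<phi>'
  proof -
    note [measurable] = mc[OF that(1)] mg[OF that(2)]
    have "compact (c \<phi> ` closure \<Lambda>)"
      by (intro compact_continuous_image tgt.compact_closure_S continuous_convex_UNIV ccvx that)
    then obtain K where K: "\<And>y. y \<in> closure \<Lambda> \<Longrightarrow> norm (c \<phi> y) \<le> K"
      using compact_imp_bounded bounded_iff by (metis imageI)
    show ?thesis
    proof (rule src.integrable_const_bound)
      show "AE x in \<mu>. norm (c \<phi> (gradient \<phi>' x)) \<le> K"
        using sm[OF that(2)]
        by eventually_elim (use K gradient_potential_in_closure[OF brenier_potential[OF that(2)]] in auto)
    qed measurable
  qed
  have int2: "integrable \<mu> (\<lambda>x. x \<bullet> gradient \<phi> x)" if "?B \<phi>" for \<phi>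
  proof (rule src.integrable_const_bound)
    note [measurable] = mg[OF that]
    show "(\<lambda>x. x \<bullet> gradient \<phi> x) \<in> borel_measurable \<mu>" by measurable
    show "AE x in \<mu>. norm (x \<bullet> gradient \<phi> x) \<le> R * L"
      using sm[OF that]
    proof eventually_elim
      case (elim x)
      then have "norm x \<le> R" using R(2) closure_subset by blast
      moreover have "norm (gradient \<phi> x) \<le> L"
        using elim gradient_potential_in_closure[OF brenier_potential[OF that]] L by auto
      ultimately show ?case
        unfolding real_norm_def
        by (intro order_trans[OF Cauchy_Schwarz_ineq2 mult_mono]) (use R(1) in auto)
    qed
  qed
  have int3: "integrable \<mu> \<phi>" if "?B \<phi>" for \<phi>
  proof -
    have "compact (\<phi> ` closure \<Omega>)"
      by (intro compact_continuous_image src.compact_closure_S cW that)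
    then obtain K where K: "\<And>y. y \<in> closure \<Omega> \<Longrightarrow> norm (\<phi> y) \<le> K"
      using compact_imp_bounded bounded_iff by (metis imageI)
    note [measurable] = m\<phi>[OF that]
    show ?thesis
    proof (rule src.integrable_const_bound)
      show "AE x in \<mu>. norm (\<phi> x) \<le> K"
        using src.AE_M_in_S by eventually_elim (use K closure_subset in blast)
    qed measurable
  qed
  have intF: "integrable \<mu> (F \<phi> \<phi>')" if "?B \<phi>" "?B \<phi>'" for \<phi> \<phi>'
    unfolding F_def by (intro Bochner_Integration.integrable_add Bochner_Integration.integrable_diff int1 int2 int3 that)
  have F0: "AE x in \<mu>. F \<phi> \<phi>' x \<ge> 0" if "?B \<phi>" for \<phi> \<phi>'
    using src.AE_M_in_S
  proof eventually_elim
    case (elim x)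
    then have "x \<in> W" unfolding W_def using closure_subset by blast
    then show ?case
      using conjugate_on_ge[OF W cW[OF that], of x "gradient \<phi>' x"] by (simp add: F_def c_def)
  qed
  \<comment> \<open>The push-forward condition enters this argument here: the integral depends on
    \<open>\<phi>'\<close> only through \<open>\<nu>\<close>.\<close>
  have push: "(\<integral>x. c \<phi> (gradient \<phi>' x) \<partial>\<mu>) = (\<integral>y. c \<phi> y \<partial>\<nu>)" if "?B \<phi>" "?B \<phi>'" for \<phi> \<phi>'
  proof -
    have "(\<integral>y. c \<phi> y \<partial>distr \<mu> borel (gradient \<phi>')) = (\<integral>x. c \<phi> (gradient \<phi>' x) \<partial>\<mu>)"
      by (rule integral_distr) (use mc[OF that(1)] mg[OF that(2)] in measurable)
    then show ?thesis using that(2) by (simp add: brenier_solution_def)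
  qed
  have IF: "(\<integral>x. F \<phi> \<phi>' x \<partial>\<mu>) = (\<integral>y. c \<phi> y \<partial>\<nu>) - (\<integral>x. x \<bullet> gradient \<phi>' x \<partial>\<mu>) + (\<integral>x. \<phi> x \<partial>\<mu>)"
    if "?B \<phi>" "?B \<phi>'" for \<phi> \<phi>'
    unfolding F_def push[OF that, symmetric] using int1[OF that] int2[OF that(2)] int3[OF that(1)] by simp
  have diag: "(\<integral>x. F \<phi> \<phi> x \<partial>\<mu>) = 0" if "?B \<phi>" for \<phi>
  proof -
    have "AE x in \<mu>. F \<phi> \<phi> x = 0"
      using sm[OF that]
    proof eventually_elim
      case (elim x)
      then have "x \<in> W" unfolding W_def using closure_subset by blast
      then have "c \<phi> (gradient \<phi> x) = x \<bullet> gradient \<phi> x - \<phi> x"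
        unfolding c_def conjugate_on_eq_iff[OF W cW[OF that] \<open>x \<in> W\<close>]
        using elim gradient_in_subdifferential(1)[OF cvx[OF that]] by (auto simp: subdifferential_def)
      then show ?case by (simp add: F_def)
    qed
    then show ?thesis by (rule integral_eq_zero_AE)
  qed
  \<comment> \<open>By \<open>IF\<close> each integral splits into a term in \<open>\<phi>\<close>
    alone and a term in \<open>\<phi>'\<close> alone, so exchanging partners does not change the
    sum.\<close>
  have "(\<integral>x. F \<phi>1 \<phi>2 x \<partial>\<mu>) + (\<integral>x. F \<phi>2 \<phi>1 x \<partial>\<mu>) = (\<integral>x. F \<phi>1 \<phi>1 x \<partial>\<mu>) + (\<integral>x. F \<phi>2 \<phi>2 x \<partial>\<mu>)"
    by (simp add: IF \<phi>1 \<phi>2)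
  then have "(\<integral>x. F \<phi>1 \<phi>2 x \<partial>\<mu>) + (\<integral>x. F \<phi>2 \<phi>1 x \<partial>\<mu>) = 0"
    by (simp add: diag \<phi>1 \<phi>2)
  then have "(\<integral>x. F \<phi>1 \<phi>2 x \<partial>\<mu>) = 0"
    using integral_nonneg_AE[OF F0[OF \<phi>1]] integral_nonneg_AE[OF F0[OF \<phi>2]]
    by (metis add_nonneg_eq_0_iff)
  then have "AE x in \<mu>. F \<phi>1 \<phi>2 x = 0"
    using integral_nonneg_eq_0_iff_AE[OF intF[OF \<phi>1 \<phi>2] F0[OF \<phi>1]] by simp
  with sm[OF \<phi>1] sm[OF \<phi>2] show ?thesis
  proof eventually_elim
    case (elim x)
    then have x: "x \<in> W" unfolding W_def using closure_subset by blast
    have "c \<phi>1 (gradient \<phi>2 x) = x \<bullet> gradient \<phi>2 x - \<phi>1 x" using elim by (simp add: F_def)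
    then have "\<forall>w\<in>W. \<phi>1 w \<ge> \<phi>1 x + gradient \<phi>2 x \<bullet> (w - x)"
      unfolding c_def conjugate_on_eq_iff[OF W cW[OF \<phi>1] x] .
    then have "gradient \<phi>2 x = gradient \<phi>1 x"
      using elim gradient_in_subdifferential(2)[OF cvx[OF \<phi>1]] source_in_interior
      by (intro local_subgradient_eq_gradient[of \<phi>1 x "gradient \<phi>1 x" W]) (auto simp: W_def)
    with elim show ?case by simp
  qed
qed

theorem brenier_solution_unique:
  assumes \<phi>1: "brenier_solution \<Omega> \<Lambda> f g \<phi>1" and \<phi>2: "brenier_solution \<Omega> \<Lambda> f g \<phi>2"
  shows "\<phi>1 = \<phi>2"
proof -
  define P where "P = {(x, y). x \<in> \<Omega> \<and> y \<in> subdifferential \<phi>1 x \<and> y \<in> subdifferential \<phi>2 x}"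
  note pot = brenier_potential[OF \<phi>1] brenier_potential[OF \<phi>2]
  obtain R where R: "R > 0" "\<And>x. x \<in> closure \<Omega> \<Longrightarrow> norm x \<le> R" using src.norm_bound by metis
  have PR: "norm (fst p) \<le> R" if "p \<in> P" for p
    using that R(2) closure_subset by (fastforce simp: P_def)
  have P\<Lambda>: "snd p \<in> closure \<Lambda>" if "p \<in> P" for p
    using that potential_subdifferential[OF pot(1)] by (auto simp: P_def)
  \<comment> \<open>Otherwise the gradient almost everywhere avoids a ball around a point of
    \<open>closure \<Lambda>\<close>, but \<open>\<nu>\<close> charges every open set meeting
    \<open>\<Lambda>\<close>.\<close>
  have dense: "\<exists>p\<in>P. norm (snd p - y) \<le> e" if "y \<in> closure \<Lambda>" "e > 0" for y e
  proof (rule ccontr)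
    assume no: "\<not> ?thesis"
    have m: "gradient \<phi>1 \<in> borel_measurable \<mu>"
      using borel_measurable_gradient[OF potential_convex[OF pot(1)]] by simp
    have "AE x in \<mu>. gradient \<phi>1 x \<notin> ball y e"
      using brenier_gradients_agree[OF \<phi>1 \<phi>2]
    proof eventually_elim
      case (elim x)
      then have "(x, gradient \<phi>1 x) \<in> P"
        unfolding P_def using gradient_in_subdifferential(1) pot[THEN potential_convex] by (metis (mono_tags, lifting) case_prodI mem_Collect_eq)
      with no show ?case by (force simp: dist_norm norm_minus_commute)
    qed
    then have "AE y' in distr \<mu> borel (gradient \<phi>1). y' \<notin> ball y e"
      using m by (subst AE_distr_iff) (auto simp del: mem_ball simp flip: Compl_eq)
    moreover have "distr \<mu> borel (gradient \<phi>1) = \<nu>"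
      using \<phi>1 unfolding brenier_solution_def by blast
    ultimately have "AE y' in \<nu>. y' \<notin> ball y e" by metis
    moreover have "ball y e \<inter> \<Lambda> \<noteq> {}"
    proof -
      obtain y' where "y' \<in> \<Lambda>" "dist y' y < e" using \<open>y \<in> closure \<Lambda>\<close> \<open>e > 0\<close> closure_approachable by metis
      then have "y' \<in> ball y e \<inter> \<Lambda>" by (simp add: dist_commute)
      then show ?thesis by blast
    qed
    ultimately show False using tgt.open_charged[OF open_ball] by blast
  qed
  \<comment> \<open>\<open>fst p \<bullet> snd p - \<phi> (fst p)\<close> is the value of the
    conjugate of \<open>\<phi>\<close> at \<open>snd p\<close>, and \<open>fst p\<close> is a
    subgradient of the conjugate there.\<close>
  have step: "fst p \<bullet> (snd q - snd p) \<le> (fst q \<bullet> snd q - \<phi> (fst q)) - (fst p \<bullet> snd p - \<phi> (fst p))"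
    if "p \<in> P" "q \<in> P" "\<phi> = \<phi>1 \<or> \<phi> = \<phi>2" for p q \<phi>
  proof -
    have "snd q \<in> subdifferential \<phi> (fst q)" using that by (auto simp: P_def)
    then have "\<phi> (fst p) \<ge> \<phi> (fst q) + snd q \<bullet> (fst p - fst q)" by (auto simp: subdifferential_def)
    then show ?thesis by (simp add: inner_diff_right inner_commute)
  qed
  have "closure \<Lambda> \<noteq> {}"
    using subdifferential_nonempty[OF potential_convex[OF pot(1)], of 0] potential_subdifferential[OF pot(1)]
    by (metis empty_iff)
  then obtain p0 where p0: "p0 \<in> P" using dense[of _ 1] by fastforce
  define k where "k = \<phi>1 (fst p0) - \<phi>2 (fst p0)"
  have k: "\<phi>1 (fst p) - \<phi>2 (fst p) = k" if "p \<in> P" for p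
  proof -
    have "(fst p \<bullet> snd p - \<phi>1 (fst p)) - (fst p \<bullet> snd p - \<phi>2 (fst p))
      = (fst p0 \<bullet> snd p0 - \<phi>1 (fst p0)) - (fst p0 \<bullet> snd p0 - \<phi>2 (fst p0))"
      by (rule common_potential_unique[where C = "closure \<Lambda>" and R = R and P = P
            and ?s1.0 = "\<lambda>p. fst p \<bullet> snd p - \<phi>1 (fst p)" and ?s2.0 = "\<lambda>p. fst p \<bullet> snd p - \<phi>2 (fst p)"])
        (use convex_closure[OF convex_target] dense P\<Lambda> PR step p0 that in auto)
    then show ?thesis by (simp add: k_def)
  qed
  \<comment> \<open>The slope \<open>r\<close> of a supporting plane of \<open>\<phi>\<close> at
    \<open>x\<close> is approximated by slopes from \<open>P\<close>, whose planes support
    \<open>\<phi>'\<close>; \<open>d\<close> is chosen so that the replacement costs at most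
    \<open>e\<close>.\<close>
  have le: "\<phi> x \<le> \<phi>' x + l"
    if \<phi>: "potential \<phi>" and P1: "\<And>p. p \<in> P \<Longrightarrow> \<phi> (fst p) = \<phi>' (fst p) + l"
      and P2: "\<And>p. p \<in> P \<Longrightarrow> snd p \<in> subdifferential \<phi>' (fst p)" for \<phi> \<phi>' l x
  proof (rule field_le_epsilon)
    fix e :: real assume e: "e > 0"
    obtain r where r: "r \<in> subdifferential \<phi> x" using subdifferential_nonempty[OF potential_convex[OF \<phi>]] .
    define d where "d = e / (norm x + R)"
    have d: "d > 0" using e R by (simp add: d_def add_nonneg_pos)
    obtain p where p: "p \<in> P" "norm (snd p - r) \<le> d"
      using dense[OF potential_subdifferential[OF \<phi> r] d] by blast
    have "\<phi> (fst p) \<ge> \<phi> x + r \<bullet> (fst p - x)" using r by (auto simp: subdifferential_def)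
    moreover have "\<phi>' x \<ge> \<phi>' (fst p) + snd p \<bullet> (x - fst p)" using P2[OF p(1)] by (auto simp: subdifferential_def)
    moreover have "\<bar>(snd p - r) \<bullet> (fst p - x)\<bar> \<le> d * (norm x + R)"
    proof (rule order_trans[OF Cauchy_Schwarz_ineq2 mult_mono])
      show "norm (fst p - x) \<le> norm x + R"
        using norm_triangle_ineq4[of "fst p" x] PR[OF p(1)] by simp
    qed (use p d in auto)
    moreover have "d * (norm x + R) = e" using R by (simp add: d_def add_nonneg_pos[THEN less_imp_neq, symmetric])
    ultimately show "\<phi> x \<le> \<phi>' x + l + e"
      using P1[OF p(1)] by (simp add: inner_diff_left inner_diff_right)
  qed
  have "\<phi>1 x = \<phi>2 x + k" for x
    using le[OF pot(1), of \<phi>2 k x] le[OF pot(2), of \<phi>1 "-k" x] k by (fastforce simp: P_def)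
  moreover have "\<phi>1 0 = 0" "\<phi>2 0 = 0" using \<phi>1 \<phi>2 by (auto simp: brenier_solution_def)
  ultimately show ?thesis by (metis add_cancel_left_right add.right_neutral ext)
qed

end

section \<open>Determinants and volumes\<close>

text \<open>\<open>measure_linear_image\<close> of the library requires a linearly ordered index type.\<close>

lemma measure_linear_image_cart:
  fixes f :: "real^'n \<Rightarrow> real^'n" and S :: "(real^'n) set"
  assumes "linear f" "S \<in> lmeasurable"
  shows "f ` S \<in> lmeasurable \<and> measure lebesgue (f ` S) = \<bar>det (matrix f)\<bar> * measure lebesgue S"
proof -
  define Q where "Q f \<longleftrightarrow> (\<forall>S\<in>lmeasurable. f ` S \<in> lmeasurable \<and>
    measure lebesgue (f ` S) = \<bar>det (matrix f)\<bar> * measure lebesgue S)" for f :: "real^'n \<Rightarrow> real^'n"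
  have "Q f"
  proof (rule induct_linear_elementary[OF assms(1)])
    fix f g assume fg: "linear f" "linear g" "Q f" "Q g"
    show "Q (f \<circ> g)"
      unfolding Q_def
    proof
      fix S :: "(real^'n) set" assume "S \<in> lmeasurable"
      with fg(4) have "g ` S \<in> lmeasurable" "measure lebesgue (g ` S) = \<bar>det (matrix g)\<bar> * measure lebesgue S"
        by (auto simp: Q_def)
      moreover from this have "f ` g ` S \<in> lmeasurable" "measure lebesgue (f ` g ` S) = \<bar>det (matrix f)\<bar> * measure lebesgue (g ` S)"
        using fg(3) unfolding Q_def by blast+
      ultimately show "(f \<circ> g) ` S \<in> lmeasurable \<and>
          measure lebesgue ((f \<circ> g) ` S) = \<bar>det (matrix (f \<circ> g))\<bar> * measure lebesgue S"
        by (simp add: image_comp matrix_compose[OF fg(2,1)] det_mul abs_mult)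
    qed
  next
    fix f :: "real^'n \<Rightarrow> real^'n" and i assume f: "linear f" "\<And>x. f x $ i = 0"
    then have "\<not> surj f" by (metis one_neq_zero surjD vec_component)
    then have ninj: "\<not> inj f" using f(1) linear_injective_imp_surjective by blast
    then have "negligible (f ` S)" for S
      using f(1) negligible_linear_singular_image by blast
    moreover have "det (matrix f) = 0" using ninj det_nz_iff_inj[OF f(1)] by blast
    ultimately show "Q f" by (simp add: Q_def negligible_imp_measurable negligible_imp_measure0)
  next
    fix c :: "'n \<Rightarrow> real"
    show "Q (\<lambda>x. \<chi> i. c i * x $ i)"
      by (simp add: Q_def measurable_stretch measure_stretch matrix_def axis_def det_diagonal)
  next
    fix m n :: 'n assume mn: "m \<noteq> n"
  let ?p = "Transposition.transpose m n"
  let ?h = "\<lambda>v::real^'n. \<chi> i. v $ ?p i"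
  have lin: "linear ?h" by (rule linearI) (simp_all add: vec_eq_iff)
  have img: "?h ` cbox a b = cbox (?h a) (?h b)" for a b
  proof
    show "cbox (?h a) (?h b) \<subseteq> ?h ` cbox a b"
    proof
      fix x assume x: "x \<in> cbox (?h a) (?h b)"
      have "?h x \<in> cbox a b"
        unfolding mem_box_cart
      proof
        fix i
        have "a $ ?p (?p i) \<le> x $ ?p i \<and> x $ ?p i \<le> b $ ?p (?p i)" using x by (simp add: mem_box_cart del: transpose_involutory)
        then show "a $ i \<le> ?h x $ i \<and> ?h x $ i \<le> b $ i" by simp
      qed
      moreover have "?h (?h x) = x" by (simp add: vec_eq_iff)
      ultimately show "x \<in> ?h ` cbox a b" by (intro image_eqI[of _ _ "?h x"]) (rule sym)
    qed
  qed (auto simp: mem_box_cart)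
  have "measure lebesgue (?h ` cbox a b) = 1 * measure lebesgue (cbox a b)" for a b
  proof (cases "cbox a b = {}")
    case False
    then have "cbox (?h a) (?h b) \<noteq> {}" using img[of a b] by blast
    with False show ?thesis
      using prod.permute[OF permutes_swap_id, of m UNIV n "\<lambda>i. b $ i - a $ i"]
      by (simp add: img content_cbox_cart o_def)
  qed simp
  then have "?h ` S \<in> lmeasurable \<and> measure lebesgue (?h ` S) = measure lebesgue S"
    if "S \<in> lmeasurable" for S
    using measure_linear_sufficient[OF lin that, of 1] by simp
  moreover have "\<bar>det (matrix ?h)\<bar> = 1"
  proof -
    have eq: "matrix ?h = (\<chi> i. mat 1 $ ?p i)"
      by (auto simp: matrix_def axis_def mat_def vec_eq_iff)
    have "sign ?p = - 1" using mn by (simp only: sign_swap_id if_False)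
    then show ?thesis
      unfolding eq det_permute_rows[OF permutes_swap_id[OF UNIV_I UNIV_I]] by simp
  qed
  ultimately show "Q ?h" by (simp add: Q_def)
next
  fix m n :: 'n assume mn: "m \<noteq> n"
  let ?h = "\<lambda>v::real^'n. \<chi> i. if i = m then v $ m + v $ n else v $ i"
  have lin: "linear ?h" by (rule linearI) (auto simp: vec_eq_iff algebra_simps)
  have "measure lebesgue (?h ` cbox a b) = 1 * measure lebesgue (cbox a b)" for a b
  proof (cases "cbox a b = {}")
    case False
    \<comment> \<open>\<open>measure_shear_interval\<close> asks for a lower corner with nonnegative
      \<open>n\<close>-th coordinate; this translation moves that coordinate to 0.\<close>
    define v where "v = axis n (- (a $ n))"
    have box: "(+) v ` cbox a b = cbox (v + a) (v + b)" by (rule cbox_translation[symmetric])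
    then have ne: "cbox (v + a) (v + b) \<noteq> {}" using False by blast
    have "(+) (?h v) ` ?h ` cbox a b = ?h ` ((+) v ` cbox a b)"
      unfolding image_image by (simp only: linear_add[OF lin])
    also have "\<dots> = ?h ` cbox (v + a) (v + b)" unfolding box ..
    finally have "measure lebesgue (?h ` cbox a b) = measure lebesgue (?h ` cbox (v + a) (v + b))"
      using measure_translation[of "?h v" "?h ` cbox a b"] by (simp only:)
    also have "\<dots> = measure lebesgue (cbox (v + a) (v + b))"
      by (rule measure_shear_interval[OF mn ne]) (simp add: v_def axis_def)
    also have "\<dots> = measure lebesgue (cbox a b)"
      using measure_translation[of v "cbox a b"] unfolding box .
    finally show ?thesis by simp
  qed simp
  then have "?h ` S \<in> lmeasurable \<and> measure lebesgue (?h ` S) = measure lebesgue S"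
    if "S \<in> lmeasurable" for S
    using measure_linear_sufficient[OF lin that, of 1] by simp
  moreover have "det (matrix ?h) = 1"
  proof -
    have "matrix ?h = (\<chi> k. if k = m then row m (mat 1) + 1 *s row n (mat 1) else row k (mat 1))"
      by (auto simp: matrix_def axis_def mat_def row_def vec_eq_iff)
    then show ?thesis using det_row_operation[OF mn, of "mat 1 :: real^'n^'n" 1] by simp
  qed
  ultimately show "Q ?h" by (simp add: Q_def)
qed
  with assms(2) show ?thesis by (simp add: Q_def)
qed

lemma matrix_inv_right: "invertible A \<Longrightarrow> A ** matrix_inv A = mat 1"
  and matrix_inv_left: "invertible A \<Longrightarrow> matrix_inv A ** A = mat 1"
  for A :: "real^'n^'n"
  unfolding invertible_def matrix_inv_def by (drule someI_ex, blast)+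

lemma pos_def_invertible:
  fixes H :: "real^'n^'n"
  assumes "pos_def H"
  shows "invertible H"
proof -
  have "v = 0" if "H *v v = 0" for v
    using assms that unfolding pos_def_def by (metis inner_zero_right less_irrefl)
  then show ?thesis
    by (metis invertible_left_inverse matrix_left_invertible_ker)
qed

lemma pos_def_coercive:
  fixes H :: "real^'n^'n"
  assumes "pos_def H"
  obtains c where "c > 0" "\<And>v. v \<bullet> (H *v v) \<ge> c * (norm v)\<^sup>2"
proof -
  let ?q = "\<lambda>v. v \<bullet> (H *v v)"
  have cont: "continuous_on UNIV ?q"
    by (intro continuous_intros linear_continuous_on matrix_vector_mul_bounded_linear)
  have ne: "sphere (0::real^'n) 1 \<noteq> {}" by simp
  obtain u where u: "u \<in> sphere 0 1" "\<And>v. v \<in> sphere 0 1 \<Longrightarrow> ?q u \<le> ?q v"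
    using continuous_attains_inf[OF compact_sphere ne continuous_on_subset[OF cont subset_UNIV]] by blast
  have "u \<noteq> 0" using u(1) by auto
  then have "?q u > 0" using assms by (simp add: pos_def_def)
  moreover have "?q v \<ge> ?q u * (norm v)\<^sup>2" for v
  proof (cases "v = 0")
    case False
    then have "?q u \<le> ?q (v /\<^sub>R norm v)" by (intro u(2)) simp
    also have "\<dots> = ?q v / (norm v)\<^sup>2"
      by (simp add: matrix_vector_mult_scaleR power2_eq_square inverse_eq_divide)
    finally show ?thesis using False by (simp add: field_simps)
  qed simp
  ultimately show ?thesis using that by blast
qed

text \<open>The Ostrowski--Taussky inequality. With \<open>q v = v \<bullet> H v\<close> and \<open>N = H\<^sup>-\<^sup>1 G\<close>, antisymmetry of
  \<open>G - H\<close> gives \<open>q (N v) \<ge> q v\<close>; thus \<open>N\<close> maps the ellipsoid \<open>{q \<le> 1}\<close> onto a superset of itself.\<close>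

lemma abs_det_symmetric_part_le:
  fixes G :: "real^'n^'n"
  defines "H \<equiv> (1/2) *\<^sub>R G + (1/2) *\<^sub>R transpose G"
  assumes pd: "pos_def H"
  shows "\<bar>det H\<bar> \<le> \<bar>det G\<bar>"
proof -
  define q where "q v = v \<bullet> (H *v v)" for v
  define N where "N = matrix_inv H ** G"
  have inv: "invertible H" by (rule pos_def_invertible[OF pd])
  then have HN: "H ** N = G"
    unfolding N_def by (metis matrix_inv_right matrix_mul_assoc matrix_mul_lid)
  have sym: "u \<bullet> (H *v w) = w \<bullet> (H *v u)" for u w
    using pd by (metis dot_lmul_matrix inner_commute pos_def_def vector_transpose_matrix)
  have qH: "v \<bullet> (G *v v) = q v" for v
  proof -
    have "v \<bullet> (transpose G *v v) = v \<bullet> (G *v v)"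
      by (metis dot_lmul_matrix inner_commute vector_transpose_matrix transpose_transpose)
    then show ?thesis
      by (simp add: q_def H_def matrix_vector_mult_add_rdistrib scaleR_matrix_vector_assoc[symmetric] inner_add_right)
  qed
  have expand: "q (N *v v) \<ge> q v" for v
  proof -
    define u where "u = N *v v - v"
    have Hu: "H *v u = G *v v - H *v v"
      using HN by (simp add: u_def matrix_vector_mult_diff_distrib matrix_vector_mul_assoc)
    \<comment> \<open>\<open>G - H\<close> is antisymmetric, so \<open>v\<close> and
      \<open>u\<close> are orthogonal for the form of \<open>H\<close>, and \<open>q\<close> obeys
      Pythagoras.\<close>
    have "v \<bullet> (H *v u) = 0"
      using qH[of v] by (simp add: Hu inner_diff_right q_def)
    then have "q (v + u) = q v + q u"
      using sym[of u v] by (simp add: q_def matrix_vector_right_distrib inner_add_left inner_add_right)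
    moreover have "q u \<ge> 0"
      using pd unfolding q_def pos_def_def by (cases "u = 0") (auto simp: less_imp_le)
    ultimately show ?thesis by (simp add: u_def)
  qed
  define U where "U = {v. q v \<le> 1}"
  have contq: "continuous_on UNIV q"
    unfolding q_def by (intro continuous_intros linear_continuous_on matrix_vector_mul_bounded_linear)
  obtain c where c: "c > 0" "\<And>v. q v \<ge> c * (norm v)\<^sup>2"
    using pos_def_coercive[OF pd] unfolding q_def by metis
  have "bounded U"
    unfolding bounded_iff
  proof (intro exI ballI)
    fix v assume "v \<in> U"
    then have "c * (norm v)\<^sup>2 \<le> 1" using c(2)[of v] by (simp add: U_def)
    then have "(norm v)\<^sup>2 \<le> 1 / c" using c(1) by (simp add: field_simps)
    then show "norm v \<le> sqrt (1 / c)" using real_le_rsqrt by blast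
  qed
  moreover have "closed U"
    unfolding U_def by (intro closed_Collect_le contq continuous_intros)
  ultimately have U: "U \<in> lmeasurable" by (intro lmeasurable_compact) (simp add: compact_eq_bounded_closed)
  have "open {v. q v < 1}" by (intro open_Collect_less contq continuous_intros)
  moreover have "0 \<in> {v. q v < 1}" by (simp add: q_def)
  ultimately have "\<not> negligible {v. q v < 1}" using open_not_negligible by blast
  then have "\<not> negligible U"
    by (rule contrapos_nn) (auto simp: U_def intro: negligible_subset)
  then have Upos: "measure lebesgue U > 0"
    using U by (simp add: zero_less_measure_iff negligible_iff_measure)
  have inj: "inj ((*v) N)"
  proof -
    have "v = 0" if "N *v v = 0" for v
    proof (rule ccontr)
      assume "v \<noteq> 0"
      then have "q v > 0" using pd by (simp add: pos_def_def q_def)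
      with expand[of v] that show False by (simp add: q_def)
    qed
    then show ?thesis by (metis matrix_left_invertible_injective matrix_left_invertible_ker)
  qed
  have lin: "linear ((*v) N)" by (rule matrix_vector_mul_linear)
  have "U \<subseteq> (*v) N ` U"
  proof
    fix w assume w: "w \<in> U"
    obtain v where v: "w = N *v v" using linear_injective_imp_surjective[OF lin inj] by (metis surjD)
    have "v \<in> U" using expand[of v] w v by (simp add: U_def)
    then show "w \<in> (*v) N ` U" using v by blast
  qed
  then have "measure lebesgue U \<le> measure lebesgue ((*v) N ` U)"
    using measure_linear_image_cart[OF lin U] U by (intro measure_mono_fmeasurable) auto
  also have "\<dots> = \<bar>det N\<bar> * measure lebesgue U"
    using measure_linear_image_cart[OF lin U] by simp
  finally have "\<bar>det N\<bar> \<ge> 1" using Upos by simp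
  then have "\<bar>det H\<bar> * 1 \<le> \<bar>det H\<bar> * \<bar>det N\<bar>" by (intro mult_left_mono) auto
  also have "\<dots> = \<bar>det G\<bar>" using HN by (metis det_mul abs_mult)
  finally show ?thesis by simp
qed

text \<open>On a segment the claim is about the real function \<open>s\<close>. The hypothesis
  compares only with the fixed point \<open>z\<close>, so a short interval is handled through the
  parameter \<open>t\<close> inside it, and bisection chains such intervals; neither continuity of
  \<open>G\<close> nor a uniform radius enters.\<close>

lemma strictly_monotone_if_locally:
  fixes G :: "'a::real_inner \<Rightarrow> 'a"
  assumes K: "convex K"
    and loc: "\<And>z. z \<in> K \<Longrightarrow> \<exists>r>0. \<forall>z'\<in>K. z' \<noteq> z \<longrightarrow> dist z z' < r \<longrightarrow> (G z' - G z) \<bullet> (z' - z) > 0"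
    and xy: "x \<in> K" "y \<in> K" "x \<noteq> y"
  shows "(G y - G x) \<bullet> (y - x) > 0"
proof -
  define v where "v = y - x"
  have v: "v \<noteq> 0" using xy by (simp add: v_def)
  define c where "c t = x + t *\<^sub>R v" for t
  have cK: "c t \<in> K" if "0 \<le> t" "t \<le> 1" for t
    using convexD_alt[OF K xy(1,2) that] by (simp add: c_def v_def algebra_simps)
  define s where "s t = G (c t) \<bullet> v" for t
  \<comment> \<open>The local claim also covers degenerate intervals; the disjunct
    \<open>a = b\<close> admits them.\<close>
  have "0 \<le> (0::real) \<and> 1 \<le> (1::real) \<longrightarrow> (0::real) = 1 \<or> s 0 < s 1"
  proof (rule Bolzano[where P = "\<lambda>a b. 0 \<le> a \<and> b \<le> 1 \<longrightarrow> a = b \<or> s a < s b"])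
    fix t :: real assume t: "0 \<le> t" "t \<le> 1"
    obtain r where r: "r > 0" "\<And>z'. z' \<in> K \<Longrightarrow> z' \<noteq> c t \<Longrightarrow> dist (c t) z' < r \<Longrightarrow> (G z' - G (c t)) \<bullet> (z' - c t) > 0"
      using loc[OF cK[OF t]] by blast
    have near: "(s t' - s t) * (t' - t) > 0" if "0 \<le> t'" "t' \<le> 1" "t' \<noteq> t" "\<bar>t' - t\<bar> < r / norm v" for t'
    proof -
      have d: "c t' - c t = (t' - t) *\<^sub>R v" by (simp add: c_def algebra_simps)
      then have "dist (c t) (c t') = \<bar>t' - t\<bar> * norm v"
        by (metis dist_commute dist_norm norm_scaleR)
      then have "dist (c t) (c t') < r" using that v by (simp add: field_simps)
      moreover have "c t' \<noteq> c t" using that v by (simp add: c_def)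
      ultimately have "(G (c t') - G (c t)) \<bullet> (c t' - c t) > 0" using r(2) cK that by blast
      then show ?thesis unfolding d by (simp add: s_def inner_diff_left mult.commute)
    qed
    show "\<exists>d>0. \<forall>a b. a \<le> t \<and> t \<le> b \<and> b - a < d \<longrightarrow> (0 \<le> a \<and> b \<le> 1 \<longrightarrow> a = b \<or> s a < s b)"
    proof (intro exI[of _ "r / norm v"] conjI allI impI)
      fix a b assume ab: "a \<le> t \<and> t \<le> b \<and> b - a < r / norm v" "0 \<le> a \<and> b \<le> 1"
      have "a = t \<or> s a < s t" using near[of a] ab t by (auto simp: zero_less_mult_iff)
      moreover have "b = t \<or> s t < s b" using near[of b] ab t by (auto simp: zero_less_mult_iff)
      ultimately show "a = b \<or> s a < s b" by auto
    qed (use r v in auto)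
  qed auto
  then show ?thesis by (simp add: s_def c_def v_def inner_diff_left)
qed

section \<open>Piecewise affine interpolation\<close>

lemma convex_hull_range_weights:
  fixes p :: "'i::finite \<Rightarrow> 'a::real_vector"
  assumes "x \<in> convex hull range p"
  obtains w where "\<And>j. w j \<ge> 0" "sum w UNIV = 1" "x = (\<Sum>j\<in>UNIV. w j *\<^sub>R p j)"
proof -
  define C where "C = {(\<Sum>j\<in>UNIV. w j *\<^sub>R p j) | w. (\<forall>j. w j \<ge> 0) \<and> sum w UNIV = 1}"
  have "convex C"
    unfolding convex_def
  proof safe
    fix a b :: 'a and u v :: real
    assume "a \<in> C" "b \<in> C" and uv: "0 \<le> u" "0 \<le> v" "u + v = 1"
    then obtain wa wb where "\<forall>j. wa j \<ge> 0" "sum wa UNIV = 1" "a = (\<Sum>j\<in>UNIV. wa j *\<^sub>R p j)"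
      "\<forall>j. wb j \<ge> 0" "sum wb UNIV = 1" "b = (\<Sum>j\<in>UNIV. wb j *\<^sub>R p j)" unfolding C_def by blast
    then show "u *\<^sub>R a + v *\<^sub>R b \<in> C"
      unfolding C_def using uv
      by (intro CollectI exI[of _ "\<lambda>j. u * wa j + v * wb j"])
        (simp add: sum.distrib scaleR_left_distrib scaleR_sum_right flip: sum_distrib_left)
  qed
  moreover have "range p \<subseteq> C"
  proof
    fix y assume "y \<in> range p"
    then obtain j where "y = p j" by blast
    then show "y \<in> C"
      unfolding C_def
      by (intro CollectI exI[of _ "\<lambda>i. if i = j then 1 else 0"]) (simp add: if_distrib[of "\<lambda>c. c *\<^sub>R _"] cong: if_cong)
  qed
  ultimately have "convex hull range p \<subseteq> C" by (intro hull_minimal)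
  with assms show ?thesis unfolding C_def using that by blast
qed

text \<open>\<open>edge_matrix\<close> stores edges as rows. With \<open>A\<close> and
  \<open>B\<close> the two edge matrices, a linear map \<open>J\<close> taking the edges of the
  simplex to the differences of the gradients satisfies \<open>A ** transpose J = B\<close>, hence
  the transpose; \<open>hess\<close> is the symmetric part of \<open>J\<close>.\<close>

definition cell_jacobian :: "'n::finite simplices \<Rightarrow> (nat \<Rightarrow> real^'n) \<Rightarrow> nat \<Rightarrow> real^'n^'n" where
  "cell_jacobian T \<eta> i = transpose (matrix_inv (edge_matrix T (pt T) i) ** edge_matrix T \<eta> i)"

definition cell_map :: "'n::finite simplices \<Rightarrow> (nat \<Rightarrow> real^'n) \<Rightarrow> nat \<Rightarrow> real^'n \<Rightarrow> real^'n" where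
  "cell_map T \<eta> i x = \<eta> (vert T i None) + cell_jacobian T \<eta> i *v (x - pt T (vert T i None))"

text \<open>In an almost-triangulation the choice of the cell is immaterial by
  \<open>cell_map_agree\<close>; outside all cells the value carries no meaning.\<close>

definition pl_map :: "'n::finite simplices \<Rightarrow> (nat \<Rightarrow> real^'n) \<Rightarrow> real^'n \<Rightarrow> real^'n" where
  "pl_map T \<eta> x = cell_map T \<eta> (SOME i. i < nsimp T \<and> x \<in> cell T i) x"

lemma cell_map_diff: "cell_map T \<eta> i x - cell_map T \<eta> i y = cell_jacobian T \<eta> i *v (x - y)"
  by (simp add: cell_map_def matrix_vector_mult_diff_distrib)

lemma cell_jacobian_quadratic:
  fixes T :: "'n::finite simplices"
  shows "v \<bullet> (cell_jacobian T \<eta> i *v v) = v \<bullet> (hess T \<eta> i *v v)"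
proof -
  have tr: "v \<bullet> (v v* G) = v \<bullet> (G *v v)" for G :: "real^'n^'n"
    by (simp add: dot_lmul_matrix inner_commute[of v "v v* G"])
  show ?thesis
    by (simp add: cell_jacobian_def hess_def Let_def tr matrix_vector_mult_add_rdistrib
        scaleR_matrix_vector_assoc[symmetric] inner_add_right)
qed

lemma abs_det_hess_le: "pos_def (hess T \<eta> i) \<Longrightarrow> \<bar>det (hess T \<eta> i)\<bar> \<le> \<bar>det (cell_jacobian T \<eta> i)\<bar>"
  unfolding hess_def cell_jacobian_def Let_def det_transpose by (rule abs_det_symmetric_part_le)

lemma compact_cell: "compact (cell T i)"
  unfolding cell_def by (intro finite_imp_compact_convex_hull) simp

lemma cell_map_affine_image: "cell_map T \<eta> i ` S =
    (+) (\<eta> (vert T i None) - cell_jacobian T \<eta> i *v pt T (vert T i None)) ` (*v) (cell_jacobian T \<eta> i) ` S"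
  unfolding image_image by (intro image_cong) (simp_all add: cell_map_def matrix_vector_mult_diff_distrib)

lemma measure_cell_map_image:
  assumes "S \<in> lmeasurable"
  shows "cell_map T \<eta> i ` S \<in> lmeasurable"
    "measure lebesgue (cell_map T \<eta> i ` S) = \<bar>det (cell_jacobian T \<eta> i)\<bar> * measure lebesgue S"
  using measure_linear_image_cart[OF matrix_vector_mul_linear[of "cell_jacobian T \<eta> i"] assms]
  unfolding cell_map_affine_image by (simp_all add: measurable_translation measure_translation)

lemma compact_cell_map_image: "compact S \<Longrightarrow> compact (cell_map T \<eta> i ` S)"
  unfolding cell_map_affine_image
  by (intro compact_translation compact_continuous_image linear_continuous_on matrix_vector_mul_bounded_linear)

context
  fixes \<Omega> :: "(real^'n) set" and T :: "'n::finite simplices"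
  assumes AT: "almost_triangulation \<Omega> T"
begin

lemma vert_npts: "i < nsimp T \<Longrightarrow> vert T i j < npts T"
  using AT unfolding almost_triangulation_def by blast

lemma inj_pt: "j < npts T \<Longrightarrow> l < npts T \<Longrightarrow> pt T j = pt T l \<Longrightarrow> j = l"
  using AT by (auto simp: almost_triangulation_def inj_on_def)

lemma vertices_independent: "i < nsimp T \<Longrightarrow> \<not> affine_dependent (range (\<lambda>j. pt T (vert T i j)))"
  using AT by (auto simp: almost_triangulation_def)

lemma inj_vertices: "i < nsimp T \<Longrightarrow> inj (\<lambda>j. pt T (vert T i j))"
  using AT inj_pt vert_npts unfolding almost_triangulation_def inj_def by metis

lemma invertible_edge_matrix:
  assumes i: "i < nsimp T"
  shows "invertible (edge_matrix T (pt T) i)"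
proof -
  let ?p = "\<lambda>j. pt T (vert T i j)"
  let ?B = "(\<lambda>x. - ?p None + x) ` (range ?p - {?p None})"
  have indep: "independent ?B"
    using vertices_independent[OF i] affine_dependent_iff_dependent2[of "?p None" "range ?p"] by blast
  have "card (range ?p - {?p None}) = CARD('n option) - 1"
    using inj_vertices[OF i] by (simp add: card_image)
  then have "card ?B = CARD('n)"
    by (subst card_image) (auto simp: inj_on_def card_UNIV_option)
  then have span: "UNIV \<subseteq> span ?B"
    using card_ge_dim_independent[OF subset_UNIV indep] by (simp add: dim_UNIV)
  have "v = 0" if v: "edge_matrix T (pt T) i *v v = 0" for v
  proof -
    have "(?p (Some j) - ?p None) \<bullet> v = 0" for j
      using arg_cong[OF v, of "\<lambda>u. u $ j"] by (simp add: edge_matrix_def matrix_vector_mul_component)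
    then have "?B \<subseteq> {w. w \<bullet> v = 0}"
      by (auto simp: split_option_all) (metis (no_types) add.commute add_uminus_conv_diff not_None_eq)
    then have "span ?B \<subseteq> {w. w \<bullet> v = 0}"
      by (rule span_minimal) (simp add: subspace_hyperplane inner_commute[of _ v])
    then have "v \<bullet> v = 0" using span by blast
    then show "v = 0" by simp
  qed
  then show ?thesis by (metis invertible_left_inverse matrix_left_invertible_ker)
qed

lemma cell_map_vertex:
  assumes i: "i < nsimp T"
  shows "cell_map T \<eta> i (pt T (vert T i j)) = \<eta> (vert T i j)"
proof (cases j)
  case None
  then show ?thesis by (simp add: cell_map_def)
next
  case (Some k)
  let ?A = "edge_matrix T (pt T) i" and ?B = "edge_matrix T \<eta> i"
  have "cell_jacobian T \<eta> i *v (pt T (vert T i (Some k)) - pt T (vert T i None)) = (?A $ k) v* (matrix_inv ?A ** ?B)"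
    by (simp add: cell_jacobian_def edge_matrix_def)
  also have "\<dots> = row k (?A ** (matrix_inv ?A ** ?B))"
    by (simp add: vec_eq_iff vector_matrix_mult_def matrix_matrix_mult_def row_def mult.commute)
  also have "?A ** (matrix_inv ?A ** ?B) = ?B"
    using matrix_inv_right[OF invertible_edge_matrix[OF i]] by (simp add: matrix_mul_assoc)
  finally show ?thesis
    by (simp add: Some cell_map_def edge_matrix_def row_def vec_eq_iff)
qed

lemma cell_map_combination:
  assumes i: "i < nsimp T" and w: "sum w UNIV = 1"
  shows "cell_map T \<eta> i (\<Sum>j\<in>UNIV. w j *\<^sub>R pt T (vert T i j)) = (\<Sum>j\<in>UNIV. w j *\<^sub>R \<eta> (vert T i j))"
proof -
  let ?p = "\<lambda>j. pt T (vert T i j)" and ?J = "cell_jacobian T \<eta> i"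
  have lin: "linear ((*v) ?J)" by (rule matrix_vector_mul_linear)
  have e: "?J *v (?p j - ?p None) = \<eta> (vert T i j) - \<eta> (vert T i None)" for j
    using cell_map_diff[of T \<eta> i "?p j" "?p None"] cell_map_vertex[OF i] by simp
  have "(\<Sum>j\<in>UNIV. w j *\<^sub>R ?p j) - ?p None = (\<Sum>j\<in>UNIV. w j *\<^sub>R (?p j - ?p None))"
    using w by (simp add: scaleR_diff_right sum_subtractf flip: scaleR_sum_left)
  then have "?J *v ((\<Sum>j\<in>UNIV. w j *\<^sub>R ?p j) - ?p None) = ?J *v (\<Sum>j\<in>UNIV. w j *\<^sub>R (?p j - ?p None))"
    by (rule arg_cong)
  also have "\<dots> = (\<Sum>j\<in>UNIV. w j *\<^sub>R (?J *v (?p j - ?p None)))"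
    unfolding linear_sum[OF lin] linear_scale[OF lin] ..
  also have "\<dots> = (\<Sum>j\<in>UNIV. w j *\<^sub>R \<eta> (vert T i j)) - \<eta> (vert T i None)"
    unfolding e using w by (simp add: scaleR_diff_right sum_subtractf flip: scaleR_sum_left)
  finally show ?thesis by (simp add: cell_map_def)
qed

lemma cell_map_weights:
  assumes i: "i < nsimp T" and x: "x \<in> cell T i"
  obtains w where "\<And>j. w j \<ge> 0" "sum w UNIV = 1" "x = (\<Sum>j\<in>UNIV. w j *\<^sub>R pt T (vert T i j))"
    "cell_map T \<eta> i x = (\<Sum>j\<in>UNIV. w j *\<^sub>R \<eta> (vert T i j))"
proof -
  obtain w where w: "\<And>j. w j \<ge> 0" "sum w UNIV = 1" "x = (\<Sum>j\<in>UNIV. w j *\<^sub>R pt T (vert T i j))"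
    using x unfolding cell_def by (rule convex_hull_range_weights) blast
  show ?thesis by (rule that[OF w]) (simp add: w(3) cell_map_combination[OF i w(2)])
qed

lemma cell_face:
  assumes "i < nsimp T" "l < nsimp T" "cell T i \<inter> cell T l \<noteq> {}"
  shows "cell T i \<inter> cell T l face_of cell T i"
  using AT assms unfolding almost_triangulation_def by blast

text \<open>A common face is the hull of its extreme points, which are vertices of both simplices.\<close>

lemma cell_map_agree:
  assumes i: "i < nsimp T" and l: "l < nsimp T" and x: "x \<in> cell T i" "x \<in> cell T l"
  shows "cell_map T \<eta> i x = cell_map T \<eta> l x"
proof -
  let ?V = "\<lambda>i. range (\<lambda>j. pt T (vert T i j))"
  let ?F = "cell T i \<inter> cell T l"
  have F: "?F face_of convex hull ?V i" "?F face_of convex hull ?V l"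
    using cell_face[OF i l] cell_face[OF l i] x by (auto simp: cell_def Int_commute)
  obtain c where c: "c \<subseteq> ?V i" "?F = convex hull c"
    using F(1) vertices_independent[OF i] face_of_convex_hull_affine_independent by blast
  obtain c' where c': "c' \<subseteq> ?V l" "?F = convex hull c'"
    using F(2) vertices_independent[OF l] face_of_convex_hull_affine_independent by blast
  have ind: "\<not> affine_dependent c" "\<not> affine_dependent c'"
    using affine_independent_subset vertices_independent[OF i] vertices_independent[OF l] c c' by blast+
  have "c = c'"
    using extreme_point_of_convex_hull_affine_independent[OF ind(1)]
      extreme_point_of_convex_hull_affine_independent[OF ind(2)] c(2) c'(2) by auto
  have "c \<subseteq> {y. cell_map T \<eta> i y = cell_map T \<eta> l y}"
  proof
    fix y assume "y \<in> c"
    then obtain j k where jk: "y = pt T (vert T i j)" "y = pt T (vert T l k)"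
      using c(1) c'(1) \<open>c = c'\<close> by blast
    \<comment> \<open>Injectivity of \<open>pt T\<close> acts here: a shared point has one index,
      hence one discrete gradient.\<close>
    then have "vert T i j = vert T l k" using inj_pt vert_npts i l by metis
    then show "y \<in> {y. cell_map T \<eta> i y = cell_map T \<eta> l y}"
      using cell_map_vertex[OF i, of \<eta> j] cell_map_vertex[OF l, of \<eta> k] jk by simp
  qed
  moreover have "convex {y. cell_map T \<eta> i y = cell_map T \<eta> l y}"
  proof -
    have lin: "linear (\<lambda>y. cell_jacobian T \<eta> i *v y - cell_jacobian T \<eta> l *v y)"
      by (intro linear_compose_sub matrix_vector_mul_linear)
    define b where "b = (\<eta> (vert T l None) - cell_jacobian T \<eta> l *v pt T (vert T l None))
      - (\<eta> (vert T i None) - cell_jacobian T \<eta> i *v pt T (vert T i None))"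
    have "{y. cell_map T \<eta> i y = cell_map T \<eta> l y} = (\<lambda>y. cell_jacobian T \<eta> i *v y - cell_jacobian T \<eta> l *v y) -` {b}"
      by (auto simp: cell_map_def matrix_vector_mult_diff_distrib b_def algebra_simps)
    then show ?thesis using convex_linear_vimage[OF lin] by simp
  qed
  ultimately have "convex hull c \<subseteq> {y. cell_map T \<eta> i y = cell_map T \<eta> l y}" by (rule hull_minimal)
  with c(2) x show ?thesis by blast
qed

lemma pl_map_eq_cell_map:
  assumes "i < nsimp T" "x \<in> cell T i"
  shows "pl_map T \<eta> x = cell_map T \<eta> i x"
proof -
  have "(SOME i. i < nsimp T \<and> x \<in> cell T i) < nsimp T \<and> x \<in> cell T (SOME i. i < nsimp T \<and> x \<in> cell T i)"
    by (rule someI_ex) (use assms in blast)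
  then show ?thesis unfolding pl_map_def using cell_map_agree assms by blast
qed

text \<open>A common face that is proper in one of the two simplices has smaller affine dimension;
  it cannot be all of both, since different indices carry different cells.\<close>

lemma negligible_cell_overlap:
  assumes "i < nsimp T" "l < nsimp T" "i \<noteq> l"
  shows "negligible (cell T i \<inter> cell T l)"
proof (cases "cell T i \<inter> cell T l = {}")
  case False
  have "cell T i \<noteq> cell T l"
    using AT assms unfolding almost_triangulation_def inj_on_def by blast
  moreover have "negligible (cell T i \<inter> cell T l)"
    if il: "i < nsimp T" "l < nsimp T" "cell T i \<inter> cell T l \<noteq> {}" "cell T i \<inter> cell T l \<noteq> cell T i" for i l
  proof -
    have "aff_dim (cell T i \<inter> cell T l) < aff_dim (cell T i)"
      by (rule face_of_aff_dim_lt[OF _ cell_face[OF il(1-3)] il(4)]) (simp add: cell_def)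
    also have "\<dots> \<le> int DIM(real^'n)" by (rule aff_dim_le_DIM)
    finally have "interior (cell T i \<inter> cell T l) = {}" by (intro low_dim_interior) auto
    moreover have "convex (cell T i \<inter> cell T l)" by (simp add: cell_def convex_Int)
    ultimately show ?thesis using negligible_convex_interior by blast
  qed
  ultimately show ?thesis using assms False by (metis Int_commute)
qed simp

lemma pl_map_strictly_monotone:
  assumes K: "convex K" "K \<subseteq> (\<Union>i<nsimp T. cell T i)"
    and pd: "\<And>i. i < nsimp T \<Longrightarrow> pos_def (hess T \<eta> i)"
    and xy: "x \<in> K" "y \<in> K" "x \<noteq> y"
  shows "(pl_map T \<eta> y - pl_map T \<eta> x) \<bullet> (y - x) > 0"
proof (rule strictly_monotone_if_locally[OF K(1) _ xy])
  fix z assume "z \<in> K"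
  \<comment> \<open>Off the closed set \<open>D\<close> every covered point shares a cell with
    \<open>z\<close>, and on that cell the map is affine with positive definite symmetric
    part.\<close>
  define D where "D = (\<Union>i\<in>{i. i < nsimp T \<and> z \<notin> cell T i}. cell T i)"
  have "closed D" unfolding D_def by (intro closed_UN) (auto intro: compact_imp_closed compact_cell)
  moreover have "z \<notin> D" by (auto simp: D_def)
  ultimately obtain r where r: "r > 0" "ball z r \<subseteq> - D"
    by (metis ComplI open_Compl open_contains_ball)
  have "(pl_map T \<eta> z' - pl_map T \<eta> z) \<bullet> (z' - z) > 0" if z': "z' \<in> K" "z' \<noteq> z" "dist z z' < r" for z'
  proof -
    obtain i where i: "i < nsimp T" "z' \<in> cell T i" using z'(1) K(2) by auto
    have "z' \<notin> D" using r(2) z'(3) by auto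
    then have "z \<in> cell T i" using i by (auto simp: D_def)
    then have "(pl_map T \<eta> z' - pl_map T \<eta> z) \<bullet> (z' - z) = (z' - z) \<bullet> (hess T \<eta> i *v (z' - z))"
      using i by (simp add: pl_map_eq_cell_map cell_map_diff inner_commute cell_jacobian_quadratic)
    then show ?thesis using pd[OF i(1)] z'(2) by (simp add: pos_def_def)
  qed
  then show "\<exists>r>0. \<forall>z'\<in>K. z' \<noteq> z \<longrightarrow> dist z z' < r \<longrightarrow> (pl_map T \<eta> z' - pl_map T \<eta> z) \<bullet> (z' - z) > 0"
    using r(1) by blast
qed

text \<open>By injectivity on \<open>K\<close> a point in both images has a single preimage there,
  which lies in both cells; so the overlap sits in the affine image of a null set.\<close>

lemma cell_image_overlap_negligible:
  assumes K: "convex K" "K \<subseteq> (\<Union>i<nsimp T. cell T i)"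
    and pd: "\<And>i. i < nsimp T \<Longrightarrow> pos_def (hess T \<eta> i)"
    and il: "i < nsimp T" "l < nsimp T" "i \<noteq> l"
  shows "negligible (cell_map T \<eta> i ` (cell T i \<inter> K) \<inter> cell_map T \<eta> l ` (cell T l \<inter> K))"
proof (rule negligible_subset)
  have "inj_on (pl_map T \<eta>) K"
  proof (rule inj_onI, rule ccontr)
    fix x y assume "x \<in> K" "y \<in> K" "pl_map T \<eta> x = pl_map T \<eta> y" "x \<noteq> y"
    then show False using pl_map_strictly_monotone[OF K pd, of x y] by simp
  qed
  then show "cell_map T \<eta> i ` (cell T i \<inter> K) \<inter> cell_map T \<eta> l ` (cell T l \<inter> K) \<subseteq>
      cell_map T \<eta> i ` (cell T i \<inter> cell T l)"
  proof (intro subsetI)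
    fix y assume inj: "inj_on (pl_map T \<eta>) K"
      and "y \<in> cell_map T \<eta> i ` (cell T i \<inter> K) \<inter> cell_map T \<eta> l ` (cell T l \<inter> K)"
    then obtain a b where ab: "a \<in> cell T i" "a \<in> K" "y = cell_map T \<eta> i a" "b \<in> cell T l" "b \<in> K" "y = cell_map T \<eta> l b"
      by blast
    then have "pl_map T \<eta> a = pl_map T \<eta> b" using il by (simp add: pl_map_eq_cell_map)
    then have "a = b" using inj ab by (auto dest: inj_onD)
    with ab show "y \<in> cell_map T \<eta> i ` (cell T i \<inter> cell T l)" by blast
  qed
  have "cell T i \<inter> cell T l \<in> lmeasurable" "measure lebesgue (cell T i \<inter> cell T l) = 0"
    using negligible_cell_overlap[OF il] by (auto simp: negligible_imp_measurable negligible_imp_measure0)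
  then show "negligible (cell_map T \<eta> i ` (cell T i \<inter> cell T l))"
    using measure_cell_map_image[of "cell T i \<inter> cell T l" T \<eta> i] by (simp add: negligible_iff_measure)
qed

lemma hess_perturb:
  assumes i: "i < nsimp T"
  shows "hess T (\<lambda>j. \<eta> j + t *\<^sub>R pt T j) i = hess T \<eta> i + t *\<^sub>R mat 1"
proof -
  let ?A = "edge_matrix T (pt T) i"
  have scaleR: "X ** (t *\<^sub>R Y) = t *\<^sub>R (X ** Y)" for X Y :: "real^'n^'n"
    by (simp add: matrix_matrix_mult_def vec_eq_iff sum_distrib_left mult.left_commute)
  have "edge_matrix T (\<lambda>j. \<eta> j + t *\<^sub>R pt T j) i = edge_matrix T \<eta> i + t *\<^sub>R ?A"
    by (simp add: edge_matrix_def vec_eq_iff algebra_simps)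
  then have "matrix_inv ?A ** edge_matrix T (\<lambda>j. \<eta> j + t *\<^sub>R pt T j) i = matrix_inv ?A ** edge_matrix T \<eta> i + t *\<^sub>R mat 1"
    using matrix_inv_left[OF invertible_edge_matrix[OF i]] by (simp add: matrix_add_ldistrib scaleR)
  moreover have "transpose (X + t *\<^sub>R mat 1) = transpose X + t *\<^sub>R mat 1" for X :: "real^'n^'n"
    by (simp add: transpose_def vec_eq_iff mat_def)
  ultimately have "hess T (\<lambda>j. \<eta> j + t *\<^sub>R pt T j) i = (1/2) *\<^sub>R (matrix_inv ?A ** edge_matrix T \<eta> i + t *\<^sub>R mat 1)
      + (1/2) *\<^sub>R (transpose (matrix_inv ?A ** edge_matrix T \<eta> i) + t *\<^sub>R mat 1)"
    unfolding hess_def Let_def by (simp only:)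
  then show ?thesis
    by (simp add: hess_def Let_def vec_eq_iff add_divide_distrib)
qed

end

section \<open>Optimization potentials\<close>

lemma uniform_limit_if_pointwise_lipschitz:
  fixes F :: "nat \<Rightarrow> 'a::metric_space \<Rightarrow> 'b::metric_space"
  assumes W: "compact W" and lip: "\<And>k. L-lipschitz_on W (F k)"
    and lim: "\<And>x. x \<in> W \<Longrightarrow> (\<lambda>k. F k x) \<longlonglongrightarrow> \<phi> x"
  shows "uniform_limit W F \<phi> sequentially"
proof (rule uniform_limitI)
  fix e :: real assume e: "e > 0"
  have L: "L \<ge> 0" using lipschitz_on_nonneg[OF lip] .
  have \<phi>: "dist (\<phi> x) (\<phi> y) \<le> L * dist x y" if "x \<in> W" "y \<in> W" for x y
  proof (rule tendsto_upperbound)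
    show "(\<lambda>k. dist (F k x) (F k y)) \<longlonglongrightarrow> dist (\<phi> x) (\<phi> y)"
      by (intro tendsto_dist lim that)
    show "\<forall>\<^sub>F k in sequentially. dist (F k x) (F k y) \<le> L * dist x y"
      using lipschitz_onD[OF lip that] by simp
  qed simp
  define d where "d = e / (4 * (L + 1))"
  have d: "d > 0" "L * d \<le> e / 4" using e L by (auto simp: d_def field_simps)
  obtain C where C: "finite C" "C \<subseteq> W" "W \<subseteq> (\<Union>x\<in>C. ball x d)"
  proof (rule compactE_image[OF W, of W "\<lambda>x. ball x d"])
    show "W \<subseteq> (\<Union>x\<in>W. ball x d)" using d(1) by force
  qed (use that in auto)
  have "\<forall>\<^sub>F k in sequentially. \<forall>x\<in>C. dist (F k x) (\<phi> x) < e / 4"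
    using C lim e by (intro eventually_ball_finite ballI tendstoD) auto
  then show "\<forall>\<^sub>F k in sequentially. \<forall>x\<in>W. dist (F k x) (\<phi> x) < e"
  proof eventually_elim
    case (elim k)
    show ?case
    proof
      fix x assume x: "x \<in> W"
      then obtain y where y: "y \<in> C" "dist y x < d" using C(3) by auto
      then have yW: "y \<in> W" using C(2) by blast
      have "L * dist y x \<le> e / 4" using y(2) d L by (meson less_imp_le mult_left_mono order_trans)
      then have "dist (F k y) (F k x) \<le> e / 4" "dist (\<phi> y) (\<phi> x) \<le> e / 4"
        using lipschitz_onD[OF lip yW x, of k] \<phi>[OF yW x] by linarith+
      moreover have "dist (F k y) (\<phi> y) < e / 4" using elim y(1) by blast
      moreover have "dist (F k x) (\<phi> x) \<le> dist (F k y) (F k x) + dist (F k y) (\<phi> y) + dist (\<phi> y) (\<phi> x)"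
        using dist_triangle[of "F k x" "\<phi> x" "F k y"] dist_triangle[of "F k y" "\<phi> x" "\<phi> y"]
        by (simp add: dist_commute)
      ultimately show "dist (F k x) (\<phi> x) < e" using e by linarith
    qed
  qed
qed

lemma max_affine_ge: "j < npts T \<Longrightarrow> \<psi> j + \<eta> j \<bullet> (x - pt T j) \<le> max_affine T (\<psi>, \<eta>) x"
  by (simp add: max_affine_def)

lemma max_affine_attained:
  assumes "npts T > 0"
  obtains j where "j < npts T" "max_affine T (\<psi>, \<eta>) x = \<psi> j + \<eta> j \<bullet> (x - pt T j)"
proof -
  have "max_affine T (\<psi>, \<eta>) x \<in> (\<lambda>j. \<psi> j + \<eta> j \<bullet> (x - pt T j)) ` {..<npts T}"
    unfolding max_affine_def case_prod_conv using assms by (intro Max_in) auto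
  then show ?thesis using that by auto
qed

text \<open>The convexity constraints say exactly that no affine piece exceeds the
  \<open>j\<close>-th one at its own point. This is what makes the \<open>\<eta> j\<close> genuine
  subgradients of the potential.\<close>

lemma max_affine_vertex:
  assumes "discrete_convex \<Lambda> T \<psi> \<eta>" "j < npts T"
  shows "max_affine T (\<psi>, \<eta>) (pt T j) = \<psi> j"
proof (rule antisym)
  obtain i where i: "i < npts T" "max_affine T (\<psi>, \<eta>) (pt T j) = \<psi> i + \<eta> i \<bullet> (pt T j - pt T i)"
    using max_affine_attained[of T] assms(2) by (metis gr_zeroI not_less_zero)
  then show "max_affine T (\<psi>, \<eta>) (pt T j) \<le> \<psi> j"
    using assms by (simp add: discrete_convex_def)
  show "\<psi> j \<le> max_affine T (\<psi>, \<eta>) (pt T j)"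
    using max_affine_ge[OF assms(2), of \<psi> \<eta> "pt T j"] by simp
qed

lemma optimization_potential_0 [simp]: "optimization_potential T z 0 = 0"
  by (simp add: optimization_potential_def)

text \<open>A bound through the support function of \<open>\<Lambda>\<close>: it is stable under
  pointwise limits and serves both the Lipschitz estimate and, by separation, the location of the
  subgradients of the limit.\<close>

lemma optimization_potential_growth:
  assumes "npts T > 0" "discrete_convex \<Lambda> T \<psi> \<eta>" "\<And>y. y \<in> closure \<Lambda> \<Longrightarrow> y \<bullet> v \<le> s"
  shows "optimization_potential T (\<psi>, \<eta>) (x + v) \<le> optimization_potential T (\<psi>, \<eta>) x + s"
proof -
  obtain j where j: "j < npts T" "max_affine T (\<psi>, \<eta>) (x + v) = \<psi> j + \<eta> j \<bullet> (x + v - pt T j)"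
    using max_affine_attained[OF assms(1)] .
  have "\<eta> j \<in> closure \<Lambda>" using assms(2) j(1) by (simp add: discrete_convex_def)
  then have "\<eta> j \<bullet> v \<le> s" by (rule assms(3))
  then have "max_affine T (\<psi>, \<eta>) (x + v) \<le> max_affine T (\<psi>, \<eta>) x + s"
    using j(2) max_affine_ge[OF j(1), of \<psi> \<eta> x] by (simp add: inner_add_right inner_diff_right)
  then show ?thesis by (simp add: optimization_potential_def Let_def)
qed

lemma optimization_potential_lipschitz:
  assumes "npts T > 0" "discrete_convex \<Lambda> T \<psi> \<eta>" "\<And>y. y \<in> closure \<Lambda> \<Longrightarrow> norm y \<le> L" "L \<ge> 0"
  shows "L-lipschitz_on A (optimization_potential T (\<psi>, \<eta>))"
proof -
  have 1: "optimization_potential T (\<psi>, \<eta>) x - optimization_potential T (\<psi>, \<eta>) y \<le> L * norm (x - y)" for x y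
  proof -
    have "z \<bullet> (x - y) \<le> L * norm (x - y)" if "z \<in> closure \<Lambda>" for z
      using norm_cauchy_schwarz[of z "x - y"] mult_right_mono[OF assms(3)[OF that], of "norm (x - y)"] by simp
    from optimization_potential_growth[OF assms(1,2) this, of y] show ?thesis by simp
  qed
  show ?thesis by (rule lipschitz_on_if_diff_le) fact+
qed

lemma optimization_potential_convex:
  assumes "npts T > 0"
  shows "convex_on UNIV (optimization_potential T (\<psi>, \<eta>))"
proof (rule convex_onI)
  fix t :: real and x y assume t: "0 < t" "t < 1"
  obtain j where j: "j < npts T"
    "max_affine T (\<psi>, \<eta>) ((1 - t) *\<^sub>R x + t *\<^sub>R y) = \<psi> j + \<eta> j \<bullet> ((1 - t) *\<^sub>R x + t *\<^sub>R y - pt T j)"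
    using max_affine_attained[OF assms] .
  have "max_affine T (\<psi>, \<eta>) ((1 - t) *\<^sub>R x + t *\<^sub>R y)
    = (1 - t) * (\<psi> j + \<eta> j \<bullet> (x - pt T j)) + t * (\<psi> j + \<eta> j \<bullet> (y - pt T j))"
    unfolding j(2) by (simp add: inner_add_right inner_diff_right algebra_simps)
  also have "\<dots> \<le> (1 - t) * max_affine T (\<psi>, \<eta>) x + t * max_affine T (\<psi>, \<eta>) y"
    using t by (intro add_mono mult_left_mono max_affine_ge j(1)) auto
  finally show "optimization_potential T (\<psi>, \<eta>) ((1 - t) *\<^sub>R x + t *\<^sub>R y)
      \<le> (1 - t) * optimization_potential T (\<psi>, \<eta>) x + t * optimization_potential T (\<psi>, \<eta>) y"
    by (simp add: optimization_potential_def Let_def algebra_simps)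
qed simp

lemma optimization_potential_subgradient:
  assumes "discrete_convex \<Lambda> T \<psi> \<eta>" "j < npts T"
  shows "\<eta> j \<in> subdifferential (optimization_potential T (\<psi>, \<eta>)) (pt T j)"
  unfolding subdifferential_def
proof safe
  fix y
  show "optimization_potential T (\<psi>, \<eta>) y \<ge> optimization_potential T (\<psi>, \<eta>) (pt T j) + \<eta> j \<bullet> (y - pt T j)"
    using max_affine_ge[OF assms(2), of \<psi> \<eta> y] max_affine_vertex[OF assms]
    by (simp add: optimization_potential_def Let_def)
qed

lemma npts_pos:
  assumes "almost_triangulation \<Omega> T"
  shows "npts T > 0"
proof -
  have "0 < nsimp T" using assms by (simp add: almost_triangulation_def)
  then show ?thesis using vert_npts[OF assms, of 0 None] by linarith
qed

lemma vertex_in_cell: "pt T (vert T i j) \<in> cell T i"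
  unfolding cell_def by (intro hull_inc) blast

lemma vertex_mean_in_convex:
  fixes T :: "'n::finite simplices"
  assumes "convex C" "\<And>j. z (vert T i j) \<in> C"
  shows "vertex_mean T z i \<in> C"
proof -
  have "(\<Sum>j\<in>UNIV. (1 / (real CARD('n) + 1)) *\<^sub>R z (vert T i j)) \<in> C"
    by (rule convex_sum[OF _ assms(1)]) (auto simp: assms(2) card_UNIV_option)
  then show ?thesis by (simp add: vertex_mean_def scaleR_sum_right)
qed

lemma convex_combination_in:
  fixes w :: "'i::finite \<Rightarrow> real"
  assumes "convex C" "\<And>j. w j \<ge> 0" "sum w UNIV = 1" "\<And>j. p j \<in> C"
  shows "(\<Sum>j\<in>UNIV. w j *\<^sub>R p j) \<in> C"
  by (rule convex_sum[OF _ assms(1)]) (auto simp: assms)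

text \<open>The part of both problems that enters the limit: a feasible point whose Monge--Ampere defect
  vanishes in the mean. For both problems the defect is bounded by a multiple of the cost.\<close>

locale vanishing_defect = mass_transport \<Omega> \<Lambda> f g
  for \<Omega> \<Lambda> :: "(real^'n::finite) set" and f g :: "real^'n \<Rightarrow> real" +
  fixes T :: "nat \<Rightarrow> 'n simplices" and \<psi> :: "nat \<Rightarrow> nat \<Rightarrow> real" and \<eta> :: "nat \<Rightarrow> nat \<Rightarrow> real^'n"
    and defect :: "nat \<Rightarrow> nat \<Rightarrow> real"
  assumes adm: "admissible \<Omega> T"
    and dconvex: "\<And>k. discrete_convex \<Lambda> (T k) (\<psi> k) (\<eta> k)"
    and hess_psd: "\<And>k i. i < nsimp (T k) \<Longrightarrow> pos_semidef (hess (T k) (\<eta> k) i)"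
    and defect_nonneg: "\<And>k i. i < nsimp (T k) \<Longrightarrow> defect k i \<ge> 0"
    and defect_bound: "\<And>k i. i < nsimp (T k) \<Longrightarrow>
      f (vertex_mean (T k) (pt (T k)) i) \<le>
        g (vertex_mean (T k) (\<eta> k) i) * (\<bar>det (hess (T k) (\<eta> k) i)\<bar> + defect k i)"
    and defect_vanishes: "(\<lambda>k. \<Sum>i<nsimp (T k). volume (T k) i * defect k i) \<longlonglongrightarrow> 0"
begin

abbreviation "\<Phi> k \<equiv> optimization_potential (T k) (\<psi> k, \<eta> k)"

lemma AT: "almost_triangulation \<Omega> (T k)"
  using adm by (simp add: admissible_def)

lemma \<eta>_closure: "i < nsimp (T k) \<Longrightarrow> \<eta> k (vert (T k) i j) \<in> closure \<Lambda>"
  using dconvex vert_npts[OF AT] by (simp add: discrete_convex_def)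

lemma cell_closure: "i < nsimp (T k) \<Longrightarrow> cell (T k) i \<subseteq> closure \<Omega>"
  using AT[of k] by (simp add: almost_triangulation_def)

lemma mesh_eventually_small:
  assumes "\<epsilon> > 0"
  shows "\<forall>\<^sub>F k in sequentially. \<forall>i<nsimp (T k). \<forall>x\<in>cell (T k) i. \<forall>y\<in>cell (T k) i. norm (x - y) < \<epsilon>"
proof -
  have "(\<lambda>k. MAX i\<in>{..<nsimp (T k)}. diameter (cell (T k) i)) \<longlonglongrightarrow> 0"
    using adm by (simp add: admissible_def)
  then have "\<forall>\<^sub>F k in sequentially. (MAX i\<in>{..<nsimp (T k)}. diameter (cell (T k) i)) < \<epsilon>"
    using assms by (rule order_tendstoD)
  then show ?thesis
  proof eventually_elim
    case (elim k)
    show ?case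
    proof (intro allI impI ballI)
      fix i x y assume i: "i < nsimp (T k)" and xy: "x \<in> cell (T k) i" "y \<in> cell (T k) i"
      have "norm (x - y) \<le> diameter (cell (T k) i)"
        using diameter_bounded_bound[OF compact_imp_bounded[OF compact_cell] xy] by (simp add: dist_norm)
      also have "\<dots> \<le> (MAX i\<in>{..<nsimp (T k)}. diameter (cell (T k) i))"
        using i by (intro Max_ge) auto
      finally show "norm (x - y) < \<epsilon>" using elim by simp
    qed
  qed
qed

lemma compact_eventually_covered:
  assumes K: "compact K" "K \<subseteq> \<Omega>"
  shows "\<forall>\<^sub>F k in sequentially. K \<subseteq> (\<Union>i<nsimp (T k). cell (T k) i)"
proof -
  obtain \<Omega>' :: "real \<Rightarrow> (real^'n) set" where \<Omega>':
    "\<forall>\<epsilon>>0. open (\<Omega>' \<epsilon>) \<and> \<Omega>' \<epsilon> \<subseteq> \<Omega>"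
    "\<forall>\<epsilon>>0. \<forall>\<delta>>0. \<delta> \<le> \<epsilon> \<longrightarrow> \<Omega>' \<epsilon> \<subseteq> \<Omega>' \<delta>"
    "(\<Union>\<epsilon>\<in>{0<..}. \<Omega>' \<epsilon>) = \<Omega>"
    "\<forall>\<^sub>F \<epsilon> in at_right 0. \<forall>\<^sub>F k in sequentially.
       {x + y |x y. x \<in> \<Omega>' \<epsilon> \<and> y \<in> ball 0 \<epsilon>} \<subseteq> (\<Union>i<nsimp (T k). cell (T k) i)"
    using adm unfolding admissible_def by (elim conjE exE) (rule that, assumption+)
  obtain C where C: "C \<subseteq> {0<..}" "finite C" "K \<subseteq> (\<Union>\<epsilon>\<in>C. \<Omega>' \<epsilon>)"
    using compactE_image[OF K(1), of "{0<..}" \<Omega>'] \<Omega>'(1,3) K(2) by (metis greaterThan_iff)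
  \<comment> \<open>By monotonicity of the sets \<open>\<Omega>' \<epsilon>\<close>, one parameter
    below all those of the finite subcover captures \<open>K\<close>; \<open>insert 1 C\<close>
    keeps \<open>Min\<close> meaningful when \<open>C\<close> is empty.\<close>
  define e0 where "e0 = Min (insert 1 C)"
  have e0: "e0 > 0" using C by (auto simp: e0_def)
  have "\<forall>\<^sub>F \<epsilon> in at_right 0. 0 < \<epsilon> \<and> \<epsilon> < e0"
    using e0 eventually_at_right_less[of "0::real"] eventually_at_right_field by auto
  from eventually_happens'[OF trivial_limit_at_right_real eventually_conj[OF \<Omega>'(4) this]]
  obtain \<epsilon> where \<epsilon>: "\<forall>\<^sub>F k in sequentially.
      {x + y |x y. x \<in> \<Omega>' \<epsilon> \<and> y \<in> ball 0 \<epsilon>} \<subseteq> (\<Union>i<nsimp (T k). cell (T k) i)" "0 < \<epsilon>" "\<epsilon> < e0"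
    by (elim exE conjE)
  have "K \<subseteq> \<Omega>' \<epsilon>"
  proof
    fix x assume "x \<in> K"
    then obtain c where c: "c \<in> C" "x \<in> \<Omega>' c" using C(3) by blast
    then have "\<epsilon> \<le> c" using \<epsilon>(3) C(2) by (auto simp: e0_def)
    then show "x \<in> \<Omega>' \<epsilon>" using \<Omega>'(2) c C(1) \<epsilon>(2) by (auto simp: subset_iff)
  qed
  moreover have "\<Omega>' \<epsilon> \<subseteq> {x + y |x y. x \<in> \<Omega>' \<epsilon> \<and> y \<in> ball 0 \<epsilon>}"
  proof
    fix x assume "x \<in> \<Omega>' \<epsilon>"
    then show "x \<in> {x + y |x y. x \<in> \<Omega>' \<epsilon> \<and> y \<in> ball 0 \<epsilon>}"
      using \<epsilon>(2) by (intro CollectI exI[of _ x] exI[of _ 0]) auto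
  qed
  ultimately have "K \<subseteq> {x + y |x y. x \<in> \<Omega>' \<epsilon> \<and> y \<in> ball 0 \<epsilon>}" by (rule order_trans)
  then show ?thesis by (rule eventually_mono[OF \<epsilon>(1) order_trans])
qed

lemma \<Phi>_lipschitz:
  assumes "\<And>y. y \<in> closure \<Lambda> \<Longrightarrow> norm y \<le> L" "L \<ge> 0"
  shows "L-lipschitz_on A (\<Phi> k)"
  using optimization_potential_lipschitz[OF npts_pos[OF AT] dconvex assms] .

end

section \<open>Properties of pointwise limits of the potentials\<close>

locale vanishing_defect_limit = vanishing_defect \<Omega> \<Lambda> f g T \<psi> \<eta> defect
  for \<Omega> \<Lambda> :: "(real^'n::finite) set" and f g T \<psi> \<eta> defect +
  fixes \<phi> :: "real^'n \<Rightarrow> real"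
  assumes lim: "\<And>x. (\<lambda>k. \<Phi> k x) \<longlonglongrightarrow> \<phi> x"
begin

lemma limit_uniform: "uniform_limit (closure \<Omega>) \<Phi> \<phi> sequentially"
proof -
  obtain L where "L > 0" "\<And>y. y \<in> closure \<Lambda> \<Longrightarrow> norm y \<le> L" using tgt.norm_bound by metis
  then show ?thesis
    by (intro uniform_limit_if_pointwise_lipschitz[of _ L] src.compact_closure_S \<Phi>_lipschitz lim) auto
qed

lemma limit_0: "\<phi> 0 = 0"
  using LIMSEQ_unique[OF lim[of 0]] by simp

lemma limit_convex: "convex_on UNIV \<phi>"
proof (rule convex_onI)
  fix t :: real and x y :: "real^'n" assume t: "0 < t" "t < 1"
  show "\<phi> ((1 - t) *\<^sub>R x + t *\<^sub>R y) \<le> (1 - t) * \<phi> x + t * \<phi> y"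
  proof (rule LIMSEQ_le[OF lim])
    show "(\<lambda>k. (1 - t) * \<Phi> k x + t * \<Phi> k y) \<longlonglongrightarrow> (1 - t) * \<phi> x + t * \<phi> y"
      by (intro tendsto_intros lim)
    show "\<exists>N. \<forall>k\<ge>N. \<Phi> k ((1 - t) *\<^sub>R x + t *\<^sub>R y) \<le> (1 - t) * \<Phi> k x + t * \<Phi> k y"
      using convex_onD[OF optimization_potential_convex[OF npts_pos[OF AT]]] t by auto
  qed
qed simp

lemma limit_potential: "potential \<phi>"
  unfolding potential_def
proof (intro conjI limit_convex subsetI, rule ccontr)
  fix p assume p: "p \<in> (\<Union>x. subdifferential \<phi> x)" "p \<notin> closure \<Lambda>"
  then obtain x where x: "p \<in> subdifferential \<phi> x" by blast
  obtain v s where v: "v \<bullet> p < s" "\<And>y. y \<in> closure \<Lambda> \<Longrightarrow> v \<bullet> y > s"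
    using separating_hyperplane_closed_point[OF convex_closure[OF convex_target] closed_closure p(2)] by auto
  \<comment> \<open>Moving against the separating direction, slopes in
    \<open>closure \<Lambda>\<close> lower the potential by at least \<open>s\<close>, while the
    subgradient \<open>p\<close> allows only a drop of less than \<open>s\<close>.\<close>
  have "\<phi> (x + - v) \<le> \<phi> x + - s"
  proof (rule LIMSEQ_le[OF lim])
    show "(\<lambda>k. \<Phi> k x + - s) \<longlonglongrightarrow> \<phi> x + - s" by (intro tendsto_intros lim)
    have "\<Phi> k (x + - v) \<le> \<Phi> k x + - s" for k
      using v(2) by (intro optimization_potential_growth[OF npts_pos[OF AT] dconvex]) (auto simp: inner_commute less_imp_le)
    then show "\<exists>N. \<forall>k\<ge>N. \<Phi> k (x + - v) \<le> \<Phi> k x + - s" by blast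
  qed
  moreover have "\<phi> (x - v) \<ge> \<phi> x + p \<bullet> (x - v - x)"
    using x unfolding subdifferential_def by blast
  ultimately show False using v(1) by (simp add: inner_commute)
qed

lemma discrete_gradients_approx_subgradients:
  assumes \<tau>: "\<tau> > 0"
  shows "\<forall>\<^sub>F k in sequentially. \<forall>i<nsimp (T k). \<forall>x\<in>cell (T k) i. \<forall>j. \<forall>w\<in>closure \<Omega>.
    \<phi> w \<ge> \<phi> x + \<eta> k (vert (T k) i j) \<bullet> (w - x) - \<tau>"
proof -
  obtain L where L: "L > 0" "\<And>y. y \<in> closure \<Lambda> \<Longrightarrow> norm y \<le> L" using tgt.norm_bound by metis
  have "\<forall>\<^sub>F k in sequentially. \<forall>x\<in>closure \<Omega>. dist (\<Phi> k x) (\<phi> x) < \<tau> / 4"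
    by (rule uniform_limitD[OF limit_uniform]) (use \<tau> in simp)
  \<comment> \<open>Four errors of \<open>\<tau> / 4\<close>: the distance of
    \<open>\<Phi> k\<close> to \<open>\<phi>\<close> at \<open>x\<close> and at \<open>w\<close>,
    and the move of the base point from the vertex to \<open>x\<close>, once in the potential and
    once in the slope term.\<close>
  moreover have "\<forall>\<^sub>F k in sequentially. \<forall>i<nsimp (T k). \<forall>x\<in>cell (T k) i. \<forall>y\<in>cell (T k) i. norm (x - y) < \<tau> / (4 * L)"
    using L \<tau> by (intro mesh_eventually_small) simp
  ultimately show ?thesis
  proof eventually_elim
    case (elim k)
    show ?case
    proof (intro allI impI ballI)
      fix i x j w assume i: "i < nsimp (T k)" and x: "x \<in> cell (T k) i" and w: "w \<in> closure \<Omega>"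
      let ?v = "pt (T k) (vert (T k) i j)" and ?p = "\<eta> k (vert (T k) i j)"
      have xv: "norm (x - ?v) \<le> \<tau> / (4 * L)"
        using elim(2) i x vertex_in_cell by (meson less_imp_le)
      then have Lxv: "L * norm (x - ?v) \<le> \<tau> / 4" using L(1) by (simp add: field_simps)
      have "\<Phi> k w \<ge> \<Phi> k ?v + ?p \<bullet> (w - ?v)"
        using optimization_potential_subgradient[OF dconvex[of k] vert_npts[OF AT i]]
        unfolding subdifferential_def by blast
      moreover have "dist (\<Phi> k x) (\<Phi> k ?v) \<le> L * dist x ?v"
        using lipschitz_onD[OF \<Phi>_lipschitz[OF L(2), of UNIV k], of x ?v] L(1) by simp
      moreover have "\<bar>?p \<bullet> (x - ?v)\<bar> \<le> L * norm (x - ?v)"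
        by (rule order_trans[OF Cauchy_Schwarz_ineq2 mult_right_mono]) (use L(2) \<eta>_closure[OF i] in auto)
      moreover have "?p \<bullet> (w - ?v) = ?p \<bullet> (w - x) + ?p \<bullet> (x - ?v)" by (simp add: inner_diff_right)
      moreover have "dist (\<Phi> k x) (\<phi> x) < \<tau> / 4" "dist (\<Phi> k w) (\<phi> w) < \<tau> / 4"
        using elim(1) w x cell_closure[OF i] by auto
      ultimately show "\<phi> w \<ge> \<phi> x + ?p \<bullet> (w - x) - \<tau>"
        using Lxv unfolding dist_real_def dist_norm[of x] by linarith
    qed
  qed
qed

text \<open>The gradients at the vertices of a cell containing \<open>x\<close> are approximate
  subgradients at \<open>x\<close>, where differentiability of \<open>\<phi>\<close> forces them
  close to its gradient. The threshold in \<open>k\<close> depends on \<open>x\<close>; no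
  uniformity is claimed.\<close>

lemma gradient_oscillation_vanishes:
  assumes x: "x \<in> \<Omega>" "x \<in> smooth_points \<phi>" and \<delta>: "\<delta> > 0"
  shows "\<forall>\<^sub>F k in sequentially. \<forall>i<nsimp (T k). x \<in> cell (T k) i \<longrightarrow>
    (\<forall>j l. norm (\<eta> k (vert (T k) i j) - \<eta> k (vert (T k) i l)) \<le> \<delta>)"
proof -
  let ?p = "gradient \<phi> x"
  obtain \<tau> where \<tau>: "\<tau> > 0"
    "\<And>q. (\<And>w. w \<in> closure \<Omega> \<Longrightarrow> \<phi> w \<ge> \<phi> x + q \<bullet> (w - x) - \<tau>) \<Longrightarrow> norm (q - ?p) \<le> \<delta> / 2"
    using approx_subgradient_near_gradient[OF gradient_in_subdifferential(2)[OF limit_convex x(2)] source_in_interior[OF x(1)], of "\<delta>/2"] \<delta>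
    by (metis half_gt_zero)
  from discrete_gradients_approx_subgradients[OF \<tau>(1)] show ?thesis
  proof eventually_elim
    case (elim k)
    show ?case
    proof (intro allI impI)
      fix i j l assume i: "i < nsimp (T k)" "x \<in> cell (T k) i"
      have *: "norm (\<eta> k (vert (T k) i j) - ?p) \<le> \<delta> / 2" for j
        using elim i by (intro \<tau>(2)) blast
      show "norm (\<eta> k (vert (T k) i j) - \<eta> k (vert (T k) i l)) \<le> \<delta>"
        using norm_triangle_ineq4[of "\<eta> k (vert (T k) i j) - ?p" "\<eta> k (vert (T k) i l) - ?p"] *[of j] *[of l] by simp
    qed
  qed
qed

end

section \<open>Mass balance on compact pieces\<close>

context positive_density
begin

lemma emeasure_M_subset:
  assumes A: "A \<in> sets borel" "A \<subseteq> S"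
  shows "emeasure M A = (\<integral>\<^sup>+x. ennreal (h x) * indicator A x \<partial>lborel)"
proof -
  have "emeasure M A = (\<integral>\<^sup>+x. ennreal (h x) * indicator S x * indicator A x \<partial>lborel)"
    using A unfolding density_on_def by (intro emeasure_density) auto
  also have "\<dots> = (\<integral>\<^sup>+x. ennreal (h x) * indicator A x \<partial>lborel)"
    using A(2) by (intro nn_integral_cong) (auto simp: indicator_def)
  finally show ?thesis .
qed

lemma emeasure_lborel_subset:
  assumes "A \<in> sets borel" "A \<subseteq> S"
  shows "emeasure lborel A = ennreal (measure lebesgue A)"
proof -
  have "emeasure lborel A < \<infinity>" by (rule emeasure_bounded_finite[OF bounded_subset[OF bounded_S assms(2)]])
  then show ?thesis using assms(1) by (simp add: emeasure_eq_ennreal_measure)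
qed

lemma measure_M_le:
  assumes A: "A \<in> sets borel" "A \<subseteq> S" and b: "b \<ge> 0" "\<And>x. x \<in> A \<Longrightarrow> h x \<le> b"
  shows "measure M A \<le> b * measure lebesgue A"
proof -
  have "emeasure M A \<le> (\<integral>\<^sup>+x. ennreal b * indicator A x \<partial>lborel)"
    unfolding emeasure_M_subset[OF A] using b(2)
    by (intro nn_integral_mono) (auto simp: indicator_def intro: ennreal_leI)
  also have "\<dots> = ennreal b * emeasure lborel A" using A(1) by (simp add: nn_integral_cmult)
  also have "\<dots> = ennreal (b * measure lebesgue A)"
    using b(1) by (simp add: emeasure_lborel_subset[OF A] ennreal_mult)
  finally show ?thesis
    using b(1) by (simp add: emeasure_eq_measure ennreal_le_iff)
qed

text \<open>\<open>b\<close> may be negative, as it is used with a value of \<open>g\<close> minus a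
  tolerance.\<close>

lemma measure_M_ge:
  assumes A: "A \<in> sets borel" "A \<subseteq> S" and b: "\<And>x. x \<in> A \<Longrightarrow> b \<le> h x"
  shows "b * measure lebesgue A \<le> measure M A"
proof (cases "b \<ge> 0")
  case True
  have "ennreal (b * measure lebesgue A) = ennreal b * emeasure lborel A"
    using True by (simp add: emeasure_lborel_subset[OF A] ennreal_mult)
  also have "\<dots> = (\<integral>\<^sup>+x. ennreal b * indicator A x \<partial>lborel)" using A(1) by (simp add: nn_integral_cmult)
  also have "\<dots> \<le> emeasure M A"
    unfolding emeasure_M_subset[OF A] using b
    by (intro nn_integral_mono) (auto simp: indicator_def intro: ennreal_leI)
  finally show ?thesis
    by (simp add: emeasure_eq_measure ennreal_le_iff)
next
  case False
  then have "b * measure lebesgue A \<le> 0" by (simp add: mult_nonpos_nonneg)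
  then show ?thesis using measure_nonneg[of M A] by linarith
qed

end

section \<open>Extension of the target density to a ball\<close>

context mass_transport
begin

lemma target_nonempty: "\<Lambda> \<noteq> {}"
proof
  assume "\<Lambda> = {}"
  then have "(LINT y:\<Lambda>|lborel. g y) = 0" by (simp add: set_lebesgue_integral_def)
  then have "emeasure \<mu> UNIV = 0" by (simp add: src.emeasure_M_UNIV mass_eq)
  then have "AE x in \<mu>. x \<notin> UNIV" by (intro AE_I[of _ _ UNIV]) auto
  then show False using src.open_charged[of UNIV] source_nonempty by simp
qed

definition rad :: real where
  "rad = (SOME r. r > 0 \<and> (\<forall>x\<in>closure \<Omega>. norm x \<le> r) \<and> (\<forall>y\<in>closure \<Lambda>. norm y \<le> r))"

lemma rad: "rad > 0" "x \<in> closure \<Omega> \<Longrightarrow> norm x \<le> rad" "y \<in> closure \<Lambda> \<Longrightarrow> norm y \<le> rad"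
proof -
  obtain R where R: "R > 0" "\<And>x. x \<in> closure \<Omega> \<Longrightarrow> norm x \<le> R" using src.norm_bound by metis
  obtain L where L: "L > 0" "\<And>x. x \<in> closure \<Lambda> \<Longrightarrow> norm x \<le> L" using tgt.norm_bound by metis
  have "\<exists>r. r > 0 \<and> (\<forall>x\<in>closure \<Omega>. norm x \<le> r) \<and> (\<forall>y\<in>closure \<Lambda>. norm y \<le> r)"
    using R L by (intro exI[of _ "max R L"]) (auto simp: le_max_iff_disj)
  then have "rad > 0 \<and> (\<forall>x\<in>closure \<Omega>. norm x \<le> rad) \<and> (\<forall>y\<in>closure \<Lambda>. norm y \<le> rad)"
    unfolding rad_def by (rule someI_ex)
  then show "rad > 0" "x \<in> closure \<Omega> \<Longrightarrow> norm x \<le> rad" "y \<in> closure \<Lambda> \<Longrightarrow> norm y \<le> rad" by auto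
qed

text \<open>Images of the tilted interpolation may leave \<open>closure \<Lambda>\<close>; composing
  with the projection onto this convex set keeps continuity, the two-sided bounds and the modulus of
  continuity of \<open>g\<close>.\<close>

definition ext_g :: "'a \<Rightarrow> real" where
  "ext_g y = g (closest_point (closure \<Lambda>) y)"

lemma closest_in_closure: "closest_point (closure \<Lambda>) y \<in> closure \<Lambda>"
  using target_nonempty by (intro closest_point_in_set) auto

lemma ext_g_eq: "y \<in> closure \<Lambda> \<Longrightarrow> ext_g y = g y"
  by (simp add: ext_g_def closest_point_self)

lemma continuous_ext_g: "continuous_on A ext_g"
proof -
  have "continuous_on A (closest_point (closure \<Lambda>))"
    using continuous_on_closest_point[OF convex_closure[OF convex_target] closed_closure] target_nonempty by simp
  then show ?thesis
    unfolding ext_g_def by (rule continuous_on_compose2[OF tgt.cont_h]) (auto intro: closest_in_closure)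
qed

lemma ext_g_near:
  assumes "\<omega> > 0"
  obtains \<delta> where "\<delta> > 0" "\<And>y m. m \<in> closure \<Lambda> \<Longrightarrow> norm (y - m) < \<delta> \<Longrightarrow> g m \<le> ext_g y + \<omega>"
proof -
  have "uniformly_continuous_on (closure \<Lambda>) g"
    by (rule compact_uniformly_continuous[OF tgt.cont_h tgt.compact_closure_S])
  then obtain \<delta> where \<delta>: "\<delta> > 0"
    "\<And>y m. y \<in> closure \<Lambda> \<Longrightarrow> m \<in> closure \<Lambda> \<Longrightarrow> dist y m < \<delta> \<Longrightarrow> dist (g y) (g m) < \<omega>"
    using assms unfolding uniformly_continuous_on_def by metis
  show ?thesis
  proof (rule that[OF \<delta>(1)])
    fix y m assume m: "m \<in> closure \<Lambda>" "norm (y - m) < \<delta>"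
    have "dist (closest_point (closure \<Lambda>) y) (closest_point (closure \<Lambda>) m) \<le> dist y m"
      using closest_point_lipschitz[OF convex_closure[OF convex_target] closed_closure] target_nonempty by simp
    then have "dist (closest_point (closure \<Lambda>) y) m < \<delta>"
      using m by (simp add: closest_point_self dist_norm)
    from \<delta>(2)[OF closest_in_closure m(1) this] show "g m \<le> ext_g y + \<omega>"
      by (simp add: ext_g_def dist_real_def abs_less_iff)
  qed
qed

lemma ext_g_positive_density: "positive_density (ball 0 (2 * rad + 1)) ext_g"
proof
  obtain c C where "0 < c" "\<And>y. y \<in> closure \<Lambda> \<Longrightarrow> c \<le> g y \<and> g y \<le> C"
    using tgt.bounds_h by blast
  then show "\<exists>c C. 0 < c \<and> (\<forall>x\<in>closure (ball 0 (2 * rad + 1)). c \<le> ext_g x \<and> ext_g x \<le> C)"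
    unfolding ext_g_def using closest_in_closure by blast
qed (auto intro: continuous_ext_g)

end

sublocale mass_transport \<subseteq> ext: positive_density "ball 0 (2 * rad + 1)" ext_g
  by (rule ext_g_positive_density)

abbreviation (in mass_transport) "\<nu>' \<equiv> density_on (ball 0 (2 * rad + 1)) ext_g"

lemma tendsto_det_perturb:
  fixes H :: "real^'n^'n"
  shows "((\<lambda>t. det (H + t *\<^sub>R mat 1)) \<longlongrightarrow> det H) (at_right 0)"
proof -
  have "((\<lambda>t. det (H + t *\<^sub>R mat 1)) \<longlongrightarrow> det (H + 0 *\<^sub>R mat 1)) (at_right 0)"
    unfolding det_def vector_add_component vector_scaleR_component by (intro tendsto_intros)
  then show ?thesis by simp
qed

context vanishing_defect
begin

text \<open>Tilting by a small multiple of the identity makes the interpolated gradient strictly monotone,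
  hence injective, also for the DMAOP.\<close>

definition tilt :: "nat \<Rightarrow> real" where
  "tilt k = (SOME t. 0 < t \<and> t < inverse (real (Suc k)) \<and>
     (\<forall>i<nsimp (T k). \<bar>det (hess (T k) (\<eta> k) i)\<bar> \<le> \<bar>det (hess (T k) (\<eta> k) i + t *\<^sub>R mat 1)\<bar> + inverse (real (Suc k))))"

definition tilted :: "nat \<Rightarrow> nat \<Rightarrow> real^'n" where
  "tilted k j = \<eta> k j + tilt k *\<^sub>R pt (T k) j"

lemma tilt_properties:
  "0 < tilt k" "tilt k < inverse (real (Suc k))"
  "i < nsimp (T k) \<Longrightarrow> \<bar>det (hess (T k) (\<eta> k) i)\<bar> \<le> \<bar>det (hess (T k) (tilted k) i)\<bar> + inverse (real (Suc k))"
proof -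
  let ?e = "inverse (real (Suc k))"
  have e: "?e > 0" by simp
  \<comment> \<open>\<open>k\<close> is fixed and has finitely many cells, so continuity of the
    determinant at 0 yields one tilt for all of them.\<close>
  have "\<forall>\<^sub>F t in at_right 0. \<forall>i\<in>{..<nsimp (T k)}. \<bar>det (hess (T k) (\<eta> k) i)\<bar> \<le> \<bar>det (hess (T k) (\<eta> k) i + t *\<^sub>R mat 1)\<bar> + ?e"
  proof (intro eventually_ball_finite ballI)
    fix i
    have "((\<lambda>t. \<bar>det (hess (T k) (\<eta> k) i + t *\<^sub>R mat 1)\<bar> + ?e) \<longlongrightarrow> \<bar>det (hess (T k) (\<eta> k) i)\<bar> + ?e) (at_right 0)"
      by (intro tendsto_intros tendsto_det_perturb)
    then have "\<forall>\<^sub>F t in at_right 0. \<bar>det (hess (T k) (\<eta> k) i)\<bar> < \<bar>det (hess (T k) (\<eta> k) i + t *\<^sub>R mat 1)\<bar> + ?e"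
      by (rule order_tendstoD) (use e in linarith)
    then show "\<forall>\<^sub>F t in at_right 0. \<bar>det (hess (T k) (\<eta> k) i)\<bar> \<le> \<bar>det (hess (T k) (\<eta> k) i + t *\<^sub>R mat 1)\<bar> + ?e"
      by (rule eventually_mono) simp
  qed simp
  moreover have "\<forall>\<^sub>F t in at_right 0. 0 < t \<and> t < ?e"
    using eventually_at_right_real[OF e] by (rule eventually_mono) simp
  ultimately have "\<forall>\<^sub>F t in at_right 0. 0 < t \<and> t < ?e \<and>
     (\<forall>i<nsimp (T k). \<bar>det (hess (T k) (\<eta> k) i)\<bar> \<le> \<bar>det (hess (T k) (\<eta> k) i + t *\<^sub>R mat 1)\<bar> + ?e)"
    by eventually_elim auto
  from someI_ex[OF eventually_happens'[OF trivial_limit_at_right_real this], folded tilt_def]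
  have t: "0 < tilt k" "tilt k < ?e"
    "\<And>i. i < nsimp (T k) \<Longrightarrow> \<bar>det (hess (T k) (\<eta> k) i)\<bar> \<le> \<bar>det (hess (T k) (\<eta> k) i + tilt k *\<^sub>R mat 1)\<bar> + ?e"
    by blast+
  then show "0 < tilt k" "tilt k < ?e" by blast+
  have tf: "tilted k = (\<lambda>j. \<eta> k j + tilt k *\<^sub>R pt (T k) j)" by (simp add: fun_eq_iff tilted_def)
  show "\<bar>det (hess (T k) (\<eta> k) i)\<bar> \<le> \<bar>det (hess (T k) (tilted k) i)\<bar> + ?e" if "i < nsimp (T k)"
    using t(3)[OF that] unfolding tf hess_perturb[OF AT that] .
qed

lemma tilted_pos_def:
  assumes "i < nsimp (T k)"
  shows "pos_def (hess (T k) (tilted k) i)"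
proof -
  have tf: "tilted k = (\<lambda>j. \<eta> k j + tilt k *\<^sub>R pt (T k) j)" by (simp add: fun_eq_iff tilted_def)
  let ?H = "hess (T k) (\<eta> k) i"
  have psd: "transpose ?H = ?H" "\<And>v. v \<bullet> (?H *v v) \<ge> 0"
    using hess_psd[OF assms] by (auto simp: pos_semidef_def)
  have e: "hess (T k) (tilted k) i = ?H + tilt k *\<^sub>R mat 1"
    unfolding tf by (rule hess_perturb[OF AT assms])
  show ?thesis
    unfolding pos_def_def
  proof (intro conjI allI impI)
    show "transpose (hess (T k) (tilted k) i) = hess (T k) (tilted k) i"
      unfolding e using psd(1) by (simp add: transpose_def vec_eq_iff mat_def)
    fix v :: "real^'n" assume v: "v \<noteq> 0"
    have "v \<bullet> (hess (T k) (tilted k) i *v v) = v \<bullet> (?H *v v) + tilt k * (v \<bullet> v)"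
      unfolding e by (simp add: matrix_vector_mult_add_rdistrib scaleR_matrix_vector_assoc[symmetric] inner_add_right)
    also have "\<dots> > 0" using psd(2)[of v] tilt_properties(1)[of k] v by (simp add: add_nonneg_pos)
    finally show "v \<bullet> (hess (T k) (tilted k) i *v v) > 0" .
  qed
qed

text \<open>Without the tilt the value is a convex combination of the vertex gradients.
  \<open>C\<close> stays free because it is used for \<open>closure \<Lambda>\<close>, for small
  balls and for sets of approximate subgradients.\<close>

lemma tilted_cell_map_in_convex:
  assumes i: "i < nsimp (T k)" and x: "x \<in> cell (T k) i" and C: "convex C" "\<And>j. \<eta> k (vert (T k) i j) \<in> C"
  shows "cell_map (T k) (tilted k) i x - tilt k *\<^sub>R x \<in> C"
proof -
  obtain w where w: "\<And>j. w j \<ge> 0" "sum w UNIV = 1" "x = (\<Sum>j\<in>UNIV. w j *\<^sub>R pt (T k) (vert (T k) i j))"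
    "cell_map (T k) (tilted k) i x = (\<Sum>j\<in>UNIV. w j *\<^sub>R tilted k (vert (T k) i j))"
    by (rule cell_map_weights[OF AT i x, where \<eta> = "tilted k"]) blast
  have "cell_map (T k) (tilted k) i x = (\<Sum>j\<in>UNIV. w j *\<^sub>R \<eta> k (vert (T k) i j))
      + tilt k *\<^sub>R (\<Sum>j\<in>UNIV. w j *\<^sub>R pt (T k) (vert (T k) i j))"
    unfolding w(4) by (simp add: tilted_def scaleR_add_right sum.distrib scaleR_sum_right mult.commute)
  then have "cell_map (T k) (tilted k) i x - tilt k *\<^sub>R x = (\<Sum>j\<in>UNIV. w j *\<^sub>R \<eta> k (vert (T k) i j))"
    using w(3) by simp
  then show ?thesis using convex_combination_in[OF C(1) w(1,2) C(2)] by simp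
qed

lemma tilt_tendsto: "(\<lambda>k. tilt k * c) \<longlonglongrightarrow> 0"
proof -
  have "tilt \<longlonglongrightarrow> 0"
    by (rule real_tendsto_sandwich[of "\<lambda>_. 0" _ _ "\<lambda>k. inverse (real (Suc k))"])
      (auto simp: LIMSEQ_inverse_real_of_nat less_imp_le tilt_properties simp del: of_nat_Suc)
  from tendsto_mult_left_zero[OF this] show ?thesis .
qed

definition piece :: "(real^'n) set \<Rightarrow> nat \<Rightarrow> nat \<Rightarrow> (real^'n) set" where
  "piece K k i = cell_map (T k) (tilted k) i ` (cell (T k) i \<inter> K)"

lemma compact_piece: "compact K \<Longrightarrow> compact (piece K k i)"
  unfolding piece_def by (intro compact_cell_map_image compact_Int compact_cell)

text \<open>Gradients have norm at most \<open>rad\<close>, the tilt adds at most \<open>rad\<close>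
  because \<open>tilt k \<le> 1\<close>, and the extra 1 allows an open ball.\<close>

lemma piece_in_ball:
  assumes "i < nsimp (T k)"
  shows "piece K k i \<subseteq> ball 0 (2 * rad + 1)"
proof
  fix y assume "y \<in> piece K k i"
  then obtain x where x: "x \<in> cell (T k) i" "y = cell_map (T k) (tilted k) i x" by (auto simp: piece_def)
  have "y - tilt k *\<^sub>R x \<in> closure \<Lambda>"
    unfolding x(2) using x(1) \<eta>_closure[OF assms]
    by (intro tilted_cell_map_in_convex[OF assms] convex_closure convex_target) auto
  then have "norm (y - tilt k *\<^sub>R x) \<le> rad" by (rule rad(3))
  moreover have "norm (tilt k *\<^sub>R x) \<le> 1 * rad"
  proof -
    have "inverse (real (Suc k)) \<le> 1" by (simp add: inverse_le_1_iff)
    then have "tilt k \<le> 1" using tilt_properties(2)[of k] by linarith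
    then have "\<bar>tilt k\<bar> * norm x \<le> 1 * rad"
      using x cell_closure[OF assms] rad(2) tilt_properties(1)[of k] by (intro mult_mono) auto
    then show ?thesis by simp
  qed
  ultimately have "norm y \<le> rad + rad"
    using norm_triangle_ineq[of "y - tilt k *\<^sub>R x" "tilt k *\<^sub>R x"] by simp
  then show "y \<in> ball 0 (2 * rad + 1)" by simp
qed

text \<open>Change of variables on each good cell: \<open>f\<close>-mass to volume with error
  \<open>\<omega>\<close>, \<open>f\<close> to \<open>g\<close> times the Jacobian by the defect
  bound, Jacobian times volume to the volume of the image, and back to \<open>g\<close>-mass with
  error \<open>\<omega>\<close>. Null overlaps among the cells and among their images allow the
  summation.\<close>

lemma good_cells_mass:
  assumes K: "compact K" "convex K" "K \<subseteq> \<Omega>" and cover: "K \<subseteq> (\<Union>i<nsimp (T k). cell (T k) i)"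
    and Good: "Good \<subseteq> {..<nsimp (T k)}"
    and \<omega>: "\<omega> \<ge> 0" and C: "\<And>y. y \<in> closure \<Lambda> \<Longrightarrow> g y \<le> C"
    and fi: "\<And>i x. i \<in> Good \<Longrightarrow> x \<in> cell (T k) i \<inter> K \<Longrightarrow> f x \<le> f (vertex_mean (T k) (pt (T k)) i) + \<omega>"
    and gi: "\<And>i y. i \<in> Good \<Longrightarrow> y \<in> piece K k i \<Longrightarrow> g (vertex_mean (T k) (\<eta> k) i) \<le> ext_g y + \<omega>"
  shows "(\<Sum>i\<in>Good. measure \<mu> (cell (T k) i \<inter> K)) \<le> measure \<nu>' (\<Union>i\<in>Good. piece K k i)
    + \<omega> * measure lebesgue (ball (0::real^'n) (2 * rad + 1)) + \<omega> * measure lebesgue K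
    + C * inverse (real (Suc k)) * measure lebesgue K + C * (\<Sum>i<nsimp (T k). volume (T k) i * defect k i)"
proof -
  have fin: "finite Good" using Good finite_subset by blast
  have ltG: "i < nsimp (T k)" if "i \<in> Good" for i using Good that by blast
  let ?P = "\<lambda>i. cell (T k) i \<inter> K" and ?Q = "piece K k"
  have cP: "compact (?P i)" for i by (intro compact_Int compact_cell K)
  have cQ: "compact (?Q i)" for i by (rule compact_piece[OF K(1)])
  have Pm: "?P i \<in> lmeasurable" for i by (rule lmeasurable_compact[OF cP])
  have Qm: "?Q i \<in> lmeasurable" for i by (rule lmeasurable_compact[OF cQ])
  have Km: "K \<in> lmeasurable" by (rule lmeasurable_compact[OF K(1)])
  have overlap: "negligible (?Q i \<inter> ?Q l)" if "i \<in> Good" "l \<in> Good" "i \<noteq> l" for i l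
    unfolding piece_def using that ltG
    by (intro cell_image_overlap_negligible[OF AT K(2) cover] tilted_pos_def) auto
  have sumP: "(\<Sum>i\<in>Good. measure lebesgue (?P i)) \<le> measure lebesgue K"
  proof -
    have "(\<Sum>i\<in>Good. measure lebesgue (?P i)) = measure lebesgue (\<Union>(?P ` Good))"
    proof (rule measure_negligible_finite_Union_image[symmetric, OF fin Pm])
      show "pairwise (\<lambda>i l. negligible (?P i \<inter> ?P l)) Good"
        by (intro pairwiseI negligible_subset[OF negligible_cell_overlap[OF AT]]) (use ltG in auto)
    qed
    also have "\<dots> \<le> measure lebesgue K"
    proof (rule measure_mono_fmeasurable[OF _ _ Km])
      show "\<Union>(?P ` Good) \<in> sets lebesgue" by (intro sets.finite_UN fin fmeasurableD Pm)
    qed auto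
    finally show ?thesis .
  qed
  have sumQ: "(\<Sum>i\<in>Good. measure lebesgue (?Q i)) \<le> measure lebesgue (ball (0::real^'n) (2 * rad + 1))"
  proof -
    have "(\<Sum>i\<in>Good. measure lebesgue (?Q i)) = measure lebesgue (\<Union>(?Q ` Good))"
      by (rule measure_negligible_finite_Union_image[symmetric, OF fin Qm]) (use overlap in \<open>auto intro: pairwiseI\<close>)
    also have "\<dots> \<le> measure lebesgue (ball (0::real^'n) (2 * rad + 1))"
      by (rule measure_mono_fmeasurable) (use piece_in_ball ltG in \<open>auto intro!: fin Qm fmeasurableD\<close>)
    finally show ?thesis .
  qed
  have sum\<nu>: "(\<Sum>i\<in>Good. measure \<nu>' (?Q i)) = measure \<nu>' (\<Union>i\<in>Good. ?Q i)"
  proof (rule measure_UNION_AE[symmetric, OF fin])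
    show "?Q i \<in> fmeasurable \<nu>'" for i
      using cQ[of i] by (simp add: ext.fmeasurable_eq_sets borel_compact)
    show "pairwise (\<lambda>i l. AE y in \<nu>'. y \<notin> ?Q i \<or> y \<notin> ?Q l) Good"
    proof (rule pairwiseI)
      fix i l assume il: "i \<in> Good" "l \<in> Good" "i \<noteq> l"
      have "?Q i \<inter> ?Q l \<in> sets lborel" using cQ by (simp add: borel_compact sets.Int)
      then have "?Q i \<inter> ?Q l \<in> null_sets lborel"
        using overlap[OF il] by (simp add: negligible_iff_null_sets null_sets_completion_iff)
      then have "AE y in lborel. y \<notin> ?Q i \<inter> ?Q l" by (rule AE_not_in)
      then show "AE y in \<nu>'. y \<notin> ?Q i \<or> y \<notin> ?Q l"
        by (intro ext.AE_M_lborel) (auto elim: eventually_mono)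
    qed
  qed
  have C0: "C \<ge> 0" using C tgt.h_pos target_nonempty closure_subset by (meson ex_in_conv less_imp_le order_trans subsetD)
  have term_bound: "measure \<mu> (?P i) \<le> measure \<nu>' (?Q i) + \<omega> * measure lebesgue (?Q i) + \<omega> * measure lebesgue (?P i)
      + C * inverse (real (Suc k)) * measure lebesgue (?P i) + C * (volume (T k) i * defect k i)" if i: "i \<in> Good" for i
  proof -
    let ?f = "f (vertex_mean (T k) (pt (T k)) i)" and ?g = "g (vertex_mean (T k) (\<eta> k) i)"
    let ?J = "\<bar>det (cell_jacobian (T k) (tilted k) i)\<bar>" and ?e = "inverse (real (Suc k))"
    have mean: "vertex_mean (T k) (\<eta> k) i \<in> closure \<Lambda>"
      using \<eta>_closure[OF ltG[OF i]] by (intro vertex_mean_in_convex convex_closure convex_target) auto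
    have meanf: "vertex_mean (T k) (pt (T k)) i \<in> closure \<Omega>"
      using vertex_mean_in_convex[of "cell (T k) i" "pt (T k)" "T k" i] vertex_in_cell cell_closure[OF ltG[OF i]]
      by (auto simp: cell_def)
    have g0: "?g \<ge> 0" "?g \<le> C" using tgt.h_pos[OF mean] C[OF mean] by auto
    \<comment> \<open>The cost controls only the symmetric part; its determinant bounds the full
      Jacobian from below, with the loss \<open>?e\<close> caused by the tilt.\<close>
    have "\<bar>det (hess (T k) (\<eta> k) i)\<bar> \<le> ?J + ?e"
      using tilt_properties(3)[OF ltG[OF i]] abs_det_hess_le[OF tilted_pos_def[OF ltG[OF i]]] by linarith
    then have "?f \<le> ?g * (?J + ?e + defect k i)"
      using defect_bound[OF ltG[OF i]] g0(1) by (meson add_right_mono mult_left_mono order_trans)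
    also have "\<dots> = ?g * ?J + ?g * (?e + defect k i)" by (simp add: algebra_simps)
    also have "\<dots> \<le> ?g * ?J + C * (?e + defect k i)"
      using g0 defect_nonneg[OF ltG[OF i]] by (intro add_left_mono mult_right_mono) auto
    finally have f: "?f \<le> ?g * ?J + C * ?e + C * defect k i" by (simp add: algebra_simps)
    have "measure \<mu> (?P i) \<le> (?f + \<omega>) * measure lebesgue (?P i)"
      using cP K(3) fi[OF i] \<omega> src.h_pos[OF meanf] by (intro src.measure_M_le) (auto simp: borel_compact)
    also have "\<dots> \<le> (?g * ?J + C * ?e + C * defect k i + \<omega>) * measure lebesgue (?P i)"
      using f by (intro mult_right_mono) auto
    also have "\<dots> = ?g * (?J * measure lebesgue (?P i)) + C * ?e * measure lebesgue (?P i)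
        + C * (defect k i * measure lebesgue (?P i)) + \<omega> * measure lebesgue (?P i)" by (simp add: algebra_simps)
    also have "?J * measure lebesgue (?P i) = measure lebesgue (?Q i)"
      unfolding piece_def measure_cell_map_image(2)[OF Pm] ..
    also have "?g * measure lebesgue (?Q i) \<le> measure \<nu>' (?Q i) + \<omega> * measure lebesgue (?Q i)"
    proof -
      have "(?g - \<omega>) * measure lebesgue (?Q i) \<le> measure \<nu>' (?Q i)"
        using cQ piece_in_ball[OF ltG[OF i]] gi[OF i] by (intro ext.measure_M_ge) (auto simp: borel_compact algebra_simps)
      then show ?thesis by (simp add: algebra_simps)
    qed
    also have "C * (defect k i * measure lebesgue (?P i)) \<le> C * (volume (T k) i * defect k i)"
    proof -
      have "measure lebesgue (?P i) \<le> volume (T k) i"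
        unfolding volume_def
        by (rule measure_mono_fmeasurable) (auto intro: lmeasurable_compact compact_cell fmeasurableD Pm)
      then show ?thesis
        using C0 defect_nonneg[OF ltG[OF i]] by (simp add: mult.commute mult_left_mono)
    qed
    finally show ?thesis by linarith
  qed
  have "(\<Sum>i\<in>Good. measure \<mu> (?P i)) \<le> (\<Sum>i\<in>Good. measure \<nu>' (?Q i) + \<omega> * measure lebesgue (?Q i) + \<omega> * measure lebesgue (?P i)
      + C * inverse (real (Suc k)) * measure lebesgue (?P i) + C * (volume (T k) i * defect k i))"
    by (rule sum_mono) (rule term_bound)
  also have "\<dots> = measure \<nu>' (\<Union>i\<in>Good. ?Q i) + \<omega> * (\<Sum>i\<in>Good. measure lebesgue (?Q i)) + \<omega> * (\<Sum>i\<in>Good. measure lebesgue (?P i))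
      + C * inverse (real (Suc k)) * (\<Sum>i\<in>Good. measure lebesgue (?P i)) + C * (\<Sum>i\<in>Good. volume (T k) i * defect k i)"
    by (simp add: sum.distrib sum_distrib_left sum\<nu> del: of_nat_Suc)
  also have "\<dots> \<le> measure \<nu>' (\<Union>i\<in>Good. ?Q i) + \<omega> * measure lebesgue (ball (0::real^'n) (2 * rad + 1)) + \<omega> * measure lebesgue K
      + C * inverse (real (Suc k)) * measure lebesgue K + C * (\<Sum>i<nsimp (T k). volume (T k) i * defect k i)"
  proof (intro add_mono mult_left_mono sumP sumQ \<omega> C0 order_refl)
    show "(\<Sum>i\<in>Good. volume (T k) i * defect k i) \<le> (\<Sum>i<nsimp (T k). volume (T k) i * defect k i)"
      by (rule sum_mono2) (use Good defect_nonneg in \<open>auto simp: volume_def\<close>)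
  qed (use C0 in auto)
  finally show ?thesis .
qed

end

section \<open>Passage to the limit\<close>

context vanishing_defect_limit
begin

abbreviation "\<phi>' \<equiv> conjugate_on (closure \<Omega>) \<phi>"

lemmas limit_conjugate = src.compact_closure_S closure_source_nonempty continuous_convex_UNIV[OF limit_convex]

text \<open>The indicators of the bad parts tend to 0 almost everywhere; since \<open>\<mu>\<close>
  is finite, dominated convergence with the constant 1 turns this pointwise statement into vanishing
  mass.\<close>

lemma bad_cells_vanish:
  assumes K: "compact K" "K \<subseteq> \<Omega>" and \<delta>: "\<delta> > 0"
  defines "Bad k \<equiv> (\<Union>i\<in>{i. i < nsimp (T k) \<and> \<not> (\<forall>j l. norm (\<eta> k (vert (T k) i j) - \<eta> k (vert (T k) i l)) \<le> \<delta>)}. cell (T k) i)"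
  shows "(\<lambda>k. measure \<mu> (K \<inter> Bad k)) \<longlonglongrightarrow> 0"
proof -
  have "closed (Bad k)" for k
    unfolding Bad_def by (intro closed_UN) (auto intro: compact_imp_closed compact_cell)
  then have meas: "K \<inter> Bad k \<in> sets borel" for k
    using compact_imp_closed[OF K(1)] by (intro borel_closed closed_Int)
  have ae: "AE x in \<mu>. (\<lambda>k. indicat_real (K \<inter> Bad k) x) \<longlonglongrightarrow> 0"
    using src.AE_M_lborel[OF AE_potential_smooth[OF limit_potential]]
  proof eventually_elim
    case (elim x)
    show ?case
    proof (cases "x \<in> K")
      case True
      then have "x \<in> \<Omega>" using K(2) by blast
      from gradient_oscillation_vanishes[OF this elim \<delta>]
      have "\<forall>\<^sub>F k in sequentially. indicat_real (K \<inter> Bad k) x = 0"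
        by eventually_elim (auto simp: Bad_def indicator_def)
      then show ?thesis by (rule tendsto_eventually)
    qed simp
  qed
  have "(\<lambda>k. \<integral>x. indicat_real (K \<inter> Bad k) x \<partial>\<mu>) \<longlonglongrightarrow> (\<integral>x. 0 \<partial>\<mu>)"
  proof (rule integral_dominated_convergence[where w = "\<lambda>_. 1"])
    show "(\<lambda>x. indicat_real (K \<inter> Bad k) x) \<in> borel_measurable \<mu>" for k
      using meas[of k] by (intro borel_measurable_indicator) simp
  qed (use ae in \<open>auto simp: indicator_def\<close>)
  then show ?thesis using meas by simp
qed

text \<open>The summand 3 collects three errors that are eventually below \<open>\<omega>\<close>:
  the mass of the bad cells, the loss from tilting, and the total defect.\<close>

lemma mass_le_pieces:
  assumes K: "compact K" "convex K" "K \<subseteq> \<Omega>" and \<omega>: "\<omega> > 0"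
  shows "\<forall>\<^sub>F k in sequentially. measure \<mu> K \<le> measure \<nu>' (\<Union>i<nsimp (T k). piece K k i)
    + \<omega> * (measure lebesgue (ball (0::real^'n) (2 * rad + 1)) + measure lebesgue K + 3)"
proof -
  obtain C where C: "\<And>y. y \<in> closure \<Lambda> \<Longrightarrow> g y \<le> C" using tgt.bounds_h by blast
  obtain \<delta> where \<delta>: "\<delta> > 0" "\<And>y m. m \<in> closure \<Lambda> \<Longrightarrow> norm (y - m) < \<delta> \<Longrightarrow> g m \<le> ext_g y + \<omega>"
    using ext_g_near[OF \<omega>] by metis
  have "uniformly_continuous_on (closure \<Omega>) f"
    by (rule compact_uniformly_continuous[OF src.cont_h src.compact_closure_S])
  then obtain \<delta>f where \<delta>f: "\<delta>f > 0"
    "\<And>x y. x \<in> closure \<Omega> \<Longrightarrow> y \<in> closure \<Omega> \<Longrightarrow> dist x y < \<delta>f \<Longrightarrow> dist (f x) (f y) < \<omega>"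
    using \<omega> unfolding uniformly_continuous_on_def by metis
  \<comment> \<open>With \<open>\<delta> / 4\<close>, an image point freed from the tilt and the
    mean of the gradients lie in one ball of that radius, hence at distance at most
    \<open>\<delta> / 2\<close>; the tilt uses less than the other half.\<close>
  let ?osc = "\<lambda>k i. \<forall>j l. norm (\<eta> k (vert (T k) i j) - \<eta> k (vert (T k) i l)) \<le> \<delta> / 4"
  let ?Bad = "\<lambda>k. (\<Union>i\<in>{i. i < nsimp (T k) \<and> \<not> ?osc k i}. cell (T k) i)"
  have "(\<lambda>k. C * inverse (real (Suc k)) * measure lebesgue K) \<longlonglongrightarrow> C * 0 * measure lebesgue K"
    by (intro tendsto_intros LIMSEQ_inverse_real_of_nat)
  then have e5: "\<forall>\<^sub>F k in sequentially. C * inverse (real (Suc k)) * measure lebesgue K < \<omega>"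
    by (rule order_tendstoD) (use \<omega> in simp)
  have "(\<lambda>k. C * (\<Sum>i<nsimp (T k). volume (T k) i * defect k i)) \<longlonglongrightarrow> C * 0"
    by (intro tendsto_intros defect_vanishes)
  then have e6: "\<forall>\<^sub>F k in sequentially. C * (\<Sum>i<nsimp (T k). volume (T k) i * defect k i) < \<omega>"
    by (rule order_tendstoD) (use \<omega> in simp)
  have e4: "\<forall>\<^sub>F k in sequentially. tilt k * rad < \<delta> / 2"
    by (rule order_tendstoD(2)[OF tilt_tendsto]) (use \<delta>(1) in simp)
  have e3: "\<forall>\<^sub>F k in sequentially. measure \<mu> (K \<inter> ?Bad k) < \<omega>"
    by (rule order_tendstoD(2)[OF bad_cells_vanish[OF K(1,3)]]) (use \<delta>(1) \<omega> in simp_all)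
  from compact_eventually_covered[OF K(1,3)] mesh_eventually_small[OF \<delta>f(1)] e3 e4 e5 e6
  show ?thesis
  proof eventually_elim
    case (elim k)
    let ?Good = "{i. i < nsimp (T k) \<and> ?osc k i}"
    let ?P = "\<lambda>i. cell (T k) i \<inter> K"
    have fin: "finite ?Good" by simp
    have bP: "?P i \<in> sets borel" for i by (intro borel_compact compact_Int compact_cell K)
    have "closed (?Bad k)" by (intro closed_UN) (auto intro: compact_imp_closed compact_cell)
    then have bB: "K \<inter> ?Bad k \<in> sets borel"
      using compact_imp_closed[OF K(1)] by (intro borel_closed closed_Int)
    have bU: "(\<Union>i\<in>?Good. ?P i) \<in> sets borel" using bP by (intro sets.finite_UN) auto
    have "K \<subseteq> (\<Union>i\<in>?Good. ?P i) \<union> (K \<inter> ?Bad k)"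
    proof
      fix x assume x: "x \<in> K"
      then obtain i where "i < nsimp (T k)" "x \<in> cell (T k) i" using elim(1) by auto
      with x show "x \<in> (\<Union>i\<in>?Good. ?P i) \<union> (K \<inter> ?Bad k)" by (cases "?osc k i") blast+
    qed
    then have "measure \<mu> K \<le> measure \<mu> ((\<Union>i\<in>?Good. ?P i) \<union> (K \<inter> ?Bad k))"
      using bU bB by (intro src.finite_measure_mono) auto
    also have "\<dots> \<le> measure \<mu> (\<Union>i\<in>?Good. ?P i) + measure \<mu> (K \<inter> ?Bad k)"
      using bU bB by (intro measure_Un_le) auto
    also have "measure \<mu> (\<Union>i\<in>?Good. ?P i) \<le> (\<Sum>i\<in>?Good. measure \<mu> (?P i))"
      using bP by (intro measure_UNION_le fin) auto
    also have "\<dots> \<le> measure \<nu>' (\<Union>i\<in>?Good. piece K k i)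
      + \<omega> * measure lebesgue (ball (0::real^'n) (2 * rad + 1)) + \<omega> * measure lebesgue K
      + C * inverse (real (Suc k)) * measure lebesgue K + C * (\<Sum>i<nsimp (T k). volume (T k) i * defect k i)"
    proof (rule good_cells_mass[OF K elim(1) _ _ C])
      fix i x assume i: "i \<in> ?Good" and x: "x \<in> cell (T k) i \<inter> K"
      have m: "vertex_mean (T k) (pt (T k)) i \<in> cell (T k) i"
        using vertex_in_cell by (intro vertex_mean_in_convex) (auto simp: cell_def)
      then have "dist x (vertex_mean (T k) (pt (T k)) i) < \<delta>f"
        unfolding dist_norm using elim(2) i x by blast
      then have "dist (f x) (f (vertex_mean (T k) (pt (T k)) i)) < \<omega>"
        using i x m cell_closure[of i k] by (intro \<delta>f(2)) auto
      then show "f x \<le> f (vertex_mean (T k) (pt (T k)) i) + \<omega>" by (simp add: dist_real_def abs_less_iff)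
    next
      fix i y assume i: "i \<in> ?Good" and y: "y \<in> piece K k i"
      then have il: "i < nsimp (T k)" by simp
      obtain x where x: "x \<in> cell (T k) i" "x \<in> K" "y = cell_map (T k) (tilted k) i x"
        using y by (auto simp: piece_def)
      let ?C = "cball (\<eta> k (vert (T k) i None)) (\<delta> / 4)" and ?m = "vertex_mean (T k) (\<eta> k) i"
      have C: "\<eta> k (vert (T k) i j) \<in> ?C" for j using i by (simp add: dist_norm)
      have "y - tilt k *\<^sub>R x \<in> ?C"
        unfolding x(3) using x(1) C by (intro tilted_cell_map_in_convex[OF il] convex_cball) auto
      moreover have "?m \<in> ?C" using C by (intro vertex_mean_in_convex convex_cball) auto
      ultimately have "dist (y - tilt k *\<^sub>R x) ?m \<le> \<delta> / 4 + \<delta> / 4"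
        unfolding mem_cball
        using dist_triangle3[of "y - tilt k *\<^sub>R x" ?m "\<eta> k (vert (T k) i None)"] by linarith
      moreover have "norm (tilt k *\<^sub>R x) \<le> tilt k * rad"
        using x(2) K(3) closure_subset rad(2) tilt_properties(1)[of k] by (auto intro!: mult_left_mono)
      moreover have "norm (y - ?m) \<le> norm (y - tilt k *\<^sub>R x - ?m) + norm (tilt k *\<^sub>R x)"
        using norm_triangle_ineq[of "y - tilt k *\<^sub>R x - ?m" "tilt k *\<^sub>R x"] by simp
      ultimately have "norm (y - ?m) < \<delta>" using elim(4) by (simp add: dist_norm)
      moreover have "?m \<in> closure \<Lambda>"
        using \<eta>_closure[OF il] by (intro vertex_mean_in_convex convex_closure convex_target) auto
      ultimately show "g ?m \<le> ext_g y + \<omega>" using \<delta>(2) by blast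
    qed (use \<omega> in auto)
    also have "measure \<nu>' (\<Union>i\<in>?Good. piece K k i) \<le> measure \<nu>' (\<Union>i<nsimp (T k). piece K k i)"
    proof (rule ext.finite_measure_mono)
      show "(\<Union>i<nsimp (T k). piece K k i) \<in> sets \<nu>'"
        using compact_piece[OF K(1)] by (intro sets.finite_UN) (auto simp: borel_compact)
    qed auto
    finally show ?case using elim(3,5,6) by (simp add: algebra_simps del: of_nat_Suc)
  qed
qed

text \<open>The subgradient relation is put as near equality in Fenchel--Young with some
  \<open>x\<close> in \<open>K\<close>: for fixed \<open>y\<close> this survives letting
  \<open>\<tau>\<close> tend to 0 although \<open>x\<close> varies.\<close>

lemma pieces_approx_subgradients:
  assumes \<tau>: "\<tau> > 0" and K: "K \<subseteq> \<Omega>"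
  shows "\<forall>\<^sub>F k in sequentially. \<forall>i<nsimp (T k). \<forall>y\<in>piece K k i.
    (\<exists>y0\<in>closure \<Lambda>. dist y0 y < \<tau>) \<and> (\<exists>x\<in>K. \<phi>' y \<le> x \<bullet> y - \<phi> x + \<tau>)"
proof -
  have e1: "\<forall>\<^sub>F k in sequentially. tilt k * rad < \<tau>"
    by (rule order_tendstoD(2)[OF tilt_tendsto]) (use \<tau> in simp)
  have e2: "\<forall>\<^sub>F k in sequentially. tilt k * (2 * rad * rad) < \<tau> / 2"
    by (rule order_tendstoD(2)[OF tilt_tendsto]) (use \<tau> in simp)
  have "\<tau> / 2 > 0" using \<tau> by simp
  from discrete_gradients_approx_subgradients[OF this] e1 e2 show ?thesis
  proof eventually_elim
    case (elim k)
    show ?case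
    proof (intro allI impI ballI)
      fix i y assume i: "i < nsimp (T k)" and "y \<in> piece K k i"
      then obtain x where x: "x \<in> cell (T k) i" "x \<in> K" "y = cell_map (T k) (tilted k) i x"
        by (auto simp: piece_def)
      have xr: "norm x \<le> rad" using x(2) K closure_subset rad(2) by blast
      define y0 where "y0 = y - tilt k *\<^sub>R x"
      have t0: "tilt k > 0" by (rule tilt_properties)
      have "y0 \<in> closure \<Lambda>"
        unfolding y0_def x(3) using x(1) \<eta>_closure[OF i]
        by (intro tilted_cell_map_in_convex[OF i] convex_closure convex_target) auto
      moreover have "dist y0 y < \<tau>"
      proof -
        have "dist y0 y = tilt k * norm x" using t0 by (simp add: y0_def dist_norm)
        also have "\<dots> \<le> tilt k * rad" using t0 xr by (intro mult_left_mono) auto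
        finally show ?thesis using elim(2) by simp
      qed
      moreover have "\<phi>' y \<le> x \<bullet> y - \<phi> x + \<tau>"
      proof -
        \<comment> \<open>The slopes of approximate supporting planes at \<open>x\<close>: an
          intersection of half-spaces, so it contains the convex combination \<open>y0\<close> along
          with the vertex gradients.\<close>
        let ?C = "\<Inter>w\<in>closure \<Omega>. {q. (w - x) \<bullet> q \<le> \<phi> w - \<phi> x + \<tau> / 2}"
        have "y0 \<in> ?C"
          unfolding y0_def x(3)
        proof (rule tilted_cell_map_in_convex[OF i x(1)])
          show "convex ?C" by (intro convex_INT convex_halfspace_le)
          show "\<eta> k (vert (T k) i j) \<in> ?C" for j
          proof (intro INT_I CollectI)
            fix w assume "w \<in> closure \<Omega>"
            then have "\<phi> w \<ge> \<phi> x + \<eta> k (vert (T k) i j) \<bullet> (w - x) - \<tau> / 2"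
              using elim(1) i x(1) by blast
            then show "(w - x) \<bullet> \<eta> k (vert (T k) i j) \<le> \<phi> w - \<phi> x + \<tau> / 2"
              by (simp add: inner_commute)
          qed
        qed
        then have y0: "(w - x) \<bullet> y0 \<le> \<phi> w - \<phi> x + \<tau> / 2" if "w \<in> closure \<Omega>" for w using that by blast
        obtain w where w: "w \<in> closure \<Omega>" "\<phi>' y = w \<bullet> y - \<phi> w"
          using conjugate_on_attained[OF limit_conjugate] .
        have "(w - x) \<bullet> (tilt k *\<^sub>R x) \<le> tilt k * (2 * rad * rad)"
        proof -
          have "norm (w - x) \<le> 2 * rad" using norm_triangle_ineq4[of w x] rad(2)[OF w(1)] xr by simp
          then have "(w - x) \<bullet> x \<le> 2 * rad * rad"
            using xr rad(1) by (intro order_trans[OF norm_cauchy_schwarz mult_mono]) auto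
          then show ?thesis using t0 by (simp add: mult_left_mono)
        qed
        then have "(w - x) \<bullet> y \<le> \<phi> w - \<phi> x + \<tau>"
          using y0[OF w(1)] elim(3) by (simp add: y0_def inner_diff_right)
        then show ?thesis using w(2) by (simp add: inner_diff_left)
      qed
      ultimately show "(\<exists>y0\<in>closure \<Lambda>. dist y0 y < \<tau>) \<and> (\<exists>x\<in>K. \<phi>' y \<le> x \<bullet> y - \<phi> x + \<tau>)"
        using x(2) by blast
    qed
  qed
qed

lemma frontier_target_null: "AE y in lborel. y \<notin> closure \<Lambda> - \<Lambda>"
proof -
  have "negligible (frontier \<Lambda>)" by (rule negligible_convex_frontier[OF convex_target])
  then have "frontier \<Lambda> \<in> null_sets lborel"
    by (simp add: negligible_iff_null_sets null_sets_completion_iff)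
  then have "AE y in lborel. y \<notin> frontier \<Lambda>" by (rule AE_not_in)
  then show ?thesis
    by eventually_elim (simp add: frontier_def interior_open[OF tgt.open_S])
qed

text \<open>Continuity from above for the tails \<open>A m\<close> bounds the mass of
  \<open>K\<close> by that of the upper limit of the images. A point \<open>y\<close> of this upper
  limit lies in images for arbitrarily large \<open>k\<close>, so every approximate statement about
  it becomes exact.\<close>

lemma mass_le_conjugate_preimage:
  assumes K: "compact K" "convex K" "K \<subseteq> \<Omega>"
  shows "measure \<mu> K \<le> measure \<nu> (gradient \<phi>' -` K)"
proof (cases "K = {}")
  case False
  define E where "E k = (\<Union>i<nsimp (T k). piece K k i)" for k
  define A where "A m = (\<Union>k\<in>{m..}. E k)" for m
  have mE: "E k \<in> sets borel" for k
    unfolding E_def using compact_piece[OF K(1)] by (intro sets.finite_UN) (auto simp: borel_compact)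
  then have mA: "A m \<in> sets borel" for m unfolding A_def by (intro sets.countable_UN'') auto
  have dec: "decseq A"
    unfolding decseq_def A_def by (intro allI impI UN_mono) auto
  have "measure \<mu> K \<le> measure \<nu>' (\<Inter>m. A m)"
  proof (rule field_le_epsilon)
    fix e :: real assume e: "e > 0"
    define c where "c = measure lebesgue (ball (0::real^'n) (2 * rad + 1)) + measure lebesgue K + 3"
    have c: "c > 0" by (simp add: c_def add_nonneg_pos)
    have "e / c > 0" using e c by simp
    from mass_le_pieces[OF K this]
    have ev: "\<forall>\<^sub>F k in sequentially. measure \<mu> K \<le> measure \<nu>' (E k) + e"
      unfolding c_def[symmetric] E_def[symmetric] using c by simp
    have "measure \<mu> K \<le> measure \<nu>' (A m) + e" for m
    proof -
      have "\<forall>\<^sub>F k in sequentially. measure \<mu> K \<le> measure \<nu>' (E k) + e \<and> k \<ge> m"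
        using ev eventually_ge_at_top by (rule eventually_conj)
      then obtain k where k: "measure \<mu> K \<le> measure \<nu>' (E k) + e" "k \<ge> m"
        using eventually_happens'[OF trivial_limit_sequentially] by blast
      have "measure \<nu>' (E k) \<le> measure \<nu>' (A m)"
        using mA k(2) by (intro ext.finite_measure_mono) (auto simp: A_def)
      with k(1) show ?thesis by simp
    qed
    moreover have "(\<lambda>m. measure \<nu>' (A m) + e) \<longlonglongrightarrow> measure \<nu>' (\<Inter>m. A m) + e"
      using mA dec by (intro tendsto_intros ext.finite_Lim_measure_decseq) auto
    ultimately show "measure \<mu> K \<le> measure \<nu>' (\<Inter>m. A m) + e"
      by (intro LIMSEQ_le_const) auto
  qed
  also have "\<dots> \<le> measure \<nu> (gradient \<phi>' -` K)"
  proof -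
    have close: "(\<exists>y0\<in>closure \<Lambda>. dist y0 y < \<tau>) \<and> (\<exists>x\<in>K. \<phi>' y \<le> x \<bullet> y - \<phi> x + \<tau>)"
      if y: "y \<in> (\<Inter>m. A m)" and \<tau>: "\<tau> > 0" for y \<tau>
    proof -
      obtain m where m: "\<And>k. k \<ge> m \<Longrightarrow> \<forall>i<nsimp (T k). \<forall>y\<in>piece K k i.
          (\<exists>y0\<in>closure \<Lambda>. dist y0 y < \<tau>) \<and> (\<exists>x\<in>K. \<phi>' y \<le> x \<bullet> y - \<phi> x + \<tau>)"
        using pieces_approx_subgradients[OF \<tau> K(3)] unfolding eventually_sequentially by blast
      have "y \<in> A m" using y by blast
      then obtain k where "k \<ge> m" "y \<in> E k" by (auto simp: A_def)
      then show ?thesis using m unfolding E_def by blast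
    qed
    \<comment> \<open>Maximising over the compact \<open>K\<close> once replaces extracting a limit
      of the points that belong to different \<open>\<tau>\<close>.\<close>
    have attained: "\<exists>x\<in>K. \<phi>' y = x \<bullet> y - \<phi> x" if y: "y \<in> (\<Inter>m. A m)" for y
    proof -
      have "continuous_on K (\<lambda>x. x \<bullet> y - \<phi> x)"
        by (intro continuous_intros continuous_convex_UNIV[OF limit_convex])
      then obtain x where x: "x \<in> K" "\<And>z. z \<in> K \<Longrightarrow> z \<bullet> y - \<phi> z \<le> x \<bullet> y - \<phi> x"
        using continuous_attains_sup[OF K(1) False] by blast
      have "\<phi>' y \<le> x \<bullet> y - \<phi> x"
      proof (rule field_le_epsilon)
        fix \<tau> :: real assume "\<tau> > 0"
        with close[OF y] obtain z where "z \<in> K" "\<phi>' y \<le> z \<bullet> y - \<phi> z + \<tau>" by blast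
        with x(2)[of z] show "\<phi>' y \<le> x \<bullet> y - \<phi> x + \<tau>" by linarith
      qed
      moreover have "x \<bullet> y - \<phi> x \<le> \<phi>' y"
        using x(1) K(3) closure_subset by (intro conjugate_on_ge[OF limit_conjugate]) blast
      ultimately show ?thesis using x(1) by auto
    qed
    \<comment> \<open>Two null sets are dropped: the frontier of the convex
      \<open>\<Lambda>\<close>, where limit points may end up, and the points where
      \<open>\<phi>'\<close> is not differentiable.\<close>
    have ae: "AE y in lborel. y \<in> (\<Inter>m. A m) \<longrightarrow> y \<in> \<Lambda> \<and> gradient \<phi>' y \<in> K"
      using frontier_target_null AE_smooth_points_conjugate_on[OF limit_conjugate]
    proof eventually_elim
      case (elim y)
      show ?case
      proof
        assume y: "y \<in> (\<Inter>m. A m)"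
        have "\<forall>e>0. \<exists>y0\<in>closure \<Lambda>. dist y0 y < e" using close[OF y] by blast
        then have "y \<in> closure (closure \<Lambda>)" by (subst closure_approachable)
        then have "y \<in> closure \<Lambda>" by simp
        with elim have "y \<in> \<Lambda>" by blast
        moreover obtain x where x: "x \<in> K" "\<phi>' y = x \<bullet> y - \<phi> x" using attained[OF y] by blast
        then have "x \<in> closure \<Omega>" using K(3) closure_subset by blast
        then have "x \<in> subdifferential \<phi>' y"
          by (intro conjugate_on_subgradient[OF limit_conjugate] x(2))
        then have "gradient \<phi>' y = x"
          by (intro subgradient_is_gradient(2)[OF convex_conjugate_on[OF limit_conjugate] elim(2)])
        ultimately show "y \<in> \<Lambda> \<and> gradient \<phi>' y \<in> K" using x(1) by simp
      qed
    qed
    have mI: "(\<Inter>m. A m) \<in> sets borel" using mA by (intro sets.countable_INT'') auto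
    have mg: "gradient \<phi>' -` K \<in> sets borel"
      using measurable_sets[OF borel_measurable_gradient[OF convex_conjugate_on[OF limit_conjugate]], of K] K(1)
      by (simp add: borel_compact)
    have sub: "(\<Inter>m. A m) \<subseteq> ball 0 (2 * rad + 1)"
      using piece_in_ball by (fastforce simp: A_def E_def)
    have "emeasure \<nu>' (\<Inter>m. A m) = (\<integral>\<^sup>+y. ennreal (ext_g y) * indicator (\<Inter>m. A m) y \<partial>lborel)"
      by (rule ext.emeasure_M_subset[OF mI sub])
    also have "\<dots> \<le> (\<integral>\<^sup>+y. ennreal (g y) * indicator \<Lambda> y * indicator (gradient \<phi>' -` K) y \<partial>lborel)"
      using ae
    proof (intro nn_integral_mono_AE, eventually_elim)
      case (elim y)
      show ?case
      proof (cases "y \<in> (\<Inter>m. A m)")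
        case True
        with elim have "y \<in> \<Lambda>" "gradient \<phi>' y \<in> K" by auto
        moreover from this have "ext_g y = g y" using closure_subset by (intro ext_g_eq) blast
        ultimately show ?thesis using True by simp
      qed simp
    qed
    also have "\<dots> = emeasure \<nu> (gradient \<phi>' -` K)"
      unfolding density_on_def using mg by (intro emeasure_density[symmetric]) auto
    finally show ?thesis
      by (simp add: ext.emeasure_eq_measure tgt.emeasure_eq_measure)
  qed
  finally show ?thesis .
qed simp

end

context vanishing_defect_limit
begin

lemma limit_conjugate_gradient_borel [measurable]: "gradient \<phi>' \<in> borel_measurable borel"
  by (rule borel_measurable_gradient[OF convex_conjugate_on[OF limit_conjugate]])

text \<open>The estimate is known only for convex compact sets inside \<open>\<Omega>\<close>.
  Vitali exhausts \<open>U \<inter> \<Omega>\<close> up to a null set by countably many disjoint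
  closed balls; their preimages are disjoint too, so the inequalities add up.\<close>

lemma mass_le_conjugate_preimage_open:
  assumes U: "open U"
  shows "emeasure \<mu> U \<le> emeasure \<nu> (gradient \<phi>' -` U)"
proof -
  define K where "K = {(x, r). 0 < r \<and> cball x r \<subseteq> U \<inter> \<Omega>}"
  obtain C where C: "countable C" "C \<subseteq> K"
    "pairwise (\<lambda>i j. disjnt (cball (fst i) (snd i)) (cball (fst j) (snd j))) C"
    "negligible ((U \<inter> \<Omega>) - (\<Union>i \<in> C. cball (fst i) (snd i)))"
  proof (rule Vitali_covering_theorem_cballs[of K snd "U \<inter> \<Omega>" fst])
    show "0 < snd i" if "i \<in> K" for i using that by (auto simp: K_def)
    fix x and d :: real assume x: "x \<in> U \<inter> \<Omega>" "0 < d"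
    have "open (U \<inter> \<Omega>)" using U src.open_S by blast
    then obtain e where e: "e > 0" "cball x e \<subseteq> U \<inter> \<Omega>" using x(1) open_contains_cball by blast
    then have "(x, min e (d / 2)) \<in> K" using x(2) by (auto simp: K_def)
    then show "\<exists>i. i \<in> K \<and> x \<in> cball (fst i) (snd i) \<and> snd i < d"
      using e x(2) by (intro exI[of _ "(x, min e (d / 2))"]) auto
  qed blast
  let ?B = "\<lambda>i. cball (fst i) (snd i) :: (real^'n) set"
  have CU: "?B i \<subseteq> U" "?B i \<subseteq> \<Omega>" if "i \<in> C" for i
    using subsetD[OF C(2) that] by (auto simp: K_def case_prod_beta)
  have disj: "disjoint_family_on ?B C"
    using C(3) by (auto simp: disjoint_family_on_def pairwise_def disjnt_def)
  have BU: "(\<Union>i\<in>C. ?B i) \<in> sets borel" using C(1) by (intro sets.countable_UN'') auto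
  have "(U \<inter> \<Omega>) - (\<Union>i\<in>C. ?B i) \<in> sets lborel"
    using U src.open_S BU by auto
  then have "(U \<inter> \<Omega>) - (\<Union>i\<in>C. ?B i) \<in> null_sets lborel"
    using C(4) by (simp add: negligible_iff_null_sets null_sets_completion_iff)
  then have "AE x in lborel. x \<notin> (U \<inter> \<Omega>) - (\<Union>i\<in>C. ?B i)" by (rule AE_not_in)
  from src.AE_M_lborel[OF this] src.AE_M_in_S
  have "emeasure \<mu> U \<le> emeasure \<mu> (\<Union>i\<in>C. ?B i)"
    using BU U by (intro emeasure_mono_AE) (auto elim!: eventually_elim2)
  also have "\<dots> = (\<integral>\<^sup>+i. emeasure \<mu> (?B i) \<partial>count_space C)"
    using C(1) disj by (intro emeasure_UN_countable) auto
  also have "\<dots> \<le> (\<integral>\<^sup>+i. emeasure \<nu> (gradient \<phi>' -` ?B i) \<partial>count_space C)"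
  proof (intro nn_integral_mono)
    fix i assume "i \<in> space (count_space C)"
    then have "measure \<mu> (?B i) \<le> measure \<nu> (gradient \<phi>' -` ?B i)"
      using CU by (intro mass_le_conjugate_preimage) auto
    then show "emeasure \<mu> (?B i) \<le> emeasure \<nu> (gradient \<phi>' -` ?B i)"
      by (simp add: src.emeasure_eq_measure tgt.emeasure_eq_measure)
  qed
  also have "\<dots> = emeasure \<nu> (\<Union>i\<in>C. gradient \<phi>' -` ?B i)"
  proof (rule emeasure_UN_countable[symmetric])
    show "gradient \<phi>' -` ?B i \<in> sets \<nu>" if "i \<in> C" for i
      using measurable_sets[OF limit_conjugate_gradient_borel, of "?B i"] by simp
    show "disjoint_family_on (\<lambda>i. gradient \<phi>' -` ?B i) C"
      using disj unfolding disjoint_family_on_def by (metis vimage_Int vimage_empty)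
  qed (rule C)
  also have "\<dots> \<le> emeasure \<nu> (gradient \<phi>' -` U)"
  proof (rule emeasure_mono)
    show "gradient \<phi>' -` U \<in> sets \<nu>"
      using measurable_sets[OF limit_conjugate_gradient_borel, of U] U by simp
  qed (use CU in blast)
  finally show ?thesis .
qed

text \<open>Equal total masses turn the inequality on open sets into the reverse one on closed sets.
  A box and its closure have the same \<open>\<mu>\<close>-mass, which squeezes both measures to
  equality on boxes, an intersection-stable generator.\<close>

lemma conjugate_pushforward: "distr \<nu> borel (gradient \<phi>') = \<mu>"
proof -
  let ?\<rho> = "distr \<nu> borel (gradient \<phi>')"
  have m: "gradient \<phi>' \<in> measurable \<nu> borel" by measurable
  interpret \<rho>: finite_measure ?\<rho> by (rule tgt.finite_measure_distr[OF m])
  have \<rho>: "emeasure ?\<rho> A = emeasure \<nu> (gradient \<phi>' -` A)" if "A \<in> sets borel" for A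
    using emeasure_distr[OF m that] by simp
  have open_le: "measure \<mu> U \<le> measure ?\<rho> U" if "open U" for U
    using mass_le_conjugate_preimage_open[OF that] \<rho>[of U] that
    by (metis borel_open ennreal_le_iff measure_nonneg src.emeasure_eq_measure \<rho>.emeasure_eq_measure)
  have "emeasure ?\<rho> UNIV = emeasure \<mu> UNIV"
    using \<rho>[of UNIV] by (simp add: src.emeasure_M_UNIV tgt.emeasure_M_UNIV mass_eq)
  then have total: "measure ?\<rho> UNIV = measure \<mu> UNIV" by (simp add: measure_def)
  have closed_le: "measure ?\<rho> F \<le> measure \<mu> F" if F: "closed F" for F
  proof -
    have "measure ?\<rho> (- F) = measure ?\<rho> UNIV - measure ?\<rho> F"
      using \<rho>.finite_measure_compl[of F] F by (simp add: Compl_eq_Diff_UNIV)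
    moreover have "measure \<mu> (- F) = measure \<mu> UNIV - measure \<mu> F"
      using src.finite_measure_compl[of F] F by (simp add: Compl_eq_Diff_UNIV)
    ultimately show ?thesis using open_le[of "- F"] F total by (simp add: open_Compl)
  qed
  have box: "emeasure ?\<rho> (box a b) = emeasure \<mu> (box a b)" for a b
  proof -
    have "AE x in lborel. x \<notin> cbox a b - box a b"
    proof (rule AE_not_in)
      have "negligible (cbox a b - box a b)"
        by (rule negligible_frontier_interval)
      then show "cbox a b - box a b \<in> null_sets lborel"
        by (simp add: negligible_iff_null_sets null_sets_completion_iff)
    qed
    then have "AE x in \<mu>. x \<in> cbox a b \<longleftrightarrow> x \<in> box a b"
      by (intro src.AE_M_lborel, eventually_elim) (use box_subset_cbox in blast)
    then have "emeasure \<mu> (cbox a b) = emeasure \<mu> (box a b)"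
      by (rule emeasure_eq_AE) auto
    then have "measure \<mu> (cbox a b) = measure \<mu> (box a b)" by (simp add: measure_def)
    moreover have "measure ?\<rho> (box a b) \<le> measure ?\<rho> (cbox a b)"
      by (intro \<rho>.finite_measure_mono box_subset_cbox) auto
    ultimately have "measure ?\<rho> (box a b) = measure \<mu> (box a b)"
      using open_le[of "box a b"] closed_le[of "cbox a b"] by (simp add: open_box closed_cbox)
    then show ?thesis by (simp add: src.emeasure_eq_measure \<rho>.emeasure_eq_measure)
  qed
  show ?thesis
  proof (rule measure_eqI_generator_eq)
    let ?E = "range (\<lambda>(a, b). box a b :: (real^'n) set)"
    show "Int_stable ?E" by (auto simp: Int_stable_def box_Int_box)
    show "?E \<subseteq> Pow UNIV" "sets ?\<rho> = sigma_sets UNIV ?E" "sets \<mu> = sigma_sets UNIV ?E"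
      by (simp_all add: borel_eq_box)
    let ?A = "\<lambda>n::nat. box (- (real n *\<^sub>R One)) (real n *\<^sub>R One) :: (real^'n) set"
    show "range ?A \<subseteq> ?E" "(\<Union>i. ?A i) = UNIV"
      unfolding UN_box_eq_UNIV by auto
    show "emeasure ?\<rho> (?A i) \<noteq> \<infinity>" for i by simp
    show "emeasure ?\<rho> X = emeasure \<mu> X" if "X \<in> ?E" for X
      using that box by auto
  qed
qed

text \<open>For \<open>\<nu>\<close>-almost every \<open>y\<close> the image under
  \<open>gradient \<phi>'\<close> is a point of \<open>\<Omega>\<close> where \<open>\<phi>\<close>
  is differentiable, since it is distributed as \<open>\<mu>\<close>. There \<open>y\<close> is a
  subgradient relative to the neighbourhood \<open>closure \<Omega>\<close> and so equals the
  gradient; composing push-forwards gives the claim.\<close>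

theorem limit_brenier: "brenier_solution \<Omega> \<Lambda> f g \<phi>"
proof -
  have mc: "gradient \<phi>' \<in> measurable \<nu> borel" by measurable
  have mg: "gradient \<phi> \<in> borel_measurable borel" by (rule borel_measurable_gradient[OF limit_convex])
  have msm: "smooth_points \<phi> \<in> sets borel" by (rule smooth_points_borel[OF limit_convex])
  have "AE x in distr \<nu> borel (gradient \<phi>'). x \<in> \<Omega> \<and> x \<in> smooth_points \<phi>"
    unfolding conjugate_pushforward
    using src.AE_M_in_S src.AE_M_lborel[OF AE_potential_smooth[OF limit_potential]] by eventually_elim simp
  then have "AE y in \<nu>. gradient \<phi>' y \<in> \<Omega> \<and> gradient \<phi>' y \<in> smooth_points \<phi>"
    using msm src.borel_S by (subst (asm) AE_distr_iff[OF mc]) auto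
  moreover have "AE y in \<nu>. y \<in> smooth_points \<phi>'"
    by (rule tgt.AE_M_lborel[OF AE_smooth_points_conjugate_on[OF limit_conjugate]])
  ultimately have inverse: "AE y in \<nu>. gradient \<phi> (gradient \<phi>' y) = y"
  proof eventually_elim
    case (elim y)
    have "y = gradient \<phi> (gradient \<phi>' y)"
      using elim gradient_conjugate_on(2)[OF limit_conjugate elim(2)]
      by (intro local_subgradient_eq_gradient[OF gradient_in_subdifferential(2)[OF limit_convex] source_in_interior]) auto
    then show ?case by simp
  qed
  have "distr \<mu> borel (gradient \<phi>) = distr \<nu> borel (gradient \<phi> \<circ> gradient \<phi>')"
    unfolding conjugate_pushforward[symmetric] by (rule distr_distr[OF mg mc])
  also have "\<dots> = distr \<nu> borel (\<lambda>y. y)"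
    using inverse mg mc by (intro distr_cong_AE) (auto intro: measurable_comp)
  also have "\<dots> = \<nu>" by (rule distr_id2) simp
  finally have "distr \<mu> borel (gradient \<phi>) = \<nu>" .
  with limit_potential limit_0 show ?thesis
    by (simp add: brenier_solution_def potential_def)
qed

end

section \<open>Compactness and convergence of the full sequence\<close>

lemma admissible_subseq:
  assumes "admissible \<Omega> T" "strict_mono r"
  shows "admissible \<Omega> (T \<circ> r)"
proof -
  have lim: "(\<lambda>k. MAX i\<in>{..<nsimp (T k)}. diameter (cell (T k) i)) \<longlonglongrightarrow> 0"
    using assms(1) by (simp add: admissible_def)
  have ev: "\<forall>\<^sub>F k in sequentially. P (r k)" if "\<forall>\<^sub>F k in sequentially. P k" for P
    using that filterlim_subseq[OF assms(2)] by (rule eventually_compose_filterlim)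
  obtain \<Omega>' :: "real \<Rightarrow> (real^'a) set" where \<Omega>':
    "\<forall>\<epsilon>>0. open (\<Omega>' \<epsilon>) \<and> \<Omega>' \<epsilon> \<subseteq> \<Omega>"
    "\<forall>\<epsilon>>0. \<forall>\<delta>>0. \<delta> \<le> \<epsilon> \<longrightarrow> \<Omega>' \<epsilon> \<subseteq> \<Omega>' \<delta>"
    "(\<Union>\<epsilon>\<in>{0<..}. \<Omega>' \<epsilon>) = \<Omega>"
    "\<forall>\<^sub>F \<epsilon> in at_right 0. \<forall>\<^sub>F k in sequentially.
       {x + y |x y. x \<in> \<Omega>' \<epsilon> \<and> y \<in> ball 0 \<epsilon>} \<subseteq> (\<Union>i<nsimp (T k). cell (T k) i)"
    using assms(1) unfolding admissible_def by (elim conjE exE) (rule that, assumption+)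
  have "\<forall>\<^sub>F \<epsilon> in at_right 0. \<forall>\<^sub>F k in sequentially.
       {x + y |x y. x \<in> \<Omega>' \<epsilon> \<and> y \<in> ball 0 \<epsilon>} \<subseteq> (\<Union>i<nsimp ((T \<circ> r) k). cell ((T \<circ> r) k) i)"
    using \<Omega>'(4) unfolding o_def by (rule eventually_mono) (rule ev)
  moreover have "\<forall>k. almost_triangulation \<Omega> ((T \<circ> r) k)"
    using assms(1) by (simp add: admissible_def)
  moreover have "(\<lambda>k. MAX i\<in>{..<nsimp ((T \<circ> r) k)}. diameter (cell ((T \<circ> r) k) i)) \<longlonglongrightarrow> 0"
    using LIMSEQ_subseq_LIMSEQ[OF lim assms(2)] by (simp add: o_def)
  ultimately show ?thesis
    unfolding admissible_def using \<Omega>'(1-3) by blast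
qed

context vanishing_defect
begin

lemma subsequence:
  assumes r: "strict_mono r"
  shows "vanishing_defect \<Omega> \<Lambda> f g (T \<circ> r) (\<psi> \<circ> r) (\<eta> \<circ> r) (defect \<circ> r)"
proof
  show "admissible \<Omega> (T \<circ> r)" by (rule admissible_subseq[OF adm r])
  show "(\<lambda>k. \<Sum>i<nsimp ((T \<circ> r) k). volume ((T \<circ> r) k) i * (defect \<circ> r) k i) \<longlonglongrightarrow> 0"
    using LIMSEQ_subseq_LIMSEQ[OF defect_vanishes r] by (simp add: o_def)
qed (use dconvex hess_psd defect_nonneg defect_bound in auto)

text \<open>Convergence is obtained on the whole space, not only on \<open>closure \<Omega>\<close>:
  convexity and the subdifferential constraint of a Brenier solution are global.\<close>

lemma convergent_subsequence:
  obtains r \<phi> where "strict_mono (r :: nat \<Rightarrow> nat)" "\<And>x. (\<lambda>k. \<Phi> (r k) x) \<longlonglongrightarrow> \<phi> x"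
proof -
  have lip: "rad-lipschitz_on UNIV (\<Phi> k)" for k by (rule \<Phi>_lipschitz) (use rad in auto)
  obtain D :: "(real^'n) set" where D: "countable D" "\<And>X. open X \<Longrightarrow> X \<noteq> {} \<Longrightarrow> \<exists>d\<in>D. d \<in> X"
    by (rule countable_dense_setE) blast
  \<comment> \<open>All potentials vanish at 0 and are \<open>rad\<close>-Lipschitz, so this weight
    bounds them by one constant on the unbounded set \<open>D\<close>, as the diagonal argument
    requires.\<close>
  define F where "F k x = \<Phi> k x / (1 + norm x)" for k x
  have pos: "1 + norm x > 0" for x :: "real^'n" by (simp add: add_pos_nonneg)
  have "norm (F k x) \<le> rad" for k x
  proof -
    have "\<bar>\<Phi> k x\<bar> \<le> rad * norm x"
      using lipschitz_onD[OF lip, of x 0 k] by simp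
    also have "\<dots> \<le> rad * (1 + norm x)" using rad(1) by simp
    finally show ?thesis using pos[of x] by (simp add: F_def field_simps)
  qed
  then obtain r where r: "strict_mono (r :: nat \<Rightarrow> nat)" "\<And>x. x \<in> D \<Longrightarrow> \<exists>l. (\<lambda>k. F (r k) x) \<longlonglongrightarrow> l"
    using function_convergent_subsequence[OF D(1), of F rad] by metis
  have conv: "convergent (\<lambda>k. \<Phi> (r k) x)" for x
  proof (rule Cauchy_convergent, rule metric_CauchyI)
    fix e :: real assume e: "e > 0"
    have "e / (4 * rad) > 0" using e rad(1) by simp
    then have "x \<in> ball x (e / (4 * rad))" by simp
    then have "ball x (e / (4 * rad)) \<noteq> {}" by blast
    then obtain d where d: "d \<in> D" "dist x d < e / (4 * rad)" using D(2)[OF open_ball] by auto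
    then have xd: "rad * dist x d < e / 4" using rad(1) by (simp add: field_simps)
    obtain l where "(\<lambda>k. F (r k) d) \<longlonglongrightarrow> l" using r(2)[OF d(1)] by blast
    then have "(\<lambda>k. F (r k) d * (1 + norm d)) \<longlonglongrightarrow> l * (1 + norm d)" by (intro tendsto_intros)
    then have "convergent (\<lambda>k. \<Phi> (r k) d)" using pos[of d] by (auto simp: F_def convergent_def)
    then have "Cauchy (\<lambda>k. \<Phi> (r k) d)" by (rule convergent_Cauchy)
    then obtain M where M: "\<And>m n. m \<ge> M \<Longrightarrow> n \<ge> M \<Longrightarrow> dist (\<Phi> (r m) d) (\<Phi> (r n) d) < e / 2"
      using metric_CauchyD[of "\<lambda>k. \<Phi> (r k) d" "e / 2"] e by auto
    have "dist (\<Phi> (r m) x) (\<Phi> (r n) x) < e" if "m \<ge> M" "n \<ge> M" for m n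
    proof -
      have "dist (\<Phi> (r k) x) (\<Phi> (r k) d) < e / 4" for k
        using lipschitz_onD[OF lip, of x d "r k"] xd by simp
      from this[of m] this[of n] M[OF that] show ?thesis unfolding dist_real_def by linarith
    qed
    then show "\<exists>M. \<forall>m\<ge>M. \<forall>n\<ge>M. dist (\<Phi> (r m) x) (\<Phi> (r n) x) < e" by blast
  qed
  show ?thesis
    by (rule that[OF r(1), of "\<lambda>x. lim (\<lambda>k. \<Phi> (r k) x)"]) (use conv in \<open>simp add: convergent_LIMSEQ_iff\<close>)
qed

lemma brenier_subsequence:
  obtains r \<phi> where "strict_mono (r :: nat \<Rightarrow> nat)" "brenier_solution \<Omega> \<Lambda> f g \<phi>"
    "uniform_limit (closure \<Omega>) (\<lambda>k. \<Phi> (r k)) \<phi> sequentially"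
proof -
  obtain r \<phi> where r: "strict_mono (r :: nat \<Rightarrow> nat)" "\<And>x. (\<lambda>k. \<Phi> (r k) x) \<longlonglongrightarrow> \<phi> x"
    using convergent_subsequence by blast
  interpret S: vanishing_defect \<Omega> \<Lambda> f g "T \<circ> r" "\<psi> \<circ> r" "\<eta> \<circ> r" "defect \<circ> r"
    by (rule subsequence[OF r(1)])
  interpret L: vanishing_defect_limit \<Omega> \<Lambda> f g "T \<circ> r" "\<psi> \<circ> r" "\<eta> \<circ> r" "defect \<circ> r" \<phi>
    by unfold_locales (use r(2) in simp)
  show ?thesis
    by (rule that[OF r(1) L.limit_brenier]) (use L.limit_uniform in simp)
qed

theorem converges_to_brenier:
  "\<exists>\<phi>. brenier_solution \<Omega> \<Lambda> f g \<phi> \<and> (\<forall>\<phi>'. brenier_solution \<Omega> \<Lambda> f g \<phi>' \<longrightarrow> \<phi>' = \<phi>) \<and>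
     uniform_limit (closure \<Omega>) \<Phi> \<phi> sequentially"
proof -
  obtain \<phi> where \<phi>: "brenier_solution \<Omega> \<Lambda> f g \<phi>" using brenier_subsequence by blast
  have "uniform_limit (closure \<Omega>) \<Phi> \<phi> sequentially"
  proof (rule uniform_limitI, rule ccontr)
    fix e :: real assume e: "e > 0"
      and "\<not> (\<forall>\<^sub>F k in sequentially. \<forall>x\<in>closure \<Omega>. dist (\<Phi> k x) (\<phi> x) < e)"
    then have "infinite {k. \<not> (\<forall>x\<in>closure \<Omega>. dist (\<Phi> k x) (\<phi> x) < e)}"
      by (simp add: cofinite_eq_sequentially[symmetric] eventually_cofinite)
    from infinite_enumerate[OF this]
    obtain r :: "nat \<Rightarrow> nat" where r: "strict_mono r"
      "\<forall>k. r k \<in> {k. \<not> (\<forall>x\<in>closure \<Omega>. dist (\<Phi> k x) (\<phi> x) < e)}"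
      by (elim exE conjE)
    interpret S: vanishing_defect \<Omega> \<Lambda> f g "T \<circ> r" "\<psi> \<circ> r" "\<eta> \<circ> r" "defect \<circ> r"
      by (rule subsequence[OF r(1)])
    \<comment> \<open>A subsequence staying away from \<open>\<phi>\<close> would itself have a
      subsequence converging to a Brenier solution, which by uniqueness is
      \<open>\<phi>\<close>.\<close>
    obtain s \<phi>2 where s: "strict_mono (s :: nat \<Rightarrow> nat)" "brenier_solution \<Omega> \<Lambda> f g \<phi>2"
      "uniform_limit (closure \<Omega>) (\<lambda>k. optimization_potential ((T \<circ> r) (s k)) ((\<psi> \<circ> r) (s k), (\<eta> \<circ> r) (s k))) \<phi>2 sequentially"
      by (rule S.brenier_subsequence)
    have "\<phi>2 = \<phi>" by (rule brenier_solution_unique[OF s(2) \<phi>])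
    from uniform_limitD[OF s(3) e] have "\<forall>\<^sub>F k in sequentially. \<forall>x\<in>closure \<Omega>. dist (\<Phi> (r (s k)) x) (\<phi> x) < e"
      unfolding \<open>\<phi>2 = \<phi>\<close> by simp
    then obtain k where "\<forall>x\<in>closure \<Omega>. dist (\<Phi> (r (s k)) x) (\<phi> x) < e"
      using eventually_happens'[OF trivial_limit_sequentially] by blast
    with r(2) show False by blast
  qed
  with \<phi> brenier_solution_unique show ?thesis by blast
qed

end

section \<open>From the optimization problems to vanishing defect\<close>

lemma minimal_costs_tend_to_zero:
  assumes "\<And>k. is_arg_min (cost k) (feasible k) (z k)" "(\<lambda>k. optimal_cost (cost k) (feasible k)) \<longlonglongrightarrow> 0"
  shows "(\<lambda>k. cost k (z k) :: real) \<longlonglongrightarrow> 0"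
proof -
  have "optimal_cost (cost k) (feasible k) = cost k (z k)" for k
    unfolding optimal_cost_def
    using assms(1)[of k] by (intro cInf_eq_minimum) (auto simp: is_arg_min_def not_less)
  with assms(2) show ?thesis by simp
qed

text \<open>In both bounds \<open>q\<close> is \<open>f / g\<close> and \<open>d\<close> the determinant of the discrete Hessian. For \<open>c \<ge> root n q\<close>
  the second one is trivial; otherwise it is Bernoulli's inequality.\<close>

lemma log_defect_bound:
  fixes q d c :: real
  assumes "q > 0" "d \<noteq> 0" "ln q - ln d \<le> c"
  shows "q \<le> \<bar>d\<bar> + q * c"
proof -
  \<comment> \<open>The real logarithm used here is even, which is why the conclusion carries
    \<open>\<bar>d\<bar>\<close>.\<close>
  have "ln d = ln \<bar>d\<bar>" using ln_minus[of d] by (simp add: abs_if)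
  then have "ln q + - c \<le> ln \<bar>d\<bar>" using assms(3) by simp
  then have "exp (ln q + - c) \<le> \<bar>d\<bar>" using assms(2) by (simp add: ln_ge_iff)
  then have "q * exp (- c) \<le> \<bar>d\<bar>" using assms(1) by (simp only: exp_add exp_ln)
  moreover have "q * (1 + - c) \<le> q * exp (- c)"
    using assms(1) exp_ge_add_one_self[of "- c"] by (intro mult_left_mono) auto
  ultimately show ?thesis by (simp add: algebra_simps)
qed

lemma root_defect_bound:
  fixes q d c :: real
  assumes n: "n > 0" and q: "q \<ge> 0" and c: "c \<ge> 0" "root n q - root n d \<le> c"
  shows "q \<le> \<bar>d\<bar> + real n * root n q ^ (n - 1) * c"
proof -
  define a where "a = root n q"
  have a: "a \<ge> 0" "a ^ n = q" using n q by (auto simp: a_def)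
  have an: "a ^ n = a ^ (n - 1) * a" using n by (metis Suc_diff_1 power_Suc2)
  show ?thesis
  proof (cases "c \<ge> a")
    case True
    have "q \<le> a ^ (n - 1) * c" unfolding a(2)[symmetric] an using True a(1) by (intro mult_left_mono) auto
    also have "\<dots> \<le> real n * (a ^ (n - 1) * c)"
      using n a(1) c(1) mult_right_mono[of 1 "real n" "a ^ (n - 1) * c"] by simp
    finally show ?thesis by (simp add: a_def mult.assoc)
  next
    case False
    then have apos: "a > 0" using c(1) by simp
    have "a - c \<le> root n d" using c(2) by (simp add: a_def)
    then have rd: "root n d > 0" using False by simp
    then have "d > 0" using n by (simp add: real_root_gt_0_iff)
    \<comment> \<open>The left side is the tangent of \<open>t ^ n\<close> at \<open>a\<close>,
      evaluated at \<open>a - c\<close>; hence the factor \<open>n * a ^ (n - 1)\<close> in the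
      bound.\<close>
    have "a ^ n - real n * a ^ (n - 1) * c = a ^ n * (1 + real n * (- (c / a)))"
      using apos by (simp add: an algebra_simps)
    also have "\<dots> \<le> a ^ n * (1 + - (c / a)) ^ n"
      using False apos a(1) by (intro mult_left_mono Bernoulli_inequality) auto
    also have "\<dots> = (a - c) ^ n" using apos by (simp add: field_simps flip: power_mult_distrib)
    also have "\<dots> \<le> root n d ^ n" using False \<open>a - c \<le> root n d\<close> by (intro power_mono) auto
    also have "\<dots> = d" using n \<open>d > 0\<close> by simp
    finally show ?thesis using \<open>d > 0\<close> a(2) by (simp add: a_def)
  qed
qed

theorem theorem6:
  fixes \<Omega> \<Lambda> :: "(real ^ 'n::finite) set"
    and f g :: "real ^ 'n \<Rightarrow> real"
    and T :: "nat \<Rightarrow> 'n simplices"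
    and z :: "nat \<Rightarrow> (nat \<Rightarrow> real) \<times> (nat \<Rightarrow> real ^ 'n)"
  assumes "bounded \<Omega>" "open \<Omega>" "0 \<in> \<Omega>"
    and "bounded \<Lambda>" "open \<Lambda>" "convex \<Lambda>"
    and "continuous_on (closure \<Omega>) f" "continuous_on (closure \<Lambda>) g"
    and "\<exists>c C. 0 < c \<and> (\<forall>x\<in>closure \<Omega>. c \<le> f x \<and> f x \<le> C)"
    and "\<exists>c C. 0 < c \<and> (\<forall>y\<in>closure \<Lambda>. c \<le> g y \<and> g y \<le> C)"
    and "(LINT x:\<Omega>|lborel. f x) = (LINT y:\<Lambda>|lborel. g y)"
    and "admissible \<Omega> T"
    and "((\<forall>k. is_arg_min (ldmaop_cost f g (T k)) (ldmaop_feasible \<Lambda> (T k)) (z k)) \<and>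
            (\<lambda>k. optimal_cost (ldmaop_cost f g (T k)) (ldmaop_feasible \<Lambda> (T k))) \<longlonglongrightarrow> 0)
       \<or> ((\<forall>k. is_arg_min (dmaop_cost f g (T k)) (dmaop_feasible \<Lambda> (T k)) (z k)) \<and>
            (\<lambda>k. optimal_cost (dmaop_cost f g (T k)) (dmaop_feasible \<Lambda> (T k))) \<longlonglongrightarrow> 0)"
  shows "\<exists>\<phi>. brenier_solution \<Omega> \<Lambda> f g \<phi> \<and>
             (\<forall>\<phi>'. brenier_solution \<Omega> \<Lambda> f g \<phi>' \<longrightarrow> \<phi>' = \<phi>) \<and>
             uniform_limit (closure \<Omega>) (\<lambda>k. optimization_potential (T k) (z k)) \<phi> sequentially"
proof -
  define \<psi> where "\<psi> k = fst (z k)" for k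
  define \<eta> where "\<eta> k = snd (z k)" for k
  have z: "z k = (\<psi> k, \<eta> k)" for k by (simp add: \<psi>_def \<eta>_def)
  interpret mass_transport \<Omega> \<Lambda> f g
    by unfold_locales (use assms(1-11) in auto)
  obtain cf Cf where Cf: "0 < cf" "\<And>x. x \<in> closure \<Omega> \<Longrightarrow> cf \<le> f x \<and> f x \<le> Cf" using assms(9) by blast
  obtain cg Cg where cg: "0 < cg" "\<And>y. y \<in> closure \<Lambda> \<Longrightarrow> cg \<le> g y \<and> g y \<le> Cg" using assms(10) by blast
  \<comment> \<open>A point of \<open>closure \<Omega>\<close> is wanted to see that
    \<open>cf \<le> Cf\<close>.\<close>
  have "0 \<in> closure \<Omega>" using assms(3) closure_subset by blast
  then have Cfg: "Cf / cg \<ge> 0" using Cf(1) Cf(2)[of 0] cg(1) by simp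
  let ?mf = "\<lambda>k i. f (vertex_mean (T k) (pt (T k)) i)" and ?mg = "\<lambda>k i. g (vertex_mean (T k) (\<eta> k) i)"
  let ?q = "\<lambda>k i. ?mf k i / ?mg k i" and ?H = "\<lambda>k i. hess (T k) (\<eta> k) i"
  have AT: "almost_triangulation \<Omega> (T k)" for k using assms(12) by (simp add: admissible_def)
  have f: "cf \<le> ?mf k i" "?mf k i \<le> Cf" if "i < nsimp (T k)" for k i
  proof -
    have "vertex_mean (T k) (pt (T k)) i \<in> cell (T k) i"
      using vertex_in_cell by (intro vertex_mean_in_convex) (auto simp: cell_def)
    moreover have "cell (T k) i \<subseteq> closure \<Omega>" using AT[of k] that by (simp add: almost_triangulation_def)
    ultimately show "cf \<le> ?mf k i" "?mf k i \<le> Cf" using Cf(2) by blast+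
  qed
  have g: "cg \<le> ?mg k i" if "discrete_convex \<Lambda> (T k) (\<psi> k) (\<eta> k)" "i < nsimp (T k)" for k i
  proof -
    have "\<eta> k (vert (T k) i j) \<in> closure \<Lambda>" for j
      using that(1) vert_npts[OF AT that(2)] by (simp add: discrete_convex_def)
    then have "vertex_mean (T k) (\<eta> k) i \<in> closure \<Lambda>"
      by (intro vertex_mean_in_convex convex_closure assms(6))
    then show ?thesis using cg(2) by blast
  qed
  have q: "0 < ?q k i" "?q k i \<le> Cf / cg" "?mf k i = ?mg k i * ?q k i"
    if "discrete_convex \<Lambda> (T k) (\<psi> k) (\<eta> k)" "i < nsimp (T k)" for k i
    using f[OF that(2)] g[OF that] Cf(1) cg(1) by (auto intro!: frac_le)
  \<comment> \<open>Both problems end here: \<open>c\<close> is the defect term in the summands of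
    the respective cost, and the constant \<open>A\<close> absorbs a factor depending on
    \<open>f / g\<close>, which is bounded over all cells and all \<open>k\<close>.\<close>
  have concl: ?thesis
    if dc: "\<And>k. discrete_convex \<Lambda> (T k) (\<psi> k) (\<eta> k)"
      and psd: "\<And>k i. i < nsimp (T k) \<Longrightarrow> pos_semidef (?H k i)"
      and c: "\<And>k i. c k i \<ge> 0" "A \<ge> 0" "\<And>k i. i < nsimp (T k) \<Longrightarrow> ?q k i \<le> \<bar>det (?H k i)\<bar> + A * c k i"
      and lim: "(\<lambda>k. \<Sum>i<nsimp (T k). volume (T k) i * c k i) \<longlonglongrightarrow> 0"
    for c :: "nat \<Rightarrow> nat \<Rightarrow> real" and A
  proof -
    interpret vanishing_defect \<Omega> \<Lambda> f g T \<psi> \<eta> "\<lambda>k i. A * c k i"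
    proof
      fix k i assume i: "i < nsimp (T k)"
      show "?mf k i \<le> ?mg k i * (\<bar>det (?H k i)\<bar> + A * c k i)"
        using mult_left_mono[OF c(3)[OF i], of "?mg k i"] q(3)[OF dc i] g[OF dc i] cg(1) by linarith
    next
      have "(\<lambda>k. A * (\<Sum>i<nsimp (T k). volume (T k) i * c k i)) \<longlonglongrightarrow> A * 0"
        by (intro tendsto_intros lim)
      then show "(\<lambda>k. \<Sum>i<nsimp (T k). volume (T k) i * (A * c k i)) \<longlonglongrightarrow> 0"
        by (simp add: sum_distrib_left mult.left_commute)
    qed (use assms(12) dc psd c in auto)
    show ?thesis using converges_to_brenier unfolding z .
  qed
  from assms(13) show ?thesis
  proof
    assume L: "(\<forall>k. is_arg_min (ldmaop_cost f g (T k)) (ldmaop_feasible \<Lambda> (T k)) (z k)) \<and>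
            (\<lambda>k. optimal_cost (ldmaop_cost f g (T k)) (ldmaop_feasible \<Lambda> (T k))) \<longlonglongrightarrow> 0"
    then have feas: "discrete_convex \<Lambda> (T k) (\<psi> k) (\<eta> k)" "i < nsimp (T k) \<Longrightarrow> pos_def (?H k i)" for k i
      by (auto simp: is_arg_min_def ldmaop_feasible_def z)
    define c where "c k i = max 0 (- ln (det (?H k i)) - ln (?mg k i) + ln (?mf k i))" for k i
    have "(\<lambda>k. ldmaop_cost f g (T k) (z k)) \<longlonglongrightarrow> 0"
      by (rule minimal_costs_tend_to_zero[where feasible = "\<lambda>k. ldmaop_feasible \<Lambda> (T k)"]) (use L in auto)
    then have lim: "(\<lambda>k. \<Sum>i<nsimp (T k). volume (T k) i * c k i) \<longlonglongrightarrow> 0"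
      by (simp add: ldmaop_cost_def z c_def)
    show ?thesis
    proof (rule concl[where c = c and A = "Cf / cg"])
      fix k i assume i: "i < nsimp (T k)"
      show "pos_semidef (?H k i)"
        using feas(2)[OF i] unfolding pos_def_def pos_semidef_def
        by (metis inner_zero_left less_imp_le order_refl)
      have "det (?H k i) \<noteq> 0"
        using pos_def_invertible[OF feas(2)[OF i]] by (simp add: invertible_det_nz)
      moreover have "ln (?q k i) = ln (?mf k i) - ln (?mg k i)"
        using f(1)[OF i] g[OF feas(1) i] Cf(1) cg(1) by (subst ln_div) auto
      then have "ln (?q k i) - ln (det (?H k i)) \<le> c k i" by (simp add: c_def)
      ultimately have "?q k i \<le> \<bar>det (?H k i)\<bar> + ?q k i * c k i"
        using log_defect_bound q(1)[OF feas(1) i] by blast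
      also have "?q k i * c k i \<le> Cf / cg * c k i"
        using q(2)[OF feas(1) i] by (intro mult_right_mono) (auto simp: c_def)
      finally show "?q k i \<le> \<bar>det (?H k i)\<bar> + Cf / cg * c k i" by simp
    next
      show "Cf / cg \<ge> 0" by (rule Cfg)
    qed (use feas lim in \<open>auto simp: c_def\<close>)
  next
    assume D: "(\<forall>k. is_arg_min (dmaop_cost f g (T k)) (dmaop_feasible \<Lambda> (T k)) (z k)) \<and>
            (\<lambda>k. optimal_cost (dmaop_cost f g (T k)) (dmaop_feasible \<Lambda> (T k))) \<longlonglongrightarrow> 0"
    then have feas: "discrete_convex \<Lambda> (T k) (\<psi> k) (\<eta> k)" "i < nsimp (T k) \<Longrightarrow> pos_semidef (?H k i)" for k i
      by (auto simp: is_arg_min_def dmaop_feasible_def z)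
    let ?n = "CARD('n)"
    define c where "c k i = max 0 (- root ?n (det (?H k i)) + root ?n (?q k i))" for k i
    have "(\<lambda>k. dmaop_cost f g (T k) (z k)) \<longlonglongrightarrow> 0"
      by (rule minimal_costs_tend_to_zero[where feasible = "\<lambda>k. dmaop_feasible \<Lambda> (T k)"]) (use D in auto)
    then have lim: "(\<lambda>k. \<Sum>i<nsimp (T k). volume (T k) i * c k i) \<longlonglongrightarrow> 0"
      by (simp add: dmaop_cost_def z c_def)
    show ?thesis
    \<comment> \<open>The factor in \<open>root_defect_bound\<close> is nondecreasing in
      \<open>f / g\<close>, so its value at the upper bound \<open>Cf / cg\<close> serves for all
      cells.\<close>
    proof (rule concl[where c = c and A = "real ?n * root ?n (Cf / cg) ^ (?n - 1)"])
      fix k i assume i: "i < nsimp (T k)"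
      have "?q k i \<le> \<bar>det (?H k i)\<bar> + real ?n * root ?n (?q k i) ^ (?n - 1) * c k i"
        using q(1)[OF feas(1) i] by (intro root_defect_bound) (auto simp: c_def)
      also have "real ?n * root ?n (?q k i) ^ (?n - 1) * c k i \<le> real ?n * root ?n (Cf / cg) ^ (?n - 1) * c k i"
        using q(1,2)[OF feas(1) i]
        by (intro mult_right_mono mult_left_mono power_mono) (auto simp: c_def)
      finally show "?q k i \<le> \<bar>det (?H k i)\<bar> + real ?n * root ?n (Cf / cg) ^ (?n - 1) * c k i" by simp
    next
      show "real ?n * root ?n (Cf / cg) ^ (?n - 1) \<ge> 0" using Cfg by simp
    qed (use feas lim in \<open>auto simp: c_def\<close>)
  qed
qed

end
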